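(* There is a randomized $O^{\star}(k^{O(k^2)})$-time algorithm to solve \textsc{MoV Fair Matching}, where $k=|V|$ is the number of vertices on the right side of the input bipartite graph; this holds also for \textsc{MoV Fair Matching} with the non-emptiness constraint.
   Context: Let $G=(U\cup V,E)$ be a bipartite graph with left side $U$ and right side $V$ ($U\cap V=\emptyset$); write $n=|U|$ and $k=|V|$. For a vertex $w$ and $M\subseteq E$, let $M(w)=\{w' \mid \{w,w'\}\in M\}$. A many-to-one matching is a set $M\subseteq E$ with $|M(u)|\le 1$ for every $u\in U$; it is left-perfect if $|M(u)|=1$ for every $u\in U$. Let $C$ be a finite set of colors and $\mathrm{col}\colon U\to C$; for $U'\subseteq U$ and $c\in C$ let $U'_c=\{u\in U'\mid \mathrm{col}(u)=c\}$. The margin of victory $\mathrm{MoV}(U')$ is the largest value minus the second largest value in the list $(|U'_c|)_{c\in C}$ (values counted with multiplicity, colors absent from $U'$ counting $0$). For an integer $\ell\ge 0$, $U'$ is $\ell$-fair if $\mathrm{MoV}(U')\le\ell$, and $M$ is $\ell$-fair if $M(v)$ is $\ell$-fair for every $v\in V$. \textsc{MoV Fair Matching}: given $G$, $C$, $\mathrm{col}$, $\ell\in\mathbb{N}$, decide whether there is a left-perfect many-to-one matching in $G$ that is $\ell$-fair. With the non-emptiness constraint one additionally requires $M(v)\neq\emptyset$ for every $v\in V$. The notation $O^{\star}(\cdot)$ suppresses factors polynomial in the input size. *)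

theory Defs
  imports
    "HOL-Probability.SPMF"
    "HOL-Library.Landau_Symbols"
    "HOL-Library.Log_Nat"
    "HOL-Library.Multiset"
    "HOL-Computational_Algebra.Polynomial"
begin

section \<open>MoV Fair Matching\<close>

definition bipartite_graph :: "'v set \<Rightarrow> 'v set \<Rightarrow> 'v set set \<Rightarrow> bool" where
  "bipartite_graph U V E \<longleftrightarrow>
     finite U \<and> finite V \<and> U \<inter> V = {} \<and> E \<subseteq> {{u, v} | u v. u \<in> U \<and> v \<in> V}"

definition partners :: "'v set set \<Rightarrow> 'v \<Rightarrow> 'v set" where
  "partners M w = {w'. {w, w'} \<in> M}"

definition many_to_one_matching :: "'v set \<Rightarrow> 'v set set \<Rightarrow> 'v set set \<Rightarrow> bool" where
  "many_to_one_matching U E M \<longleftrightarrow> M \<subseteq> E \<and> (\<forall>u\<in>U. card (partners M u) \<le> 1)"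

definition left_perfect :: "'v set \<Rightarrow> 'v set set \<Rightarrow> bool" where
  "left_perfect U M \<longleftrightarrow> (\<forall>u\<in>U. card (partners M u) = 1)"

definition color_class :: "('v \<Rightarrow> 'c) \<Rightarrow> 'v set \<Rightarrow> 'c \<Rightarrow> 'v set" where
  "color_class col U' c = {u \<in> U'. col u = c}"

text \<open>
  The counts, one per color of \<open>C\<close>, are listed in non-increasing order. A missing second entry
  (only one color) is read as \<open>0\<close>, which agrees with adding a color that is never used.
\<close>

definition MoV :: "'c set \<Rightarrow> ('v \<Rightarrow> 'c) \<Rightarrow> 'v set \<Rightarrow> nat" where
  "MoV C col U' =
     (case rev (sorted_list_of_multiset
                 (image_mset (\<lambda>c. card (color_class col U' c)) (mset_set C))) of
        [] \<Rightarrow> 0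
      | [a] \<Rightarrow> a
      | a # b # _ \<Rightarrow> a - b)"

definition fair_set :: "'c set \<Rightarrow> ('v \<Rightarrow> 'c) \<Rightarrow> nat \<Rightarrow> 'v set \<Rightarrow> bool" where
  "fair_set C col l U' \<longleftrightarrow> MoV C col U' \<le> l"

definition fair_matching ::
  "'v set \<Rightarrow> 'c set \<Rightarrow> ('v \<Rightarrow> 'c) \<Rightarrow> nat \<Rightarrow> 'v set set \<Rightarrow> bool" where
  "fair_matching V C col l M \<longleftrightarrow> (\<forall>v\<in>V. fair_set C col l (partners M v))"

record ('v, 'c) mov_instance =
  left_side :: "'v set"
  right_side :: "'v set"
  edges :: "'v set set"
  colors :: "'c set"
  coloring :: "'v \<Rightarrow> 'c"
  fairness :: nat

definition valid_instance :: "('v, 'c) mov_instance \<Rightarrow> bool" where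
  "valid_instance I \<longleftrightarrow>
     bipartite_graph (left_side I) (right_side I) (edges I) \<and>
     finite (colors I) \<and> coloring I ` left_side I \<subseteq> colors I"

definition MoV_solution :: "('v, 'c) mov_instance \<Rightarrow> 'v set set \<Rightarrow> bool" where
  "MoV_solution I M \<longleftrightarrow>
     many_to_one_matching (left_side I) (edges I) M \<and>
     left_perfect (left_side I) M \<and>
     fair_matching (right_side I) (colors I) (coloring I) (fairness I) M"

definition MoV_Fair_Matching :: "('v, 'c) mov_instance \<Rightarrow> bool" where
  "MoV_Fair_Matching I \<longleftrightarrow> (\<exists>M. MoV_solution I M)"

definition MoV_Fair_Matching_nonempty :: "('v, 'c) mov_instance \<Rightarrow> bool" where
  "MoV_Fair_Matching_nonempty I \<longleftrightarrow>
     (\<exists>M. MoV_solution I M \<and> (\<forall>v\<in>right_side I. partners M v \<noteq> {}))"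


section \<open>Randomized random access machines with logarithmic cost\<close>

text \<open>
  Programs are structured RAM programs over one memory of natural numbers indexed by addresses;
  \<open>Mem\<close> gives indirect addressing. Tests are for being nonzero, and subtraction is truncated.
  An evaluation costs the total bit length of all values that occur in it (operands, addresses
  and results). Charging bit lengths is what makes multiplication and division admissible as
  primitives: running time is polynomially related to that of a (randomized) Turing machine.
\<close>

datatype expr =
    Num nat
  | Mem expr
  | Plus expr expr
  | Minus expr expr
  | Times expr expr
  | Div expr expr

datatype com =
    Skip
  | Assign expr expr  \<comment> \<open>the first expression computes the target address\<close>
  | Flip expr         \<comment> \<open>stores one fair random bit at the given address\<close>
  | Seq com com
  | If expr com com
  | While expr com

type_synonym memory = "nat \<Rightarrow> nat"

definition bit_size :: "nat \<Rightarrow> nat" where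
  "bit_size n = floorlog 2 n + 1"

primrec eval_expr :: "expr \<Rightarrow> memory \<Rightarrow> nat" where
  "eval_expr (Num n) s = n"
| "eval_expr (Mem a) s = s (eval_expr a s)"
| "eval_expr (Plus a b) s = eval_expr a s + eval_expr b s"
| "eval_expr (Minus a b) s = eval_expr a s - eval_expr b s"
| "eval_expr (Times a b) s = eval_expr a s * eval_expr b s"
| "eval_expr (Div a b) s = eval_expr a s div eval_expr b s"

primrec cost_expr :: "expr \<Rightarrow> memory \<Rightarrow> nat" where
  "cost_expr (Num n) s = bit_size n"
| "cost_expr (Mem a) s = cost_expr a s + bit_size (eval_expr (Mem a) s)"
| "cost_expr (Plus a b) s = cost_expr a s + cost_expr b s + bit_size (eval_expr (Plus a b) s)"
| "cost_expr (Minus a b) s = cost_expr a s + cost_expr b s + bit_size (eval_expr (Minus a b) s)"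
| "cost_expr (Times a b) s = cost_expr a s + cost_expr b s + bit_size (eval_expr (Times a b) s)"
| "cost_expr (Div a b) s = cost_expr a s + cost_expr b s + bit_size (eval_expr (Div a b) s)"

text \<open>
  The joint distribution of final memory and running time. The missing mass of the
  subprobability distribution is the probability of not terminating.
\<close>

partial_function (spmf) exec :: "com \<Rightarrow> memory \<Rightarrow> (memory \<times> nat) spmf" where
  "exec c s =
     (case c of
        Skip \<Rightarrow> return_spmf (s, 1)
      | Assign a e \<Rightarrow>
          return_spmf (s(eval_expr a s := eval_expr e s), cost_expr a s + cost_expr e s)
      | Flip a \<Rightarrow>
          map_spmf (\<lambda>b. (s(eval_expr a s := of_bool b), cost_expr a s + 1)) coin_spmf
      | Seq c1 c2 \<Rightarrow>
          bind_spmf (exec c1 s) (\<lambda>(s1, t1).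
            map_spmf (\<lambda>(s2, t2). (s2, t1 + t2)) (exec c2 s1))
      | If e c1 c2 \<Rightarrow>
          map_spmf (\<lambda>(s', t). (s', cost_expr e s + t))
            (if eval_expr e s \<noteq> 0 then exec c1 s else exec c2 s)
      | While e c1 \<Rightarrow>
          (if eval_expr e s \<noteq> 0
           then bind_spmf (exec c1 s) (\<lambda>(s1, t1).
                  map_spmf (\<lambda>(s2, t2). (s2, cost_expr e s + t1 + t2)) (exec (While e c1) s1))
           else return_spmf (s, cost_expr e s)))"

definition load_input :: "nat list \<Rightarrow> memory" where
  "load_input x i = (if i < length x then x ! i else 0)"

definition input_size :: "nat list \<Rightarrow> nat" where
  "input_size x = (\<Sum>a\<leftarrow>x. bit_size a)"

text \<open>
  Bounded error: the program halts almost surely, every halting run respects the time bound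
  \<open>T\<close>, and the answer left in cell \<open>0\<close> (nonzero for yes) is right with probability at least
  \<open>2/3\<close>.
\<close>

definition randomized_decides :: "com \<Rightarrow> nat list \<Rightarrow> bool \<Rightarrow> nat \<Rightarrow> bool" where
  "randomized_decides c x answer T \<longleftrightarrow>
     lossless_spmf (exec c (load_input x)) \<and>
     (\<forall>(s, t) \<in> set_spmf (exec c (load_input x)). t \<le> T) \<and>
     measure (measure_spmf (exec c (load_input x))) {(s, t). (s 0 \<noteq> 0) = answer} \<ge> 2/3"


section \<open>Encoding of instances\<close>

text \<open>
  Vertices and colors of an encoded instance are arbitrary numbers, listed in an arbitrary order.
  Since sizes are measured in bits, \<open>fairness\<close> is given in binary.
\<close>

definition encodes :: "nat list \<Rightarrow> (nat, nat) mov_instance \<Rightarrow> bool" where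
  "encodes x I \<longleftrightarrow>
     (\<exists>us vs es cs.
        distinct us \<and> set us = left_side I \<and>
        distinct vs \<and> set vs = right_side I \<and>
        distinct es \<and> set es \<subseteq> left_side I \<times> right_side I \<and>
        (\<lambda>(u, v). {u, v}) ` set es = edges I \<and>
        distinct cs \<and> set cs = colors I \<and>
        x = [length us, length vs, length es, length cs, fairness I]
            @ us @ map (coloring I) us @ vs @ concat (map (\<lambda>(u, v). [u, v]) es) @ cs)"

lemma valid_instance_has_encoding:
  assumes "valid_instance I"
  shows "\<exists>x. encodes x I"
proof -
  have fin: "finite (left_side I)" "finite (right_side I)" "finite (colors I)"
    and sub: "edges I \<subseteq> (\<lambda>(u, v). {u, v}) ` (left_side I \<times> right_side I)"
    using assms by (auto simp: valid_instance_def bipartite_graph_def)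
  obtain us where "set us = left_side I" "distinct us"
    using finite_distinct_list[OF fin(1)] by blast
  moreover obtain vs where "set vs = right_side I" "distinct vs"
    using finite_distinct_list[OF fin(2)] by blast
  moreover obtain cs where "set cs = colors I" "distinct cs"
    using finite_distinct_list[OF fin(3)] by blast
  moreover obtain P where P: "P \<subseteq> left_side I \<times> right_side I" "edges I = (\<lambda>(u, v). {u, v}) ` P"
    using sub by (auto simp: subset_image_iff)
  moreover have "finite P"
    using P(1) fin by (meson finite_SigmaI finite_subset)
  then obtain es where "set es = P" "distinct es"
    using finite_distinct_list by blast
  ultimately show ?thesis
    unfolding encodes_def by metis
qed


section \<open>Fixed-parameter running time\<close>

text \<open>
  A randomized algorithm running in time \<open>O\<^sup>\<star>(k\<^bsup>f(k)\<^esup>)\<close>, where \<open>k\<close> is the size of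
  the right side and the suppressed factor is a polynomial in the input size.
\<close>

definition randomized_Ostar_solves ::
  "com \<Rightarrow> ((nat, nat) mov_instance \<Rightarrow> bool) \<Rightarrow> (nat \<Rightarrow> nat) \<Rightarrow> bool" where
  "randomized_Ostar_solves c Q f \<longleftrightarrow>
     (\<exists>p :: nat poly. \<forall>I x. valid_instance I \<longrightarrow> encodes x I \<longrightarrow>
        randomized_decides c x (Q I)
          (card (right_side I) ^ f (card (right_side I)) * poly p (input_size x)))"

end

theory Submission
  imports Defs
begin

text \<open>
  The algorithm is deterministic. Suppose that for every right vertex \<open>v\<close> the most frequent color
  \<open>\<rho> v\<close>, the runner-up \<open>\<rho> (k + v)\<close> and the number \<open>t v\<close> of occurrences of \<open>\<rho> v\<close> are prescribed.
  Then the colors decouple, and a version of Hall's theorem with lower and upper bounds characterizes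
  solvability
    by inequalities \<open>a \<le> \<Sum>v\<in>W. t v\<close> and \<open>(\<Sum>v\<in>W. t v) \<le> b\<close> over sets \<open>W\<close> of right vertices.

  An exchange argument shows that \<open>\<rho>\<close> only needs to choose among the \<open>2 k\<close> colors that
  have the most neighbors of the respective vertex, so there are \<open>k\<^bsup>O(k)\<^esup>\<close> choices for \<open>\<rho>\<close>. Given \<open>\<rho>\<close>, an
  integral solution \<open>t\<close> can be pushed along short integral vectors (which exist by Siegel's lemma)
  until \<open>k\<close> linearly independent constraints hold with equality up to an error of \<open>k\<^bsup>O(k)\<^esup>\<close>. There
  are \<open>2\<^bsup>O(k\<^sup>2)\<^esup>\<close> choices for these constraints. Each coordinate of \<open>t\<close> is then determined up to
  \<open>k\<^bsup>O(k)\<^esup>\<close>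
    by a row of the inverse matrix; its numerators and denominator have size \<open>k\<^bsup>O(k)\<^esup>\<close>, again by
  Siegel's lemma, and it is found by exhaustive search. Guessing the remaining offsets gives
  \<open>k\<^bsup>O(k\<^sup>2)\<^esup>\<close> cases in total.

  All of this is a formula with quantifiers bounded
    by \<open>k\<^bsup>O(k\<^sup>2)\<^esup>\<close> or by the input size, and functions
  defined by such bounded formulas are computable on the machine in time polynomial in the bounds.
\<close>

section \<open>Functions computable in polynomial time\<close>

text \<open>The values \<open>t v\<close> can be as large as the number of left vertices, so
  enumerating them directly would put that number under an exponent depending on \<open>k\<close>. A
  vertex of the linear relaxation would be fixed by \<open>k\<close> tight constraints but need not
  be integral. Hence tightness is relaxed to the length of the steps along which integral solutions
  move; the right-hand sides are still read off the input, and only the small error has to be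
  guessed. The colors decouple because a fixed \<open>t\<close> caps every color at \<open>v\<close>
  and bounds only two of them from below. Every guess is finally tested as a full certificate, so
  soundness never rests on the approximation argument. On the machine side, free exponentiation
  would destroy closure under composition; therefore a single capped quantity,
  \<open>threshold\<close>, enters all cost bounds as if it belonged to the input size.\<close>

lemma exec_Assign:
  "exec (Assign a e) s
     = return_spmf (s(eval_expr a s := eval_expr e s), cost_expr a s + cost_expr e s)"
  by (subst exec.simps) simp

lemma exec_Seq:
  assumes "exec c1 s = return_spmf (s1, t1)" "exec c2 s1 = return_spmf (s2, t2)"
  shows "exec (Seq c1 c2) s = return_spmf (s2, t1 + t2)"
  by (subst exec.simps) (simp add: assms)

lemma exec_While_False:
  "eval_expr e s = 0 \<Longrightarrow> exec (While e c) s = return_spmf (s, cost_expr e s)"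
  by (subst exec.simps) simp

lemma exec_While_True:
  assumes "eval_expr e s \<noteq> 0" "exec c s = return_spmf (s1, t1)"
    "exec (While e c) s1 = return_spmf (s2, t2)"
  shows "exec (While e c) s = return_spmf (s2, cost_expr e s + t1 + t2)"
  by (subst exec.simps) (simp add: assms)

section \<open>Bit lengths and the logarithmic cost of expressions\<close>

lemma less_power_floorlog: "n < 2 ^ floorlog 2 n"
  using floorlog_leD[of 2 n "floorlog 2 n"] by simp

lemma bit_size_le: "bit_size n \<le> n + 1"
  unfolding bit_size_def using floorlog_leI[of n 2 n] by simp

lemma bit_size_mono: "m \<le> n \<Longrightarrow> bit_size m \<le> bit_size n"
  unfolding bit_size_def by (simp add: floorlog_mono)

lemma bit_size_add: "bit_size (m + n) \<le> bit_size m + bit_size n"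
proof -
  let ?a = "floorlog 2 m" and ?b = "floorlog 2 n"
  have "m < 2 ^ ?a" "n < 2 ^ ?b"
    using less_power_floorlog by auto
  moreover have "(2::nat) ^ ?a \<le> 2 ^ (?a + ?b)" "(2::nat) ^ ?b \<le> 2 ^ (?a + ?b)"
    by (simp_all add: power_increasing)
  ultimately have "m + n < 2 ^ (?a + ?b) + 2 ^ (?a + ?b)"
    by linarith
  then have "m + n < 2 ^ (?a + ?b + 1)"
    by simp
  then have "floorlog 2 (m + n) \<le> ?a + ?b + 1"
    by (intro floorlog_leI) auto
  then show ?thesis by (simp add: bit_size_def)
qed

lemma bit_size_mult: "bit_size (m * n) \<le> bit_size m + bit_size n"
proof -
  have "m * n < 2 ^ floorlog 2 m * 2 ^ floorlog 2 n"
    using less_power_floorlog[of m] less_power_floorlog[of n]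
    by (intro mult_strict_mono) auto
  then have "floorlog 2 (m * n) \<le> floorlog 2 m + floorlog 2 n"
    by (intro floorlog_leI) (auto simp: power_add)
  then show ?thesis by (simp add: bit_size_def)
qed

lemma bit_size_eval_le_cost: "bit_size (eval_expr e s) \<le> cost_expr e s"
  by (cases e) auto

text \<open>An operation yields a value whose bit length is at most the combined bit length of its
  operands, and the cost of an expression dominates the bit length of its value. Hence costs grow
  linearly whatever the values are; these four bounds then replace the defining equations.\<close>

lemma cost_Plus: "cost_expr (Plus a b) s \<le> 2 * cost_expr a s + 2 * cost_expr b s"
  using bit_size_add[of "eval_expr a s" "eval_expr b s"]
    bit_size_eval_le_cost[of a s] bit_size_eval_le_cost[of b s] by simp

lemma cost_Times: "cost_expr (Times a b) s \<le> 2 * cost_expr a s + 2 * cost_expr b s"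
  using bit_size_mult[of "eval_expr a s" "eval_expr b s"]
    bit_size_eval_le_cost[of a s] bit_size_eval_le_cost[of b s] by simp

lemma cost_Minus: "cost_expr (Minus a b) s \<le> 2 * cost_expr a s + 2 * cost_expr b s"
  using bit_size_mono[of "eval_expr a s - eval_expr b s" "eval_expr a s"]
    bit_size_eval_le_cost[of a s] by simp

lemma cost_Div: "cost_expr (Div a b) s \<le> 2 * cost_expr a s + 2 * cost_expr b s"
  using bit_size_mono[of "eval_expr a s div eval_expr b s" "eval_expr a s"]
    bit_size_eval_le_cost[of a s] by simp

lemma cost_Num: "cost_expr (Num n) s \<le> n + 1"
  using bit_size_le[of n] by simp

declare cost_expr.simps(3-6) [simp del]

text \<open>Constants are absorbed into the exponent because \<open>c < 2 ^ c\<close>. With the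
  rules for sums and products below, a composed cost is again a power of \<open>M\<close> whose
  exponent does not depend on the input.\<close>

lemma le_pow: "2 \<le> M \<Longrightarrow> c \<le> M ^ c" for M :: nat
  using less_exp[of c] power_mono[of 2 M c] by simp

lemma pow_mono: "2 \<le> M \<Longrightarrow> p \<le> q \<Longrightarrow> M ^ p \<le> M ^ q" for M :: nat
  by (simp add: power_increasing)

lemma le_pow_mono: "2 \<le> M \<Longrightarrow> a \<le> M ^ p \<Longrightarrow> p \<le> q \<Longrightarrow> a \<le> M ^ q" for M :: nat
  using pow_mono le_trans by blast

lemma add_le_pow: "2 \<le> M \<Longrightarrow> a \<le> M ^ p \<Longrightarrow> b \<le> M ^ q \<Longrightarrow> a + b \<le> M ^ (p + q + 1)"
  for M :: nat
proof -
  assume M: "2 \<le> M" and "a \<le> M ^ p" "b \<le> M ^ q"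
  then have "a \<le> M ^ (p + q)" "b \<le> M ^ (p + q)"
    by (auto elim: le_pow_mono)
  then have "a + b \<le> 2 * M ^ (p + q)" by simp
  also have "\<dots> \<le> M * M ^ (p + q)" using M by simp
  finally show ?thesis by simp
qed

lemma mult_le_pow: "a \<le> M ^ p \<Longrightarrow> b \<le> M ^ q \<Longrightarrow> a * b \<le> M ^ (p + q)" for M :: nat
  by (simp add: power_add mult_mono)


text \<open>
  The only superpolynomial quantity of the algorithm; it bounds all tuples that are enumerated.
\<close>
definition threshold :: "nat list \<Rightarrow> nat" where
  "threshold x = (x ! 1 + 2) ^ ((2 * x ! 1 + 3) * (2 * x ! 1 + 1))"

section \<open>Input layout and the registers behind it\<close>

definition well_formed :: "nat list \<Rightarrow> bool" where
  "well_formed x \<longleftrightarrow> length x = 5 + 2 * x ! 0 + x ! 1 + 2 * x ! 2 + x ! 3"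

definition input_at :: "nat list \<Rightarrow> memory \<Rightarrow> bool" where
  "input_at x s \<longleftrightarrow> (\<forall>i<length x. s i = x ! i)"

definition regs :: "nat list \<Rightarrow> memory \<Rightarrow> nat \<Rightarrow> nat" where
  "regs x s j = s (length x + j)"

definition bounds :: "nat list \<Rightarrow> nat list \<Rightarrow> nat \<Rightarrow> bool" where
  "bounds x rs M \<longleftrightarrow> 2 \<le> M \<and> input_size x \<le> M \<and> threshold x \<le> M \<and> (\<forall>r\<in>set rs. r \<le> M)"

text \<open>The first free address. One program serves all inputs, so the length of the input is
  recomputed from the header at each register access.\<close>

definition base :: expr where
  "base = Plus (Plus (Plus (Num 5) (Times (Num 2) (Mem (Num 0)))) (Mem (Num 1)))
               (Plus (Times (Num 2) (Mem (Num 2))) (Mem (Num 3)))"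

definition reg :: "nat \<Rightarrow> expr" where
  "reg j = Plus base (Num j)"

lemma well_formed_length: "well_formed x \<Longrightarrow> 5 \<le> length x"
  by (simp add: well_formed_def)

lemma bounds_mono: "bounds x rs M \<Longrightarrow> M \<le> M' \<Longrightarrow> bounds x rs M'"
  unfolding bounds_def by auto

lemma bounds_Nil: "bounds x rs M \<Longrightarrow> bounds x [] M"
  unfolding bounds_def by auto

lemma bounds_2: "bounds x rs M \<Longrightarrow> 2 \<le> M"
  unfolding bounds_def by auto

text \<open>Intermediate results are bounded only by a power of \<open>M\<close>; to pass them on as
  arguments, the bound itself is raised to that power.\<close>

lemma bounds_pow: "bounds x rs M \<Longrightarrow> 0 < q \<Longrightarrow> bounds x rs (M ^ q)"
  by (rule bounds_mono) (auto simp: bounds_def self_le_power)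

lemma eval_base: "well_formed x \<Longrightarrow> input_at x s \<Longrightarrow> eval_expr base s = length x"
  using well_formed_length[of x] unfolding base_def input_at_def well_formed_def by simp

lemma eval_reg: "well_formed x \<Longrightarrow> input_at x s \<Longrightarrow> eval_expr (reg j) s = length x + j"
  by (simp add: reg_def eval_base)

lemma bit_size_nth_le: "i < length x \<Longrightarrow> bit_size (x ! i) \<le> input_size x"
  unfolding input_size_def by (rule member_le_sum_list) auto

lemma length_le_input_size: "length x \<le> input_size x"
proof -
  have "(\<Sum>a\<leftarrow>x. 1) \<le> (\<Sum>a\<leftarrow>x. bit_size a)"
    by (rule sum_list_mono) (simp add: bit_size_def)
  then show ?thesis by (simp add: input_size_def sum_list_triv)
qed

lemma header_le:
  assumes "well_formed x" "i < 4"
  shows "x ! i \<le> length x"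
proof -
  have "i = 0 \<or> i = 1 \<or> i = 2 \<or> i = 3" using assms(2) by auto
  then show ?thesis using assms(1) by (auto simp: well_formed_def)
qed

lemma cost_header:
  assumes "well_formed x" "input_at x s" "bounds x rs M" "i < 5"
  shows "cost_expr (Mem (Num i)) s \<le> i + 1 + M"
  using bit_size_nth_le[of i x] well_formed_length[OF assms(1)] assms bit_size_le[of i]
  by (simp add: input_at_def bounds_def)

lemma cost_base:
  assumes "well_formed x" "input_at x s" "bounds x rs M"
  shows "cost_expr base s \<le> 124 * M"
proof -
  note h = cost_header[OF assms, of 0] cost_header[OF assms, of 1]
    cost_header[OF assms, of 2] cost_header[OF assms, of 3]
  have 1: "cost_expr (Times (Num 2) (Mem (Num 0))) s \<le> 2 * (4 + M)"
    using cost_Times[of "Num 2" "Mem (Num 0)" s] h cost_Num[of 2 s] by simp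
  have 2: "cost_expr (Times (Num 2) (Mem (Num 2))) s \<le> 2 * (6 + M)"
    using cost_Times[of "Num 2" "Mem (Num 2)" s] h cost_Num[of 2 s] by simp
  have 3: "cost_expr (Plus (Num 5) (Times (Num 2) (Mem (Num 0)))) s \<le> 28 + 4 * M"
    using cost_Plus[of "Num 5" "Times (Num 2) (Mem (Num 0))" s] 1 cost_Num[of 5 s] by simp
  have 4: "cost_expr (Plus (Plus (Num 5) (Times (Num 2) (Mem (Num 0)))) (Mem (Num 1))) s
      \<le> 60 + 10 * M"
    using cost_Plus[of "Plus (Num 5) (Times (Num 2) (Mem (Num 0)))" "Mem (Num 1)" s] 3 h by simp
  have 5: "cost_expr (Plus (Times (Num 2) (Mem (Num 2))) (Mem (Num 3))) s \<le> 32 + 6 * M"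
    using cost_Plus[of "Times (Num 2) (Mem (Num 2))" "Mem (Num 3)" s] 2 h by simp
  show ?thesis
    using cost_Plus[of "Plus (Plus (Num 5) (Times (Num 2) (Mem (Num 0)))) (Mem (Num 1))"
        "Plus (Times (Num 2) (Mem (Num 2))) (Mem (Num 3))" s] 4 5 bounds_2[OF assms(3)]
    unfolding base_def by simp
qed

lemma cost_reg:
  assumes "well_formed x" "input_at x s" "bounds x rs M"
  shows "cost_expr (reg j) s \<le> (250 + 2 * j) * M"
proof -
  have "cost_expr (reg j) s \<le> 2 * (cost_expr base s + (j + 1))"
    unfolding reg_def using cost_Plus[of base "Num j" s] cost_Num[of j s] by simp
  also have "\<dots> \<le> 2 * (124 * M + (j + 1))"
    using cost_base[OF assms] by simp
  also have "\<dots> \<le> 248 * M + 2 * j * M + 2 * M"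
  proof -
    have "j * 1 \<le> j * M" by (rule mult_le_mono2) (use bounds_2[OF assms(3)] in simp)
    then have "2 * j \<le> 2 * j * M" by simp
    moreover have "2 * (124 * M + (j + 1)) = 248 * M + 2 * j + 2" by simp
    ultimately show ?thesis using bounds_2[OF assms(3)] by linarith
  qed
  finally show ?thesis by (simp add: algebra_simps)
qed

lemma cost_Mem_reg:
  assumes "well_formed x" "input_at x s" "bounds x rs M" "regs x s j \<le> M"
  shows "cost_expr (Mem (reg j)) s \<le> (252 + 2 * j) * M"
proof -
  have "bit_size (s (length x + j)) \<le> M + 1"
    using bit_size_le[of "s (length x + j)"] assms(4) by (simp add: regs_def)
  then have "cost_expr (Mem (reg j)) s \<le> (250 + 2 * j) * M + (M + 1)"
    using cost_reg[OF assms(1-3), of j] by (simp add: eval_reg[OF assms(1,2)])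
  also have "\<dots> \<le> (252 + 2 * j) * M"
    using bounds_2[OF assms(3)] by (simp add: algebra_simps)
  finally show ?thesis .
qed

lemma eval_Mem_reg:
  "well_formed x \<Longrightarrow> input_at x s \<Longrightarrow> eval_expr (Mem (reg j)) s = regs x s j"
  by (simp add: eval_reg regs_def)

lemma exec_assign_reg:
  assumes "well_formed x" "input_at x s"
  obtains s' where "exec (Assign (reg j) e) s = return_spmf (s', cost_expr (reg j) s + cost_expr e s)"
    "input_at x s'" "regs x s' = (regs x s)(j := eval_expr e s)"
proof
  let ?s = "s(length x + j := eval_expr e s)"
  show "exec (Assign (reg j) e) s = return_spmf (?s, cost_expr (reg j) s + cost_expr e s)"
    by (simp add: exec_Assign eval_reg[OF assms])
  show "input_at x ?s" using assms(2) by (simp add: input_at_def)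
  show "regs x ?s = (regs x s)(j := eval_expr e s)" by (auto simp: regs_def)
qed

text \<open>
  Registers live in the memory cells behind the input. The program \<open>c\<close> reads its arguments from the
  registers \<open>as\<close>, leaves the result in register \<open>\<tau>\<close>, may destroy all registers above \<open>\<tau>\<close>, and
  obeys a polynomial bound in every \<open>M\<close> that dominates the input size, \<open>threshold\<close> and the arguments.
  Quantifying over \<open>M\<close> lets these bounds compose without ever naming a polynomial.
\<close>
definition computes ::
  "com \<Rightarrow> nat list \<Rightarrow> nat \<Rightarrow> nat \<Rightarrow> (nat list \<Rightarrow> nat list \<Rightarrow> nat) \<Rightarrow> bool" where
  "computes c as \<tau> e F \<longleftrightarrow>
     (\<forall>x s M. well_formed x \<longrightarrow> input_at x s \<longrightarrow> bounds x (map (regs x s) as) M \<longrightarrow>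
        (\<exists>s' t. exec c s = return_spmf (s', t) \<and> t \<le> M ^ e \<and> input_at x s' \<and>
           (\<forall>j<\<tau>. regs x s' j = regs x s j) \<and>
           regs x s' \<tau> = F x (map (regs x s) as) \<and> F x (map (regs x s) as) \<le> M ^ e))"

definition computable :: "nat \<Rightarrow> (nat list \<Rightarrow> nat list \<Rightarrow> nat) \<Rightarrow> bool" where
  "computable d F \<longleftrightarrow>
     (\<exists>p. \<forall>as \<tau>. length as = d \<longrightarrow> (\<forall>a\<in>set as. a < \<tau>) \<longrightarrow> (\<exists>e. computes (p as \<tau>) as \<tau> e F))"

lemma computableI:
  assumes "\<And>as \<tau>. length as = d \<Longrightarrow> (\<forall>a\<in>set as. a < \<tau>) \<Longrightarrow> \<exists>e. computes (p as \<tau>) as \<tau> e F"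
  shows "computable d F"
  using assms unfolding computable_def by blast

lemma computesD:
  assumes "computes c as \<tau> e F" "well_formed x" "input_at x s" "bounds x (map (regs x s) as) M"
  obtains s' t where "exec c s = return_spmf (s', t)" "t \<le> M ^ e" "input_at x s'"
    "\<And>j. j < \<tau> \<Longrightarrow> regs x s' j = regs x s j" "regs x s' \<tau> = F x (map (regs x s) as)"
    "F x (map (regs x s) as) \<le> M ^ e"
  using assms unfolding computes_def by blast

section \<open>Basic computable functions\<close>

lemma computable_leaf:
  assumes eval: "\<And>as x s. length as = d \<Longrightarrow> well_formed x \<Longrightarrow> input_at x s \<Longrightarrow>
      eval_expr (E as) s = F x (map (regs x s) as)"
    and cost: "\<And>as. length as = d \<Longrightarrow> \<exists>e. \<forall>x s M. well_formed x \<longrightarrow> input_at x s \<longrightarrow>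
      bounds x (map (regs x s) as) M \<longrightarrow>
      cost_expr (E as) s \<le> M ^ e \<and> F x (map (regs x s) as) \<le> M ^ e"
  shows "computable d F"
proof (rule computableI[where p = "\<lambda>as \<tau>. Assign (reg \<tau>) (E as)"])
  fix as :: "nat list" and \<tau> :: nat
  assume len: "length as = d"
  obtain e where e: "\<And>x s M. well_formed x \<Longrightarrow> input_at x s \<Longrightarrow>
      bounds x (map (regs x s) as) M \<Longrightarrow>
      cost_expr (E as) s \<le> M ^ e \<and> F x (map (regs x s) as) \<le> M ^ e"
    using cost[OF len] by blast
  let ?e = "251 + 2 * \<tau> + e + 1"
  have "computes (Assign (reg \<tau>) (E as)) as \<tau> ?e F"
    unfolding computes_def
  proof (intro allI impI)
    fix x s M
    assume a: "well_formed x" "input_at x s" "bounds x (map (regs x s) as) M"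
    have M: "2 \<le> M" using a(3) by (rule bounds_2)
    obtain s' where s': "exec (Assign (reg \<tau>) (E as)) s
        = return_spmf (s', cost_expr (reg \<tau>) s + cost_expr (E as) s)"
      "input_at x s'" "regs x s' = (regs x s)(\<tau> := eval_expr (E as) s)"
      using exec_assign_reg[OF a(1,2)] by blast
    have "(250 + 2 * \<tau>) * M \<le> M ^ (250 + 2 * \<tau> + 1)"
      by (rule mult_le_pow[OF le_pow[OF M]]) simp
    then have "cost_expr (reg \<tau>) s \<le> M ^ (251 + 2 * \<tau>)"
      using cost_reg[OF a, of \<tau>] by (simp add: add.commute)
    then have t: "cost_expr (reg \<tau>) s + cost_expr (E as) s \<le> M ^ ?e"
      using e[OF a] add_le_pow[OF M] by blast
    show "\<exists>s' t. exec (Assign (reg \<tau>) (E as)) s = return_spmf (s', t) \<and> t \<le> M ^ ?e \<and>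
        input_at x s' \<and> (\<forall>j<\<tau>. regs x s' j = regs x s j) \<and>
        regs x s' \<tau> = F x (map (regs x s) as) \<and> F x (map (regs x s) as) \<le> M ^ ?e"
      using s' t eval[OF len a(1,2)] e[OF a] le_pow_mono[OF M, of _ e ?e]
      by (intro exI[of _ s'] exI[of _ "cost_expr (reg \<tau>) s + cost_expr (E as) s"]) auto
  qed
  then show "\<exists>e. computes (Assign (reg \<tau>) (E as)) as \<tau> e F" by blast
qed

lemma computable_const: "computable d (\<lambda>x rs. c)"
proof (rule computable_leaf[where E = "\<lambda>as. Num c"])
  fix as :: "nat list"
  show "\<exists>e. \<forall>x s M. well_formed x \<longrightarrow> input_at x s \<longrightarrow> bounds x (map (regs x s) as) M \<longrightarrow>
      cost_expr (Num c) s \<le> M ^ e \<and> c \<le> M ^ e"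
    using le_pow cost_Num bounds_2
    by (intro exI[of _ "c + 1"]) (meson add_leE le_trans)
qed simp

lemma computable_header: "i < 4 \<Longrightarrow> computable d (\<lambda>x rs. x ! i)"
proof (rule computable_leaf[where E = "\<lambda>as. Mem (Num i)"])
  fix as :: "nat list" and x s
  assume "i < 4" "well_formed x" "input_at x s"
  then show "eval_expr (Mem (Num i)) s = x ! i"
    using well_formed_length[of x] by (simp add: input_at_def)
next
  fix as :: "nat list"
  assume i: "i < 4"
  show "\<exists>e. \<forall>x s M. well_formed x \<longrightarrow> input_at x s \<longrightarrow> bounds x (map (regs x s) as) M \<longrightarrow>
      cost_expr (Mem (Num i)) s \<le> M ^ e \<and> x ! i \<le> M ^ e"
  proof (intro exI[of _ 4] allI impI conjI)
    fix x s M
    assume a: "well_formed x" "input_at x s" "bounds x (map (regs x s) as) M"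
    have M: "2 \<le> M" using a(3) by (rule bounds_2)
    have "i + 1 + M \<le> M ^ 4"
      using add_le_pow[OF M, of "i + 1" 2 M 1] i power_mono[OF M, of 2] by simp
    then show "cost_expr (Mem (Num i)) s \<le> M ^ 4"
      using cost_header[OF a, of i] i by simp
    have "x ! i \<le> M"
      using header_le[OF a(1) i] length_le_input_size[of x] a(3) by (simp add: bounds_def)
    then show "x ! i \<le> M ^ 4"
      using le_pow_mono[OF M, of "x ! i" 1 4] by simp
  qed
qed

text \<open>The fairness parameter is written in binary and can be exponential in the input size,
  unlike the four lengths in the header. No count exceeds \<open>x ! 0\<close>, so capping it there
  preserves the problem; truncated subtraction expresses the minimum.\<close>

lemma computable_min_fairness: "computable d (\<lambda>x rs. min (x ! 4) (x ! 0))"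
proof (rule computable_leaf[where
      E = "\<lambda>as. Minus (Mem (Num 4)) (Minus (Mem (Num 4)) (Mem (Num 0)))"])
  fix as :: "nat list" and x s
  assume "well_formed x" "input_at x s"
  then show "eval_expr (Minus (Mem (Num 4)) (Minus (Mem (Num 4)) (Mem (Num 0)))) s
      = min (x ! 4) (x ! 0)"
    using well_formed_length[of x] by (cases x) (auto simp: input_at_def)
next
  fix as :: "nat list"
  let ?E = "Minus (Mem (Num 4)) (Minus (Mem (Num 4)) (Mem (Num 0)))"
  show "\<exists>e. \<forall>x s M. well_formed x \<longrightarrow> input_at x s \<longrightarrow> bounds x (map (regs x s) as) M \<longrightarrow>
      cost_expr ?E s \<le> M ^ e \<and> min (x ! 4) (x ! 0) \<le> M ^ e"
  proof (intro exI[of _ 28] allI impI conjI)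
    fix x s M
    assume a: "well_formed x" "input_at x s" "bounds x (map (regs x s) as) M"
    have M: "2 \<le> M" using a(3) by (rule bounds_2)
    have "cost_expr (Mem (Num 4)) s \<le> 5 + M" "cost_expr (Mem (Num 0)) s \<le> 1 + M"
      using cost_header[OF a, of 4] cost_header[OF a, of 0]
      by (simp_all del: cost_expr.simps eval_expr.simps)
    then have "cost_expr ?E s \<le> 27 * M"
      using cost_Minus[of "Mem (Num 4)" "Minus (Mem (Num 4)) (Mem (Num 0))" s]
        cost_Minus[of "Mem (Num 4)" "Mem (Num 0)" s] M by linarith
    also have "\<dots> \<le> M ^ (27 + 1)"
      by (rule mult_le_pow[OF le_pow[OF M]]) simp
    finally show "cost_expr ?E s \<le> M ^ 28" by simp
    have "x ! 0 \<le> M"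
      using header_le[OF a(1), of 0] length_le_input_size[of x] a(3) by (simp add: bounds_def)
    then show "min (x ! 4) (x ! 0) \<le> M ^ 28"
      using le_pow_mono[OF M, of "x ! 0" 1 28] by simp
  qed
qed

lemma computable_last: "computable (Suc d) (\<lambda>x rs. last rs)"
proof (rule computable_leaf[where E = "\<lambda>as. Mem (reg (last as))"])
  fix as :: "nat list" and x s
  assume "length as = Suc d" "well_formed x" "input_at x s"
  then show "eval_expr (Mem (reg (last as))) s = last (map (regs x s) as)"
    using eval_Mem_reg by (metis last_map list.size(3) nat.distinct(1))
next
  fix as :: "nat list"
  assume len: "length as = Suc d"
  show "\<exists>e. \<forall>x s M. well_formed x \<longrightarrow> input_at x s \<longrightarrow> bounds x (map (regs x s) as) M \<longrightarrow>
      cost_expr (Mem (reg (last as))) s \<le> M ^ e \<and> last (map (regs x s) as) \<le> M ^ e"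
  proof (intro exI[of _ "252 + 2 * last as + 1"] allI impI conjI)
    fix x s M
    assume a: "well_formed x" "input_at x s" "bounds x (map (regs x s) as) M"
    have M: "2 \<le> M" using a(3) by (rule bounds_2)
    have l: "last (map (regs x s) as) = regs x s (last as)" "last (map (regs x s) as) \<le> M"
      using len a(3) unfolding bounds_def
      by (metis last_map list.size(3) nat.distinct(1))
        (metis a(3) bounds_def last_in_set length_map list.size(3) nat.distinct(1) len)
    then show "last (map (regs x s) as) \<le> M ^ (252 + 2 * last as + 1)"
      using le_pow_mono[OF M, of "last (map (regs x s) as)" 1 "252 + 2 * last as + 1"] by simp
    have "(252 + 2 * last as) * M \<le> M ^ (252 + 2 * last as + 1)"
      by (rule mult_le_pow[OF le_pow[OF M]]) simp
    then show "cost_expr (Mem (reg (last as))) s \<le> M ^ (252 + 2 * last as + 1)"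
      using cost_Mem_reg[OF a, of "last as"] l by simp
  qed
qed

text \<open>The arguments act as a stack of bound variables with the innermost one last; this is
  weakening by a variable that does not occur.\<close>

lemma computable_butlast:
  assumes "computable d F"
  shows "computable (Suc d) (\<lambda>x rs. F x (butlast rs))"
proof -
  obtain p where p: "\<And>as \<tau>. length as = d \<Longrightarrow> (\<forall>a\<in>set as. a < \<tau>) \<Longrightarrow> \<exists>e. computes (p as \<tau>) as \<tau> e F"
    using assms unfolding computable_def by blast
  show ?thesis
  proof (rule computableI[where p = "\<lambda>as. p (butlast as)"])
    fix as :: "nat list" and \<tau>
    assume len: "length as = Suc d" and lt: "\<forall>a\<in>set as. a < \<tau>"
    obtain e where e: "computes (p (butlast as) \<tau>) (butlast as) \<tau> e F"
      using p[of "butlast as" \<tau>] len lt by (auto dest: in_set_butlastD)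
    have "bounds x (map (regs x s) (butlast as)) M" if "bounds x (map (regs x s) as) M" for x s M
      using that unfolding bounds_def by (auto dest: in_set_butlastD)
    with e show "\<exists>e. computes (p (butlast as) \<tau>) as \<tau> e (\<lambda>x rs. F x (butlast rs))"
      unfolding computes_def map_butlast[symmetric] by blast
  qed
qed


text \<open>
  Operands of a binary operation may be mentioned several times
    by \<open>B\<close>; only linearity of the
  cost matters.
\<close>
lemma computable_binary:
  assumes F: "computable d F" and G: "computable d G"
    and eval: "\<And>x s a b. well_formed x \<Longrightarrow> input_at x s \<Longrightarrow>
      eval_expr (B a b) s = f x (eval_expr a s) (eval_expr b s)"
    and cost: "\<And>x s M a b. well_formed x \<Longrightarrow> input_at x s \<Longrightarrow> bounds x [] M \<Longrightarrow>
      cost_expr (B a b) s \<le> C * (cost_expr a s + cost_expr b s + M)"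
    and f: "\<And>x u v. f x u v \<le> (u + v + 1)\<^sup>2"
  shows "computable d (\<lambda>x rs. f x (F x rs) (G x rs))"
proof -
  obtain p where p: "\<And>as \<tau>. length as = d \<Longrightarrow> (\<forall>a\<in>set as. a < \<tau>) \<Longrightarrow> \<exists>e. computes (p as \<tau>) as \<tau> e F"
    using F unfolding computable_def by blast
  obtain q where q: "\<And>as \<tau>. length as = d \<Longrightarrow> (\<forall>a\<in>set as. a < \<tau>) \<Longrightarrow> \<exists>e. computes (q as \<tau>) as \<tau> e G"
    using G unfolding computable_def by blast
  let ?E = "\<lambda>\<tau>. B (Mem (reg \<tau>)) (Mem (reg (Suc \<tau>)))"
  \<comment> \<open>The second operand is evaluated into the register above \<open>\<tau>\<close>;
    its program spares everything below its target, hence also the first operand.\<close>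
  let ?P = "\<lambda>as \<tau>. Seq (p as \<tau>) (Seq (q as (Suc \<tau>)) (Assign (reg \<tau>) (?E \<tau>)))"
  show ?thesis
  proof (rule computableI[where p = ?P])
    fix as :: "nat list" and \<tau>
    assume len: "length as = d" and lt: "\<forall>a\<in>set as. a < \<tau>"
    obtain e1 where e1: "computes (p as \<tau>) as \<tau> e1 F" using p[OF len lt] by blast
    obtain e2 where e2: "computes (q as (Suc \<tau>)) as (Suc \<tau>) e2 G"
      using q[OF len, of "Suc \<tau>"] lt less_SucI by blast
    define m where "m = e1 + e2 + 1"
    let ?c = "C * (2 * (254 + 2 * \<tau>) + 1) + (250 + 2 * \<tau>)"
    define r where "r = e1 + (e2 + (?c + m) + 1) + 1 + 2 * (m + 1)"
    have "computes (?P as \<tau>) as \<tau> r (\<lambda>x rs. f x (F x rs) (G x rs))"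
      unfolding computes_def
    proof (intro allI impI)
      fix x s M
      assume a: "well_formed x" "input_at x s" "bounds x (map (regs x s) as) M"
      let ?rs = "map (regs x s) as"
      have M: "2 \<le> M" using a(3) by (rule bounds_2)
      obtain s1 t1 where s1: "exec (p as \<tau>) s = return_spmf (s1, t1)" "t1 \<le> M ^ e1" "input_at x s1"
        "\<And>j. j < \<tau> \<Longrightarrow> regs x s1 j = regs x s j" "regs x s1 \<tau> = F x ?rs" "F x ?rs \<le> M ^ e1"
        using computesD[OF e1 a] by blast
      have rs1: "map (regs x s1) as = ?rs" using s1(4) lt by simp
      obtain s2 t2 where s2: "exec (q as (Suc \<tau>)) s1 = return_spmf (s2, t2)" "t2 \<le> M ^ e2"
        "input_at x s2" "\<And>j. j < Suc \<tau> \<Longrightarrow> regs x s2 j = regs x s1 j"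
        "regs x s2 (Suc \<tau>) = G x ?rs" "G x ?rs \<le> M ^ e2"
        using computesD[OF e2 a(1) s1(3), of M] a(3) unfolding rs1 by blast
      have fg: "regs x s2 \<tau> = F x ?rs" using s1(5) s2(4) by simp
      obtain s3 where s3: "exec (Assign (reg \<tau>) (?E \<tau>)) s2
          = return_spmf (s3, cost_expr (reg \<tau>) s2 + cost_expr (?E \<tau>) s2)"
        "input_at x s3" "regs x s3 = (regs x s2)(\<tau> := eval_expr (?E \<tau>) s2)"
        using exec_assign_reg[OF a(1) s2(3)] by blast
      have ev: "eval_expr (?E \<tau>) s2 = f x (F x ?rs) (G x ?rs)"
        using eval[OF a(1) s2(3)] eval_Mem_reg[OF a(1) s2(3)] fg s2(5) by simp
      have Mm: "M ^ e1 \<le> M ^ m" "M ^ e2 \<le> M ^ m" "M \<le> M ^ m" "M ^ m \<ge> 1" "2 \<le> M ^ m"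
        using pow_mono[OF M, of e1 m] pow_mono[OF M, of e2 m] pow_mono[OF M, of 1 m] M
        by (auto simp: m_def intro: order.trans[OF M])
      have bm: "bounds x [] (M ^ m)"
        using bounds_mono[OF bounds_Nil[OF a(3)] Mm(3)] .
      have c1: "cost_expr (Mem (reg \<tau>)) s2 \<le> (254 + 2 * \<tau>) * M ^ m"
        using cost_Mem_reg[OF a(1) s2(3) bm, of \<tau>] fg s1(6) Mm
        by (simp add: algebra_simps)
      have c2: "cost_expr (Mem (reg (Suc \<tau>))) s2 \<le> (254 + 2 * \<tau>) * M ^ m"
        using cost_Mem_reg[OF a(1) s2(3) bm, of "Suc \<tau>"] s2(5,6) Mm
        by (simp add: algebra_simps)
      have "cost_expr (?E \<tau>) s2 \<le> C * ((254 + 2 * \<tau>) * M ^ m + (254 + 2 * \<tau>) * M ^ m + M ^ m)"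
        by (rule order.trans[OF cost[OF a(1) s2(3) bm]]) (intro mult_le_mono add_le_mono c1 c2 order.refl)
      moreover have "cost_expr (reg \<tau>) s2 \<le> (250 + 2 * \<tau>) * M ^ m"
        by (rule cost_reg[OF a(1) s2(3) bm])
      ultimately have "cost_expr (reg \<tau>) s2 + cost_expr (?E \<tau>) s2 \<le> ?c * M ^ m"
        by (simp add: algebra_simps)
      also have "\<dots> \<le> M ^ (?c + m)"
        by (rule mult_le_pow[OF le_pow[OF M]]) simp
      finally have t: "t1 + (t2 + (cost_expr (reg \<tau>) s2 + cost_expr (?E \<tau>) s2))
          \<le> M ^ (e1 + (e2 + (?c + m) + 1) + 1)"
        by (intro add_le_pow[OF M] s1(2) s2(2))
      have "F x ?rs + G x ?rs + 1 \<le> M ^ (m + 1)"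
        using add_le_pow[OF M add_le_pow[OF M s1(6) s2(6)], of 1 0] by (simp add: m_def)
      then have "(F x ?rs + G x ?rs + 1)\<^sup>2 \<le> (M ^ (m + 1))\<^sup>2"
        by (rule power_mono) simp
      then have v: "f x (F x ?rs) (G x ?rs) \<le> M ^ (2 * (m + 1))"
        using f[of x "F x ?rs" "G x ?rs"] by (simp only: power_mult mult.commute[of 2])
      show "\<exists>s' t. exec (?P as \<tau>) s = return_spmf (s', t) \<and> t \<le> M ^ r \<and> input_at x s' \<and>
          (\<forall>j<\<tau>. regs x s' j = regs x s j) \<and> regs x s' \<tau> = f x (F x ?rs) (G x ?rs) \<and>
          f x (F x ?rs) (G x ?rs) \<le> M ^ r"
        using exec_Seq[OF s1(1) exec_Seq[OF s2(1) s3(1)]] s3 ev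
          le_pow_mono[OF M t, of r] le_pow_mono[OF M v, of r] s1(4) s2(4)
        by (intro exI conjI) (auto simp: r_def)
    qed
    then show "\<exists>e. computes (?P as \<tau>) as \<tau> e (\<lambda>x rs. f x (F x rs) (G x rs))" by blast
  qed
qed

section \<open>Arithmetic and comparison of input entries\<close>

lemma le_square_sum: "u + v \<le> (u + v + 1)\<^sup>2" "u * v \<le> (u + v + 1)\<^sup>2" for u v :: nat
  by (auto simp: power2_eq_square algebra_simps)

lemma computable_plus:
  assumes "computable d F" "computable d G"
  shows "computable d (\<lambda>x rs. F x rs + G x rs)"
proof (rule computable_binary[OF assms, where B = Plus and C = 2])
  show "cost_expr (Plus a b) s \<le> 2 * (cost_expr a s + cost_expr b s + M)" for s a b M
    using cost_Plus[of a b s] by simp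
  show "u + v \<le> (u + v + 1)\<^sup>2" for u v :: nat
    using le_square_sum[of u v] by linarith
qed auto

lemma computable_minus:
  assumes "computable d F" "computable d G"
  shows "computable d (\<lambda>x rs. F x rs - G x rs)"
proof (rule computable_binary[OF assms, where B = Minus and C = 2])
  show "cost_expr (Minus a b) s \<le> 2 * (cost_expr a s + cost_expr b s + M)" for s a b M
    using cost_Minus[of a b s] by simp
  show "u - v \<le> (u + v + 1)\<^sup>2" for u v :: nat
    using le_square_sum[of u v] by linarith
qed auto

lemma computable_times:
  assumes "computable d F" "computable d G"
  shows "computable d (\<lambda>x rs. F x rs * G x rs)"
proof (rule computable_binary[OF assms, where B = Times and C = 2])
  show "cost_expr (Times a b) s \<le> 2 * (cost_expr a s + cost_expr b s + M)" for s a b M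
    using cost_Times[of a b s] by simp
  show "u * v \<le> (u + v + 1)\<^sup>2" for u v :: nat
    using le_square_sum[of u v] by linarith
qed auto

lemma computable_div:
  assumes "computable d F" "computable d G"
  shows "computable d (\<lambda>x rs. F x rs div G x rs)"
proof (rule computable_binary[OF assms, where B = Div and C = 2])
  show "cost_expr (Div a b) s \<le> 2 * (cost_expr a s + cost_expr b s + M)" for s a b M
    using cost_Div[of a b s] by simp
  show "u div v \<le> (u + v + 1)\<^sup>2" for u v :: nat
    using div_le_dividend[of u v] le_square_sum(1)[of u v] by linarith
qed auto

text \<open>Positions outside the input are redirected to its first cell: the memory behind it holds
  registers, so reading there would not be a function of \<open>x\<close>.\<close>

definition entry :: "nat list \<Rightarrow> nat \<Rightarrow> nat" where
  "entry x i = x ! (if i < length x then i else 0)"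

text \<open>Vertex and color names are arbitrary numbers and may be exponential in the input size.
  Only tests for equality are offered, so the names never become results that would have to be
  polynomially bounded.\<close>

lemma computable_entry_eq:
  assumes "computable d F" "computable d G"
  shows "computable d (\<lambda>x rs. of_bool (entry x (F x rs) = entry x (G x rs)))"
proof (rule computable_binary[OF assms])
  \<comment> \<open>The second factor is 1 if \<open>u\<close> is below the input length and 0
    otherwise. Likewise \<open>?B\<close> is 1 exactly if both truncated differences vanish.\<close>
  let ?addr = "\<lambda>u. Times u (Minus (Num 1) (Minus (Plus u (Num 1)) base))"
  let ?B = "\<lambda>a b. Minus (Num 1)
    (Plus (Minus (Mem (?addr a)) (Mem (?addr b))) (Minus (Mem (?addr b)) (Mem (?addr a))))"
  have addr: "eval_expr (Mem (?addr u)) s = entry x (eval_expr u s)"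
    if "well_formed x" "input_at x s" for u x s
    using that eval_base[OF that] well_formed_length[of x]
    by (cases x) (auto simp: entry_def input_at_def)
  have ca: "cost_expr (Mem (?addr u)) s \<le> 18 * cost_expr u s + 1013 * M"
    if a: "well_formed x" "input_at x s" "bounds x [] M" for u x s M
  proof -
    have len: "entry x i = x ! (if i < length x then i else 0)" "0 < length x" for i
      using well_formed_length[OF a(1)] by (auto simp: entry_def)
    have M: "2 \<le> M" using a(3) by (rule bounds_2)
    have "bit_size (eval_expr (Mem (?addr u)) s) \<le> input_size x"
      unfolding addr[OF a(1,2)] len using len(2) by (auto intro: bit_size_nth_le)
    then have "bit_size (eval_expr (Mem (?addr u)) s) \<le> M"
      using a(3) by (simp add: bounds_def)
    moreover have "cost_expr (?addr u) s \<le> 18 * cost_expr u s + 1012 * M"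
      using cost_Times[of u "Minus (Num 1) (Minus (Plus u (Num 1)) base)" s]
        cost_Minus[of "Num 1" "Minus (Plus u (Num 1)) base" s]
        cost_Minus[of "Plus u (Num 1)" base s] cost_Plus[of u "Num 1" s] cost_Num[of 1 s]
        cost_base[OF a] M by linarith
    ultimately show ?thesis
      unfolding cost_expr.simps(2)[of "?addr u"] by linarith
  qed
  show "eval_expr (?B a b) s = of_bool (entry x (eval_expr a s) = entry x (eval_expr b s))"
    if "well_formed x" "input_at x s" for x s a b
    using addr[OF that, of a] addr[OF that, of b] by (auto simp del: eval_expr.simps(2))
  show "cost_expr (?B a b) s \<le> 100000 * (cost_expr a s + cost_expr b s + M)"
    if a: "well_formed x" "input_at x s" "bounds x [] M" for x s a b M
    using cost_Minus[of "Num 1" "Plus (Minus (Mem (?addr a)) (Mem (?addr b))) (Minus (Mem (?addr b)) (Mem (?addr a)))" s]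
      cost_Plus[of "Minus (Mem (?addr a)) (Mem (?addr b))" "Minus (Mem (?addr b)) (Mem (?addr a))" s]
      cost_Minus[of "Mem (?addr a)" "Mem (?addr b)" s]
      cost_Minus[of "Mem (?addr b)" "Mem (?addr a)" s] cost_Num[of 1 s] bounds_2[OF a(3)]
      ca[OF a, of a] ca[OF a, of b] unfolding distrib_left by linarith
qed auto

text \<open>
  The polynomial bound on the accumulator has to be supplied, since iteration alone could square it
  in every round.
\<close>
lemma computable_iterate:
  assumes A: "computable d A" and B: "computable d B"
    and G: "computable (Suc (Suc d))
      (\<lambda>x rs. g x (butlast (butlast rs)) (last (butlast rs)) (last rs))"
    and bnd: "\<exists>e. \<forall>x rs M j. well_formed x \<longrightarrow> length rs = d \<longrightarrow> bounds x rs M \<longrightarrow> j \<le> B x rs \<longrightarrow>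
      rec_nat (A x rs) (\<lambda>j r. g x rs r j) j \<le> M ^ e"
  shows "computable d (\<lambda>x rs. rec_nat (A x rs) (\<lambda>j r. g x rs r j) (B x rs))"
proof -
  define acc where "acc = (\<lambda>x rs j. rec_nat (A x rs) (\<lambda>j r. g x rs r j) j)"
  obtain p where p: "\<And>as \<tau>. length as = d \<Longrightarrow> (\<forall>a\<in>set as. a < \<tau>) \<Longrightarrow> \<exists>e. computes (p as \<tau>) as \<tau> e A"
    using A unfolding computable_def by blast
  obtain q where q: "\<And>as \<tau>. length as = d \<Longrightarrow> (\<forall>a\<in>set as. a < \<tau>) \<Longrightarrow> \<exists>e. computes (q as \<tau>) as \<tau> e B"
    using B unfolding computable_def by blast
  let ?G = "\<lambda>x rs. g x (butlast (butlast rs)) (last (butlast rs)) (last rs)"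
  obtain w where w: "\<And>as \<tau>. length as = Suc (Suc d) \<Longrightarrow> (\<forall>a\<in>set as. a < \<tau>) \<Longrightarrow>
      \<exists>e. computes (w as \<tau>) as \<tau> e ?G"
    using G unfolding computable_def by blast
  obtain ea where ea: "\<And>x rs M j. well_formed x \<Longrightarrow> length rs = d \<Longrightarrow> bounds x rs M \<Longrightarrow>
      j \<le> B x rs \<Longrightarrow> acc x rs j \<le> M ^ ea"
    using bnd unfolding acc_def by blast
  \<comment> \<open>Register \<open>\<tau>\<close> holds the accumulator, \<open>\<tau> + 1\<close>
    the number of rounds, \<open>\<tau> + 2\<close> the counter, and \<open>\<tau> + 3\<close> the
    result of the current round.\<close>
  let ?guard = "\<lambda>\<tau>. Minus (Mem (reg (\<tau> + 1))) (Mem (reg (\<tau> + 2)))"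
  let ?next = "\<lambda>\<tau>. Plus (Mem (reg (\<tau> + 2))) (Num 1)"
  let ?body = "\<lambda>as \<tau>. Seq (w (as @ [\<tau>, \<tau> + 2]) (\<tau> + 3))
    (Seq (Assign (reg \<tau>) (Mem (reg (\<tau> + 3)))) (Assign (reg (\<tau> + 2)) (?next \<tau>)))"
  let ?loop = "\<lambda>as \<tau>. While (?guard \<tau>) (?body as \<tau>)"
  let ?P = "\<lambda>as \<tau>. Seq (p as \<tau>) (Seq (q as (\<tau> + 1)) (Seq (Assign (reg (\<tau> + 2)) (Num 0)) (?loop as \<tau>)))"
  have "computable d (\<lambda>x rs. acc x rs (B x rs))"
  proof (rule computableI[where p = ?P])
    fix as :: "nat list" and \<tau>
    assume len: "length as = d" and lt: "\<forall>a\<in>set as. a < \<tau>"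
    obtain e1 where e1: "computes (p as \<tau>) as \<tau> e1 A" using p[OF len lt] by blast
    obtain e2 where e2: "computes (q as (\<tau> + 1)) as (\<tau> + 1) e2 B"
      using q[OF len, of "\<tau> + 1"] lt by (metis Suc_eq_plus1 less_SucI)
    have "\<forall>a\<in>set (as @ [\<tau>, \<tau> + 2]). a < \<tau> + 3" using lt by auto
    then obtain e3 where e3: "computes (w (as @ [\<tau>, \<tau> + 2]) (\<tau> + 3)) (as @ [\<tau>, \<tau> + 2]) (\<tau> + 3) e3 ?G"
      using w[of "as @ [\<tau>, \<tau> + 2]" "\<tau> + 3"] len by auto
    define m where "m = e1 + e2 + ea + 1"
    define h where "h = 10000 + 100 * \<tau> + e3"
    define r where "r = e1 + (e2 + ((h + 1) * m + (m + 3 * h * m) + 1) + 1) + 1"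
    have "computes (?P as \<tau>) as \<tau> r (\<lambda>x rs. acc x rs (B x rs))"
      unfolding computes_def
    proof (intro allI impI)
      fix x s M
      assume a: "well_formed x" "input_at x s" "bounds x (map (regs x s) as) M"
      let ?rs = "map (regs x s) as"
      let ?b = "B x ?rs"
      \<comment> \<open>A common bound for accumulator, counter and number of rounds; there will be
        at most \<open>?N\<close> rounds of cost at most \<open>3 * ?N ^ h\<close> each.\<close>
      let ?N = "M ^ m"
      have lrs: "length ?rs = d" using len by simp
      have M: "2 \<le> M" using a(3) by (rule bounds_2)
      have Mm: "M ^ e1 \<le> ?N" "M ^ e2 \<le> ?N" "M ^ ea \<le> ?N" "M \<le> ?N" "2 \<le> ?N"
        using pow_mono[OF M, of e1 m] pow_mono[OF M, of e2 m] pow_mono[OF M, of ea m]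
          pow_mono[OF M, of 1 m] M by (auto simp: m_def intro: order.trans[OF M])
      have bN: "bounds x ?rs ?N" by (rule bounds_mono[OF a(3) Mm(4)])
      have accN: "acc x ?rs j \<le> ?N" if "j \<le> ?b" for j
        using ea[OF a(1) lrs a(3) that] Mm(3) by simp
      obtain s1 t1 where s1: "exec (p as \<tau>) s = return_spmf (s1, t1)" "t1 \<le> M ^ e1" "input_at x s1"
        "\<And>j. j < \<tau> \<Longrightarrow> regs x s1 j = regs x s j" "regs x s1 \<tau> = A x ?rs"
        using computesD[OF e1 a] by blast
      have rs1: "map (regs x s1) as = ?rs" using s1(4) lt by simp
      obtain s2 t2 where s2: "exec (q as (\<tau> + 1)) s1 = return_spmf (s2, t2)" "t2 \<le> M ^ e2"
        "input_at x s2" "\<And>j. j < \<tau> + 1 \<Longrightarrow> regs x s2 j = regs x s1 j"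
        "regs x s2 (\<tau> + 1) = ?b" "?b \<le> M ^ e2"
        using computesD[OF e2 a(1) s1(3), of M] a(3) unfolding rs1 by blast
      have bleN: "?b \<le> ?N" using s2(6) Mm(2) by simp
      obtain s3 where s3: "exec (Assign (reg (\<tau> + 2)) (Num 0)) s2
          = return_spmf (s3, cost_expr (reg (\<tau> + 2)) s2 + cost_expr (Num 0) s2)"
        "input_at x s3" "regs x s3 = (regs x s2)(\<tau> + 2 := eval_expr (Num 0) s2)"
        using exec_assign_reg[OF a(1) s2(3)] by blast
      have cost_mem: "cost_expr (Mem (reg j)) s' \<le> (258 + 2 * \<tau>) * ?N"
        if "input_at x s'" "regs x s' j \<le> ?N" "j \<le> \<tau> + 3" for s' j
        using cost_Mem_reg[OF a(1) that(1) bN that(2)] that(3)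
          mult_le_mono1[of "252 + 2 * j" "258 + 2 * \<tau>" ?N] by linarith
      have cost_r: "cost_expr (reg j) s' \<le> (258 + 2 * \<tau>) * ?N"
        if "input_at x s'" "j \<le> \<tau> + 3" for s' j
        using cost_reg[OF a(1) that(1) bN, of j] that(2)
          mult_le_mono1[of "250 + 2 * j" "258 + 2 * \<tau>" ?N] by linarith
      have cN: "c * ?N \<le> ?N ^ h" if "c < h" for c
        using mult_le_pow[OF le_pow[OF Mm(5), of c], of ?N 1] le_pow_mono[OF Mm(5), of "c * ?N" "c + 1" h] that
        by simp
      define inv where "inv = (\<lambda>s' j. input_at x s' \<and> (\<forall>i<\<tau>. regs x s' i = regs x s i) \<and>
        regs x s' \<tau> = acc x ?rs j \<and> regs x s' (\<tau> + 1) = ?b \<and> regs x s' (\<tau> + 2) = j)"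
      have inv3: "inv s3 0"
        using s3 s1(4,5) s2(4,5) by (simp add: inv_def acc_def)
      have guard: "cost_expr (?guard \<tau>) s' \<le> ?N ^ h" if "inv s' j" "j \<le> ?b" for s' j
      proof -
        have "cost_expr (?guard \<tau>) s' \<le> 2 * ((258 + 2 * \<tau>) * ?N) + 2 * ((258 + 2 * \<tau>) * ?N)"
          using cost_Minus[of "Mem (reg (\<tau> + 1))" "Mem (reg (\<tau> + 2))" s'] that bleN
            cost_mem[of s' "\<tau> + 1"] cost_mem[of s' "\<tau> + 2"] unfolding inv_def by linarith
        also have "\<dots> = (4 * (258 + 2 * \<tau>)) * ?N" by simp
        also have "\<dots> \<le> ?N ^ h" by (rule cN) (simp add: h_def)
        finally show ?thesis .
      qed
      have evg: "eval_expr (?guard \<tau>) s' = ?b - j" if "inv s' j" for s' j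
        using that eval_Mem_reg[OF a(1)] by (simp add: inv_def del: eval_expr.simps(2))
      have step: "\<exists>s'' t. exec (?body as \<tau>) s' = return_spmf (s'', t) \<and> t \<le> 2 * ?N ^ h \<and> inv s'' (Suc j)"
        if i: "inv s' j" "j < ?b" for s' j
      proof -
        have in': "input_at x s'" using i(1) by (simp add: inv_def)
        have jN: "j \<le> ?N" using i(2) bleN by simp
        have rs': "map (regs x s') (as @ [\<tau>, \<tau> + 2]) = ?rs @ [acc x ?rs j, j]"
          using i(1) lt by (auto simp: inv_def)
        have b': "bounds x (?rs @ [acc x ?rs j, j]) ?N"
          using bN accN[of j] jN i(2) by (auto simp: bounds_def)
        have next_acc: "?G x (?rs @ [acc x ?rs j, j]) = acc x ?rs (Suc j)"
          by (simp add: acc_def butlast_append)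
        obtain s4 t4 where s4: "exec (w (as @ [\<tau>, \<tau> + 2]) (\<tau> + 3)) s' = return_spmf (s4, t4)"
          "t4 \<le> ?N ^ e3" "input_at x s4" "\<And>j. j < \<tau> + 3 \<Longrightarrow> regs x s4 j = regs x s' j"
          "regs x s4 (\<tau> + 3) = acc x ?rs (Suc j)"
          using computesD[OF e3 a(1) in', of ?N] b' unfolding rs' next_acc by blast
        obtain s5 where s5: "exec (Assign (reg \<tau>) (Mem (reg (\<tau> + 3)))) s4
            = return_spmf (s5, cost_expr (reg \<tau>) s4 + cost_expr (Mem (reg (\<tau> + 3))) s4)"
          "input_at x s5" "regs x s5 = (regs x s4)(\<tau> := eval_expr (Mem (reg (\<tau> + 3))) s4)"
          using exec_assign_reg[OF a(1) s4(3)] by blast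
        obtain s6 where s6: "exec (Assign (reg (\<tau> + 2)) (?next \<tau>)) s5
            = return_spmf (s6, cost_expr (reg (\<tau> + 2)) s5 + cost_expr (?next \<tau>) s5)"
          "input_at x s6" "regs x s6 = (regs x s5)(\<tau> + 2 := eval_expr (?next \<tau>) s5)"
          using exec_assign_reg[OF a(1) s5(2)] by blast
        have j5: "regs x s5 (\<tau> + 2) = j"
          using s5(3) s4(4)[of "\<tau> + 2"] i(1) by (simp add: inv_def)
        have r5: "regs x s5 = (regs x s4)(\<tau> := acc x ?rs (Suc j))"
          using s5(3) s4(5) eval_Mem_reg[OF a(1) s4(3)] by (simp del: eval_expr.simps)
        have r6: "regs x s6 = (regs x s5)(\<tau> + 2 := Suc j)"
          using s6(3) j5 eval_Mem_reg[OF a(1) s5(2), of "\<tau> + 2"]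
          by (simp del: eval_expr.simps(2))
        have inv6: "inv s6 (Suc j)"
          using s6(2) i(1) s4(4) by (simp add: inv_def r6 r5)
        let ?t = "t4 + (cost_expr (reg \<tau>) s4 + cost_expr (Mem (reg (\<tau> + 3))) s4
            + (cost_expr (reg (\<tau> + 2)) s5 + cost_expr (?next \<tau>) s5))"
        have nx: "cost_expr (?next \<tau>) s5 \<le> 2 * ((258 + 2 * \<tau>) * ?N) + 4"
          using cost_Plus[of "Mem (reg (\<tau> + 2))" "Num 1" s5] cost_Num[of 1 s5]
            cost_mem[OF s5(2), of "\<tau> + 2"] j5 jN by linarith
        have c34: "cost_expr (Mem (reg (\<tau> + 3))) s4 \<le> (258 + 2 * \<tau>) * ?N"
          using cost_mem[OF s4(3), of "\<tau> + 3"] s4(5) accN[of "Suc j"] i(2) by simp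
        have "cost_expr (reg \<tau>) s4 + cost_expr (Mem (reg (\<tau> + 3))) s4
            + (cost_expr (reg (\<tau> + 2)) s5 + cost_expr (?next \<tau>) s5)
            \<le> 5 * ((258 + 2 * \<tau>) * ?N) + 2 * ?N"
          using nx c34 cost_r[OF s4(3), of \<tau>] cost_r[OF s5(2), of "\<tau> + 2"] Mm(5)
          by linarith
        also have "\<dots> = (5 * (258 + 2 * \<tau>) + 2) * ?N" by (simp add: algebra_simps)
        also have "\<dots> \<le> ?N ^ h" by (rule cN) (simp add: h_def)
        finally have "?t \<le> 2 * ?N ^ h"
          using s4(2) le_pow_mono[OF Mm(5) s4(2), of h] by (simp add: h_def)
        then show ?thesis
          using exec_Seq[OF s4(1) exec_Seq[OF s5(1) s6(1)]] inv6 by blast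
      qed
      have loop: "\<exists>s'' t. exec (?loop as \<tau>) s' = return_spmf (s'', t) \<and>
          t \<le> n * (3 * ?N ^ h) + ?N ^ h \<and> inv s'' ?b"
        if "inv s' j" "j + n = ?b" for s' j n
        using that
      proof (induction n arbitrary: s' j)
        case 0
        then show ?case
          using exec_While_False[of "?guard \<tau>" s' "?body as \<tau>"] evg[OF 0(1)] guard[OF 0(1)] by auto
      next
        case (Suc n)
        obtain s4 t4 where s4: "exec (?body as \<tau>) s' = return_spmf (s4, t4)" "t4 \<le> 2 * ?N ^ h"
          "inv s4 (Suc j)"
          using step[OF Suc.prems(1)] Suc.prems(2) by auto
        obtain s5 t5 where s5: "exec (?loop as \<tau>) s4 = return_spmf (s5, t5)"
          "t5 \<le> n * (3 * ?N ^ h) + ?N ^ h" "inv s5 ?b"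
          using Suc.IH[OF s4(3)] Suc.prems(2) by auto
        have "exec (?loop as \<tau>) s' = return_spmf (s5, cost_expr (?guard \<tau>) s' + t4 + t5)"
          using exec_While_True[OF _ s4(1) s5(1)] evg[OF Suc.prems(1)] Suc.prems(2) by simp
        moreover have "cost_expr (?guard \<tau>) s' + t4 + t5 \<le> Suc n * (3 * ?N ^ h) + ?N ^ h"
          using guard[OF Suc.prems(1)] Suc.prems(2) s4(2) s5(2) by simp
        ultimately show ?case using s5(3) by blast
      qed
      obtain s7 t7 where s7: "exec (?loop as \<tau>) s3 = return_spmf (s7, t7)"
        "t7 \<le> ?b * (3 * ?N ^ h) + ?N ^ h" "inv s7 ?b"
        using loop[OF inv3, of ?b] by auto
      have h2: "3 \<le> h" by (simp add: h_def)
      have "3 * ?N ^ h \<le> ?N ^ h * ?N ^ h"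
        using le_pow[OF Mm(5), of h] h2 by (intro mult_right_mono) auto
      then have "?b * (3 * ?N ^ h) \<le> ?N * (?N ^ h * ?N ^ h)" "?N ^ h \<le> ?N ^ h * ?N ^ h"
        using bleN by (blast intro: mult_le_mono, linarith)
      moreover have "1 * (?N ^ h * ?N ^ h) \<le> ?N * (?N ^ h * ?N ^ h)"
        using Mm(5) by (intro mult_le_mono1) linarith
      ultimately have "?b * (3 * ?N ^ h) + ?N ^ h \<le> ?N * (?N ^ h * ?N ^ h) + ?N * (?N ^ h * ?N ^ h)"
        by linarith
      also have "\<dots> = 2 * (?N * (?N ^ h * ?N ^ h))" by simp
      also have "\<dots> \<le> ?N * (?N * (?N ^ h * ?N ^ h))" by (rule mult_le_mono1[OF Mm(5)])
      also have "\<dots> = M ^ (m * (2 + 2 * h))"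
        by (simp add: power_mult[symmetric] power_add[symmetric] algebra_simps mult_2 mult_2_right)
      finally have "t7 \<le> M ^ (m * (2 + 2 * h))" using s7(2) by simp
      then have t7: "t7 \<le> M ^ (m + 3 * h * m)"
        by (rule le_pow_mono[OF M]) (use h2 in \<open>simp add: algebra_simps\<close>)
      have "cost_expr (reg (\<tau> + 2)) s2 + cost_expr (Num 0) s2 \<le> (258 + 2 * \<tau>) * ?N + 1"
        using cost_r[OF s2(3), of "\<tau> + 2"] cost_Num[of 0 s2] by linarith
      also have "\<dots> \<le> (259 + 2 * \<tau>) * ?N" using Mm(5) by (simp add: algebra_simps)
      also have "\<dots> \<le> ?N ^ h" by (rule cN) (simp add: h_def)
      also have "\<dots> \<le> M ^ ((h + 1) * m)"
        by (simp add: power_mult[symmetric]) (rule pow_mono[OF M], simp)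
      finally have t: "t1 + (t2 + ((cost_expr (reg (\<tau> + 2)) s2 + cost_expr (Num 0) s2) + t7)) \<le> M ^ r"
        unfolding r_def by (intro add_le_pow[OF M] s1(2) s2(2) t7)
      have v: "acc x ?rs ?b \<le> M ^ r"
        using le_pow_mono[OF M accN[OF order.refl], of r] by (simp add: r_def)
      show "\<exists>s' t. exec (?P as \<tau>) s = return_spmf (s', t) \<and> t \<le> M ^ r \<and> input_at x s' \<and>
          (\<forall>j<\<tau>. regs x s' j = regs x s j) \<and> regs x s' \<tau> = acc x ?rs ?b \<and> acc x ?rs ?b \<le> M ^ r"
        using exec_Seq[OF s1(1) exec_Seq[OF s2(1) exec_Seq[OF s3(1) s7(1)]]] s7(3) t v
        unfolding inv_def by blast
    qed
    then show "\<exists>e. computes (?P as \<tau>) as \<tau> e (\<lambda>x rs. acc x rs (B x rs))"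
      by blast
  qed
  then show ?thesis by (simp add: acc_def)
qed

text \<open>The argument list is placed into the registers of an artificial memory, where the bound
  on the result of the program applies. This supplies the growth bounds that
  \<open>computable_iterate\<close> asks for.\<close>

lemma computable_bound:
  assumes "computable d F"
  obtains e where "\<And>x rs M. well_formed x \<Longrightarrow> length rs = d \<Longrightarrow> bounds x rs M \<Longrightarrow> F x rs \<le> M ^ e"
proof -
  obtain p where "\<And>as \<tau>. length as = d \<Longrightarrow> (\<forall>a\<in>set as. a < \<tau>) \<Longrightarrow> \<exists>e. computes (p as \<tau>) as \<tau> e F"
    using assms unfolding computable_def by blast
  from this[of "[0..<d]" d] obtain e where e: "computes (p [0..<d] d) [0..<d] d e F" by auto
  show thesis
  proof
    fix x rs M
    assume a: "well_formed x" "length rs = d" "bounds x rs M"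
    define s where "s = (\<lambda>i. if i < length x then x ! i else rs ! (i - length x))"
    have "input_at x s" by (simp add: input_at_def s_def)
    moreover have rs: "map (regs x s) [0..<d] = rs"
      using a(2) by (intro nth_equalityI) (auto simp: regs_def s_def)
    ultimately show "F x rs \<le> M ^ e"
      using computesD[OF e a(1), of s M] a(3) by metis
  qed
qed

lemma computable_cong:
  assumes "computable d F" "\<And>x rs. length rs = d \<Longrightarrow> F x rs = F' x rs"
  shows "computable d F'"
proof -
  have "F x (map (regs x s) as) = F' x (map (regs x s) as)" if "length as = d" for x s as
    using assms(2) that by simp
  then show ?thesis
    using assms(1) unfolding computable_def computes_def by simp
qed

text \<open>Renaming of variables is free because a program is told which registers to read.\<close>

lemma computable_reindex:
  assumes "computable (length is) F" "\<forall>i\<in>set is. i < d"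
  shows "computable d (\<lambda>x rs. F x (map ((!) rs) is))"
proof -
  obtain p where p: "\<And>as \<tau>. length as = length is \<Longrightarrow> (\<forall>a\<in>set as. a < \<tau>) \<Longrightarrow>
      \<exists>e. computes (p as \<tau>) as \<tau> e F"
    using assms unfolding computable_def by blast
  show ?thesis
  proof (rule computableI[where p = "\<lambda>as. p (map ((!) as) is)"])
    fix as :: "nat list" and \<tau>
    assume len: "length as = d" and lt: "\<forall>a\<in>set as. a < \<tau>"
    have "\<forall>a\<in>set (map ((!) as) is). a < \<tau>" using len lt assms(2) by auto
    then obtain e where e: "computes (p (map ((!) as) is) \<tau>) (map ((!) as) is) \<tau> e F"
      using p[of "map ((!) as) is" \<tau>] by auto
    have "map ((!) (map (regs x s) as)) is = map (regs x s) (map ((!) as) is)" for x s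
      using assms(2) len by simp
    moreover have "bounds x (map (regs x s) (map ((!) as) is)) M"
      if "bounds x (map (regs x s) as) M" for x s M
      using that assms(2) len unfolding bounds_def by (auto simp: Ball_def)
    ultimately have "computes (p (map ((!) as) is) \<tau>) as \<tau> e (\<lambda>x rs. F x (map ((!) rs) is))"
      using e unfolding computes_def by metis
    then show "\<exists>e. computes (p (map ((!) as) is) \<tau>) as \<tau> e (\<lambda>x rs. F x (map ((!) rs) is))" ..
  qed
qed

lemma computable_min:
  assumes "computable d F" "computable d G"
  shows "computable d (\<lambda>x rs. min (F x rs) (G x rs))"
  by (rule computable_cong[OF computable_minus[OF assms(1) computable_minus[OF assms]]]) auto

lemma computable_sum:
  assumes B: "computable d B" and G: "computable (Suc d) (\<lambda>x rs. g x (butlast rs) (last rs))"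
  shows "computable d (\<lambda>x rs. \<Sum>i<B x rs. g x rs i)"
proof -
  have rec: "(\<Sum>i<n. g x rs i) = rec_nat 0 (\<lambda>j r. r + g x rs j) n" for x rs n
    by (induction n) auto
  \<comment> \<open>The summand does not see the accumulator, which sits between the other arguments
    and the counter.\<close>
  have "computable (Suc (Suc d)) (\<lambda>x rs. (\<lambda>x rs. g x (butlast rs) (last rs)) x (map ((!) rs) ([0..<d] @ [Suc d])))"
    by (rule computable_reindex) (use G in auto)
  then have G': "computable (Suc (Suc d)) (\<lambda>x rs. g x (butlast (butlast rs)) (last rs))"
  proof (rule computable_cong)
    fix x rs :: "nat list"
    assume len: "length rs = Suc (Suc d)"
    then have "rs \<noteq> []" by auto
    with len have "butlast (butlast rs) = map ((!) rs) [0..<d]" "last rs = rs ! Suc d"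
      using last_conv_nth[of rs] by (auto intro!: nth_equalityI simp: nth_butlast)
    then show "g x (butlast (map ((!) rs) ([0..<d] @ [Suc d]))) (last (map ((!) rs) ([0..<d] @ [Suc d])))
        = g x (butlast (butlast rs)) (last rs)"
      by simp
  qed
  obtain e1 where e1: "\<And>x rs M. well_formed x \<Longrightarrow> length rs = d \<Longrightarrow> bounds x rs M \<Longrightarrow> B x rs \<le> M ^ e1"
    by (rule computable_bound[OF B]) blast
  obtain e2 where e2: "\<And>x rs M. well_formed x \<Longrightarrow> length rs = Suc d \<Longrightarrow> bounds x rs M \<Longrightarrow>
      g x (butlast rs) (last rs) \<le> M ^ e2"
    by (rule computable_bound[OF G]) blast
  show ?thesis
    unfolding rec
  proof (rule computable_iterate[where A = "\<lambda>x rs. 0" and g = "\<lambda>x rs r j. r + g x rs j"])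
    show "computable (Suc (Suc d)) (\<lambda>x rs. last (butlast rs) + g x (butlast (butlast rs)) (last rs))"
      by (intro computable_plus computable_butlast computable_last G')
    show "\<exists>e. \<forall>x rs M j. well_formed x \<longrightarrow> length rs = d \<longrightarrow> bounds x rs M \<longrightarrow> j \<le> B x rs \<longrightarrow>
        rec_nat 0 (\<lambda>j r. r + g x rs j) j \<le> M ^ e"
    proof (intro exI[of _ "e1 + (e1 + 1) * e2"] allI impI)
      fix x rs M j
      assume a: "well_formed x" "length rs = d" "bounds x rs M" "j \<le> B x rs"
      have M: "2 \<le> M" using a(3) by (rule bounds_2)
      \<comment> \<open>The index can reach \<open>M ^ e1\<close>, so the bound for \<open>g\<close>
        is used at a larger base; the extra 1 makes the exponent positive.\<close>
      have "g x rs i \<le> (M ^ (e1 + 1)) ^ e2" if "i < j" for i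
      proof -
        have "i \<le> M ^ (e1 + 1)"
          using e1[OF a(1-3)] a(4) that le_pow_mono[OF M, of i e1 "e1 + 1"] by simp
        then have "bounds x (rs @ [i]) (M ^ (e1 + 1))"
          using bounds_pow[OF a(3), of "e1 + 1"] by (simp add: bounds_def)
        then show ?thesis using e2[OF a(1), of "rs @ [i]"] a(2) by simp
      qed
      then have "(\<Sum>i<j. g x rs i) \<le> (\<Sum>i<j. (M ^ (e1 + 1)) ^ e2)"
        by (intro sum_mono) simp
      also have "\<dots> = j * M ^ ((e1 + 1) * e2)" by (simp only: power_mult) simp
      also have "\<dots> \<le> M ^ (e1 + (e1 + 1) * e2)"
        using e1[OF a(1-3)] a(4) by (intro mult_le_pow) simp_all
      finally show "rec_nat 0 (\<lambda>j r. r + g x rs j) j \<le> M ^ (e1 + (e1 + 1) * e2)"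
        by (simp add: rec)
    qed
  qed (use B in \<open>simp_all add: computable_const\<close>)
qed

text \<open>All partial products lie below \<open>threshold\<close>, and \<open>bounds\<close>
  admits only \<open>M\<close> above it; this is how a superpolynomial value enters without
  disturbing composition.\<close>

lemma computable_threshold: "computable d (\<lambda>x rs. threshold x)"
proof -
  let ?n = "\<lambda>x rs::nat list. (2 * x ! 1 + 3) * (2 * x ! 1 + 1)"
  have rec: "(x ! 1 + 2) ^ n = rec_nat 1 (\<lambda>j r. r * (x ! 1 + 2)) n" for x :: "nat list" and n
    by (induction n) (auto simp: mult.commute)
  show ?thesis
    unfolding threshold_def rec
  proof (rule computable_iterate[where A = "\<lambda>x rs. 1" and B = ?n and g = "\<lambda>x rs r j. r * (x ! 1 + 2)"])
    show "computable (Suc (Suc d)) (\<lambda>x rs. last (butlast rs) * (x ! 1 + 2))"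
      by (intro computable_times computable_plus computable_butlast computable_last
          computable_const computable_header) simp
    show "computable d ?n"
      by (intro computable_times computable_plus computable_const computable_header) simp_all
    show "\<exists>e. \<forall>x rs M j. well_formed x \<longrightarrow> length rs = d \<longrightarrow> bounds x rs M \<longrightarrow> j \<le> ?n x rs \<longrightarrow>
        rec_nat 1 (\<lambda>j r. r * (x ! 1 + 2)) j \<le> M ^ e"
    proof (intro exI[of _ 1] allI impI)
      fix x rs :: "nat list" and M j
      assume a: "bounds x rs M" "j \<le> ?n x rs"
      have "(x ! 1 + 2) ^ j \<le> threshold x"
        unfolding threshold_def by (rule power_increasing) (use a(2) in auto)
      then show "rec_nat 1 (\<lambda>j r. r * (x ! 1 + 2)) j \<le> M ^ 1"
        unfolding rec[symmetric] using a(1) by (simp add: bounds_def)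
    qed
  qed (rule computable_const)
qed

text \<open>Unrestricted exponentiation has no polynomial bound in its arguments, so powers are cut
  off at \<open>threshold\<close>. The powers that the algorithm relies on turn out to lie below the
  cut.\<close>

definition capped_power :: "nat list \<Rightarrow> nat \<Rightarrow> nat \<Rightarrow> nat" where
  "capped_power x a b = min (threshold x) (a ^ b)"

lemma computable_capped_power:
  assumes A: "computable d A" and B: "computable d B"
  shows "computable d (\<lambda>x rs. capped_power x (A x rs) (B x rs))"
proof -
  \<comment> \<open>Cutting off in every round agrees with cutting off at the end, since a truncated
    value is multiplied either by 0 or by at least 1.\<close>
  have cap: "min t (min t y * a) = min t (y * a)" for t y a :: nat
  proof (cases "a = 0 \<or> y \<le> t")
    case False
    then have "t * 1 \<le> t * a" "t * a \<le> y * a" by (intro mult_le_mono; simp)+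
    then have "t \<le> t * a" "t \<le> y * a" by linarith+
    then show ?thesis using False by (simp add: min_absorb1)
  qed auto
  have pos: "1 \<le> threshold x" for x by (simp add: threshold_def)
  have rec: "capped_power x a n = rec_nat 1 (\<lambda>j r. min (threshold x) (r * a)) n" for x a n
  proof (induction n)
    case 0
    then show ?case using pos[of x] by (simp add: capped_power_def)
  next
    case (Suc n)
    then show ?case
      using cap[of "threshold x" "a ^ n" a] by (simp add: capped_power_def mult.commute)
  qed
  show ?thesis
    unfolding rec
  proof (rule computable_iterate[where A = "\<lambda>x rs. 1" and
        g = "\<lambda>x rs r j. min (threshold x) (r * A x rs)"])
    show "computable (Suc (Suc d)) (\<lambda>x rs. min (threshold x) (last (butlast rs) * A x (butlast (butlast rs))))"
      by (intro computable_min computable_threshold computable_times computable_butlast computable_last A)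
    show "\<exists>e. \<forall>x rs M j. well_formed x \<longrightarrow> length rs = d \<longrightarrow> bounds x rs M \<longrightarrow> j \<le> B x rs \<longrightarrow>
        rec_nat 1 (\<lambda>j r. min (threshold x) (r * A x rs)) j \<le> M ^ e"
      unfolding rec[symmetric] by (rule exI[of _ 1]) (auto simp: capped_power_def bounds_def)
  qed (use B in \<open>simp_all add: computable_const\<close>)
qed

section \<open>Closure under bounded quantifiers and minimization\<close>

definition decidable :: "nat \<Rightarrow> (nat list \<Rightarrow> nat list \<Rightarrow> bool) \<Rightarrow> bool" where
  "decidable d P \<longleftrightarrow> computable d (\<lambda>x rs. of_bool (P x rs))"

lemma decidable_butlast: "decidable d P \<Longrightarrow> decidable (Suc d) (\<lambda>x rs. P x (butlast rs))"
  unfolding decidable_def by (rule computable_butlast)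

lemma decidable_entry_eq:
  "computable d F \<Longrightarrow> computable d G \<Longrightarrow> decidable d (\<lambda>x rs. entry x (F x rs) = entry x (G x rs))"
  unfolding decidable_def by (rule computable_entry_eq)

lemma decidable_not: "decidable d P \<Longrightarrow> decidable d (\<lambda>x rs. \<not> P x rs)"
  unfolding decidable_def
  by (rule computable_cong[OF computable_minus[OF computable_const[where c = 1]]]) auto

lemma decidable_conj: "decidable d P \<Longrightarrow> decidable d Q \<Longrightarrow> decidable d (\<lambda>x rs. P x rs \<and> Q x rs)"
  unfolding decidable_def of_bool_conj by (intro computable_times)

lemma decidable_disj:
  assumes "decidable d P" "decidable d Q"
  shows "decidable d (\<lambda>x rs. P x rs \<or> Q x rs)"
  using decidable_not[OF decidable_conj[OF assms[THEN decidable_not]]] by simp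

lemma decidable_imp:
  assumes "decidable d P" "decidable d Q"
  shows "decidable d (\<lambda>x rs. P x rs \<longrightarrow> Q x rs)"
  unfolding imp_conv_disj by (intro decidable_disj decidable_not assms)

lemma decidable_le:
  assumes "computable d F" "computable d G"
  shows "decidable d (\<lambda>x rs. F x rs \<le> G x rs)"
  unfolding decidable_def
  by (rule computable_cong[OF computable_minus[OF computable_const[where c = 1] computable_minus[OF assms]]])
    auto

lemma decidable_less:
  assumes "computable d F" "computable d G"
  shows "decidable d (\<lambda>x rs. F x rs < G x rs)"
  using decidable_not[OF decidable_le[OF assms(2,1)]] by (simp add: not_le)

lemma decidable_eq:
  assumes "computable d F" "computable d G"
  shows "decidable d (\<lambda>x rs. F x rs = G x rs)"
  using decidable_conj[OF decidable_le[OF assms] decidable_le[OF assms(2,1)]]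
  by (simp add: order_eq_iff)

text \<open>Exhaustive search as a sum of truth values; it respects the cost bounds because a
  computable range is itself at most a power of \<open>M\<close>.\<close>

lemma decidable_bex:
  assumes "computable d B" "decidable (Suc d) (\<lambda>x rs. P x (butlast rs) (last rs))"
  shows "decidable d (\<lambda>x rs. \<exists>i<B x rs. P x rs i)"
proof -
  have "decidable d (\<lambda>x rs. 0 < (\<Sum>i<B x rs. of_bool (P x rs i) :: nat))"
    using decidable_less[OF computable_const[where c = 0] computable_sum[OF assms(1)
          assms(2)[unfolded decidable_def]]] .
  moreover have "0 < (\<Sum>i<n. of_bool (Q i)::nat) \<longleftrightarrow> (\<exists>i<n. Q i)" for n :: nat and Q
    by (auto simp: card_gt_0_iff)
  ultimately show ?thesis by (simp only:)
qed

lemma decidable_ball: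
  assumes "computable d B" "decidable (Suc d) (\<lambda>x rs. P x (butlast rs) (last rs))"
  shows "decidable d (\<lambda>x rs. \<forall>i<B x rs. P x rs i)"
  using decidable_not[OF decidable_bex[OF assms(1) decidable_not[OF assms(2)]]] by simp

lemma computable_of_bool: "decidable d P \<Longrightarrow> computable d (\<lambda>x rs. of_bool (P x rs))"
  by (simp add: decidable_def)

lemma computable_if:
  assumes "decidable d P" "computable d F" "computable d G"
  shows "computable d (\<lambda>x rs. if P x rs then F x rs else G x rs)"
proof -
  have "computable d (\<lambda>x rs. of_bool (P x rs) * F x rs + of_bool (\<not> P x rs) * G x rs)"
    by (intro computable_plus computable_times computable_of_bool decidable_not assms)
  then show ?thesis by (rule computable_cong) auto
qed

text \<open>Bounded minimization written as a count: \<open>j\<close> contributes while no witness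
  has occurred up to \<open>j\<close>. Without a witness the value is \<open>n\<close>, one beyond
  the range.\<close>

definition first :: "nat \<Rightarrow> (nat \<Rightarrow> bool) \<Rightarrow> nat" where
  "first n P = (\<Sum>j<n. of_bool (\<forall>i<j + 1. \<not> P i))"

lemma first_works:
  assumes "P m" "m < n"
  shows "P (first n P)" "first n P \<le> m"
proof -
  define l where "l = (LEAST i. P i)"
  have l: "P l" "l \<le> m" "\<And>i. i < l \<Longrightarrow> \<not> P i"
    unfolding l_def using assms(1) by (auto intro: LeastI Least_le dest: not_less_Least)
  have "(\<forall>i<j + 1. \<not> P i) \<longleftrightarrow> j < l" for j
    using l by (metis add.commute less_Suc_eq_le linorder_not_le order_le_less_trans plus_1_eq_Suc)
  then have "first n P = (\<Sum>j<n. of_bool (j < l))" by (simp add: first_def)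
  also have "\<dots> = card ({..<n} \<inter> {j. j < l})" by (simp add: of_bool_def sum.If_cases)
  also have "{..<n} \<inter> {j. j < l} = {..<l}" using l(2) assms(2) by auto
  finally have "first n P = l" by simp
  then show "P (first n P)" "first n P \<le> m" using l by auto
qed

lemma computable_first:
  assumes "computable d B" "decidable (Suc d) (\<lambda>x rs. P x (butlast rs) (last rs))"
  shows "computable d (\<lambda>x rs. first (B x rs) (\<lambda>i. P x rs i))"
proof -
  \<comment> \<open>The predicate ignores the summation index at position \<open>d\<close>; only the
    quantified index is passed on.\<close>
  have "decidable (Suc (Suc d)) (\<lambda>x rs. (\<lambda>x rs. P x (butlast rs) (last rs)) x (map ((!) rs) ([0..<d] @ [Suc d])))"
    unfolding decidable_def
    by (rule computable_reindex[where F = "\<lambda>x rs. of_bool (P x (butlast rs) (last rs))"])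
      (use assms(2) in \<open>auto simp: decidable_def\<close>)
  then have P': "decidable (Suc (Suc d)) (\<lambda>x rs. P x (butlast (butlast rs)) (last rs))"
    unfolding decidable_def
  proof (rule computable_cong)
    fix x rs :: "nat list"
    assume len: "length rs = Suc (Suc d)"
    then have "rs \<noteq> []" by auto
    with len have "butlast (butlast rs) = map ((!) rs) [0..<d]" "last rs = rs ! Suc d"
      using last_conv_nth[of rs] by (auto intro!: nth_equalityI simp: nth_butlast)
    then show "of_bool (P x (butlast (map ((!) rs) ([0..<d] @ [Suc d]))) (last (map ((!) rs) ([0..<d] @ [Suc d]))))
        = of_bool (P x (butlast (butlast rs)) (last rs))"
      by simp
  qed
  show ?thesis
    unfolding first_def
    by (intro computable_sum computable_of_bool decidable_ball computable_plus computable_last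
        computable_const assms(1) decidable_not P')
qed

section \<open>Nearly tight solutions of integer programs\<close>

text \<open>Siegel's lemma for a 0/1 system, by pigeonhole: the box with entries up to
  \<open>X\<close> contains more vectors than there are possible values of the \<open>r\<close> row
  sums, and two vectors with equal sums differ by a kernel vector.\<close>

lemma small_kernel_vector:
  fixes a :: "nat \<Rightarrow> nat \<Rightarrow> bool"
  assumes "r < n"
  obtains z :: "nat \<Rightarrow> int" where "\<exists>u<n. z u \<noteq> 0" "\<And>u. u < n \<Longrightarrow> \<bar>z u\<bar> \<le> int (n ^ r)"
    "\<And>e. e < r \<Longrightarrow> (\<Sum>u | u < n \<and> a e u. z u) = 0"
proof -
  define X where "X = n ^ r"
  let ?A = "PiE {..<n} (\<lambda>_. {..X})"
  let ?B = "PiE {..<r} (\<lambda>_. {..n * X})"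
  define \<phi> :: "(nat \<Rightarrow> nat) \<Rightarrow> nat \<Rightarrow> nat"
    where "\<phi> = (\<lambda>x. restrict (\<lambda>e. \<Sum>u | u < n \<and> a e u. x u) {..<r})"
  have "\<phi> ` ?A \<subseteq> ?B"
  proof (rule image_subsetI)
    fix x assume x: "x \<in> ?A"
    have "(\<Sum>u | u < n \<and> a e u. x u) \<le> n * X" for e
    proof -
      have "(\<Sum>u | u < n \<and> a e u. x u) \<le> (\<Sum>u<n. x u)"
        by (rule sum_mono2) auto
      also have "\<dots> \<le> (\<Sum>u<n. X)" using x by (intro sum_mono) auto
      finally show ?thesis by simp
    qed
    then show "\<phi> x \<in> ?B" by (auto simp: \<phi>_def)
  qed
  then have "card (\<phi> ` ?A) \<le> card ?B"
    by (intro card_mono finite_PiE) auto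
  also have "\<dots> = (n * X + 1) ^ r" by (simp add: card_PiE)
  also have "\<dots> \<le> (n * (X + 1)) ^ r" using assms by (intro power_mono) auto
  \<comment> \<open>This is the reason for \<open>X = n ^ r\<close>: the surplus factor
    \<open>n ^ r\<close> equals \<open>X\<close>, just less than one more factor
    \<open>X + 1\<close>.\<close>
  also have "\<dots> = X * (X + 1) ^ r" by (simp only: X_def power_mult_distrib)
  also have "\<dots> < (X + 1) ^ Suc r" by simp
  also have "\<dots> \<le> (X + 1) ^ n" using assms by (intro power_increasing) auto
  also have "\<dots> = card ?A" by (simp add: card_PiE)
  finally have "\<not> inj_on \<phi> ?A" by (rule pigeonhole)
  then obtain x y where xy: "x \<in> ?A" "y \<in> ?A" "\<phi> x = \<phi> y" "x \<noteq> y"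
    by (auto simp: inj_on_def)
  let ?z = "\<lambda>u. int (x u) - int (y u)"
  show thesis
  proof (rule that[of ?z])
    show "\<exists>u<n. ?z u \<noteq> 0"
      using xy(4) PiE_ext[OF xy(1,2)] by auto
    show "\<bar>?z u\<bar> \<le> int (n ^ r)" if "u < n" for u
    proof -
      have "x u \<le> X" "y u \<le> X" using xy(1,2) that by auto
      then show ?thesis unfolding X_def[symmetric] by linarith
    qed
    show "(\<Sum>u | u < n \<and> a e u. ?z u) = 0" if "e < r" for e
    proof -
      have "\<phi> x e = \<phi> y e" using xy(3) by simp
      then have "(\<Sum>u | u < n \<and> a e u. x u) = (\<Sum>u | u < n \<and> a e u. y u)"
        using that by (simp add: \<phi>_def)
      then have "int (\<Sum>u | u < n \<and> a e u. x u) = int (\<Sum>u | u < n \<and> a e u. y u)"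
        by simp
      then show ?thesis by (simp add: sum_subtractf)
    qed
  qed
qed

definition feasible :: "(nat set \<times> int) set \<Rightarrow> (nat set \<times> int) set \<Rightarrow> (nat \<Rightarrow> int) \<Rightarrow> bool" where
  "feasible L H t \<longleftrightarrow> (\<forall>(W, R)\<in>L. R \<le> sum t W) \<and> (\<forall>(W, R)\<in>H. sum t W \<le> R)"

lemma feasible_lower: "feasible L H t \<Longrightarrow> (W, R) \<in> L \<Longrightarrow> R \<le> sum t W"
  unfolding feasible_def by auto

lemma feasible_upper: "feasible L H t \<Longrightarrow> (W, R) \<in> H \<Longrightarrow> sum t W \<le> R"
  unfolding feasible_def by auto

text \<open>Linear independence of the incidence vectors; integer coefficients suffice because
  denominators can be cleared.\<close>

definition independent_sets :: "nat \<Rightarrow> nat \<Rightarrow> (nat \<Rightarrow> nat set) \<Rightarrow> bool" where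
  "independent_sets k r W \<longleftrightarrow>
     (\<forall>q :: nat \<Rightarrow> int. (\<forall>v<k. (\<Sum>i<r. q i * of_bool (v \<in> W i)) = 0) \<longrightarrow> (\<forall>i<r. q i = 0))"

lemma sum_over_combination:
  fixes q t :: "nat \<Rightarrow> int"
  assumes "\<And>i. i < r \<Longrightarrow> W i \<subseteq> {..<k}"
  shows "(\<Sum>i<r. q i * sum t (W i)) = (\<Sum>v<k. (\<Sum>i<r. q i * of_bool (v \<in> W i)) * t v)"
proof -
  have "sum t (W i) = (\<Sum>v<k. of_bool (v \<in> W i) * t v)" if "i < r" for i
    using assms[OF that] by (intro sum.mono_neutral_cong_left) auto
  then have "q i * sum t (W i) = (\<Sum>v<k. q i * of_bool (v \<in> W i) * t v)" if "i < r" for i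
    using that by (simp only: sum_distrib_left mult.assoc)
  then have "(\<Sum>i<r. q i * sum t (W i)) = (\<Sum>i<r. \<Sum>v<k. q i * of_bool (v \<in> W i) * t v)"
    by (intro sum.cong refl) (simp only: lessThan_iff)
  also have "\<dots> = (\<Sum>v<k. \<Sum>i<r. q i * of_bool (v \<in> W i) * t v)"
    by (rule sum.swap)
  finally show ?thesis by (simp only: sum_distrib_right)
qed

text \<open>Pairing a vanishing combination with \<open>z\<close> leaves only its last term. Hence
  \<open>q r = 0\<close>, and the rest is a vanishing combination of the old sets.\<close>

lemma independent_sets_Suc:
  fixes z :: "nat \<Rightarrow> int"
  assumes ind: "independent_sets k r W" and sub: "\<And>i. i < Suc r \<Longrightarrow> W i \<subseteq> {..<k}"
    and z: "\<And>i. i < r \<Longrightarrow> sum z (W i) = 0" "sum z (W r) \<noteq> 0"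
  shows "independent_sets k (Suc r) W"
  unfolding independent_sets_def
proof (intro allI impI)
  fix q :: "nat \<Rightarrow> int" and i
  assume q: "\<forall>v<k. (\<Sum>i<Suc r. q i * of_bool (v \<in> W i)) = 0" and i: "i < Suc r"
  have "(\<Sum>i<Suc r. q i * sum z (W i)) = 0"
    using sum_over_combination[of "Suc r" W k q z] sub q by simp
  then have qr: "q r = 0" using z by simp
  then have "\<forall>v<k. (\<Sum>i<r. q i * of_bool (v \<in> W i)) = 0" using q by simp
  then have "\<forall>i<r. q i = 0" using ind unfolding independent_sets_def by blast
  then show "q i = 0" using qr i by (auto simp: less_Suc_eq)
qed

text \<open>
  As long as fewer than \<open>k\<close> independent constraints are nearly tight, the solution can be moved
  along a short vector orthogonal to these; nothing is violated until a further constraint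
  becomes nearly tight.
\<close>
lemma nearly_tight_solution:
  assumes sub: "\<And>W R. (W, R) \<in> L \<union> H \<Longrightarrow> W \<subseteq> {..<k}"
    and nonneg: "\<And>v. v < k \<Longrightarrow> \<exists>R\<ge>0. ({v}, R) \<in> L"
    and feas: "feasible L H t0"
    and "r \<le> k"
  defines "K \<equiv> int (k * (k + 1) ^ k)"
  shows "\<exists>t W R. feasible L H t \<and> independent_sets k r W \<and>
    (\<forall>i<r. (W i, R i) \<in> L \<union> H \<and> \<bar>sum t (W i) - R i\<bar> \<le> K)"
  using \<open>r \<le> k\<close>
proof (induction r)
  case 0
  then show ?case using feas by (auto simp: independent_sets_def)
next
  case (Suc r)
  then obtain t W R where t: "feasible L H t" "independent_sets k r W"
    "\<And>i. i < r \<Longrightarrow> (W i, R i) \<in> L \<union> H \<and> \<bar>sum t (W i) - R i\<bar> \<le> K"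
    by auto
  have Wsub: "W i \<subseteq> {..<k}" if "i < r" for i using sub t(3)[OF that] by blast
  obtain z0 :: "nat \<Rightarrow> int" where z0: "\<exists>u<k. z0 u \<noteq> 0" "\<And>u. u < k \<Longrightarrow> \<bar>z0 u\<bar> \<le> int (k ^ r)"
    "\<And>e. e < r \<Longrightarrow> (\<Sum>u | u < k \<and> u \<in> W e. z0 u) = 0"
    by (rule small_kernel_vector[of r k "\<lambda>e u. u \<in> W e"]) (use Suc.prems in simp, rule that)
  have W_eq: "{u. u < k \<and> u \<in> W e} = W e" if "e < r" for e using Wsub[OF that] by auto
  obtain u0 where u0: "u0 < k" "z0 u0 \<noteq> 0" using z0(1) by blast
  \<comment> \<open>Oriented so that some coordinate decreases; the coordinates of feasible
    solutions are nonnegative, so the walk along \<open>z\<close> must end.\<close>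
  define z where "z = (if z0 u0 < 0 then z0 else (\<lambda>u. - z0 u))"
  have z: "z u0 < 0" "\<And>u. u < k \<Longrightarrow> \<bar>z u\<bar> \<le> int (k ^ r)" "\<And>e. e < r \<Longrightarrow> sum z (W e) = 0"
    using u0 z0 W_eq by (auto simp: z_def sum_negf)
  have zK: "\<bar>sum z X\<bar> \<le> K" if "X \<subseteq> {..<k}" for X
  proof -
    have "k ^ r \<le> (k + 1) ^ r" by (rule power_mono) auto
    also have "\<dots> \<le> (k + 1) ^ k" using Suc.prems by (intro power_increasing) auto
    finally have kr: "int (k ^ r) \<le> int ((k + 1) ^ k)" by linarith
    have "\<bar>sum z X\<bar> \<le> (\<Sum>u\<in>X. \<bar>z u\<bar>)" by (rule sum_abs)
    also have "\<dots> \<le> (\<Sum>u<k. \<bar>z u\<bar>)" using that by (intro sum_mono2) auto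
    also have "\<dots> \<le> (\<Sum>u<k. int ((k + 1) ^ k))"
      using z(2) kr by (intro sum_mono) (meson lessThan_iff order.trans)
    finally show ?thesis by (simp add: K_def)
  qed
  have "\<exists>t X Y. feasible L H t \<and> (X, Y) \<in> L \<union> H \<and> \<bar>sum t X - Y\<bar> \<le> K \<and> sum z X \<noteq> 0 \<and>
      (\<forall>i<r. sum t (W i) = sum t' (W i))"
    if "feasible L H t'" for t'
    using that
  proof (induction "nat (t' u0)" arbitrary: t' rule: less_induct)
    case less
    show ?case
    proof (cases "\<exists>X Y. (X, Y) \<in> L \<union> H \<and> \<bar>sum t' X - Y\<bar> \<le> K \<and> sum z X \<noteq> 0")
      case True
      then show ?thesis using less.prems by blast
    next
      case False
      define t1 where "t1 = (\<lambda>u. t' u + z u)"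
      have sum1: "sum t1 X = sum t' X + sum z X" for X
        by (simp add: t1_def sum.distrib)
      \<comment> \<open>A constraint that \<open>z\<close> affects has slack above \<open>K\<close>,
        and one step changes its sum by at most \<open>K\<close>.\<close>
      have slack: "sum z X = 0 \<or> K < \<bar>sum t' X - Y\<bar> \<and> \<bar>sum z X\<bar> \<le> K" if "(X, Y) \<in> L \<union> H" for X Y
        using False that zK[OF sub[OF that]] by force
      have "feasible L H t1"
        unfolding feasible_def
      proof (intro conjI ballI; clarify)
        fix X Y
        { assume "(X, Y) \<in> L"
          then have "Y \<le> sum t' X" using less.prems by (auto simp: feasible_def)
          then show "Y \<le> sum t1 X" using slack[of X Y] \<open>(X, Y) \<in> L\<close>
            unfolding sum1 by auto }
        { assume "(X, Y) \<in> H"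
          then have "sum t' X \<le> Y" using less.prems by (auto simp: feasible_def)
          then show "sum t1 X \<le> Y" using slack[of X Y] \<open>(X, Y) \<in> H\<close>
            unfolding sum1 by auto }
      qed
      moreover have "0 \<le> t1 u0"
      proof -
        obtain R where "R \<ge> 0" "({u0}, R) \<in> L" using nonneg[OF u0(1)] by blast
        then show ?thesis using \<open>feasible L H t1\<close> by (force simp: feasible_def)
      qed
      then have "nat (t1 u0) < nat (t' u0)" using z(1) by (simp add: t1_def)
      ultimately obtain t2 X Y where "feasible L H t2" "(X, Y) \<in> L \<union> H" "\<bar>sum t2 X - Y\<bar> \<le> K"
        "sum z X \<noteq> 0" "\<forall>i<r. sum t2 (W i) = sum t1 (W i)"
        using less.hyps[of t1] by blast
      then show ?thesis using z(3) by (auto simp: sum1)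
    qed
  qed
  from this[OF t(1)] obtain t' X Y where t': "feasible L H t'" "(X, Y) \<in> L \<union> H"
    "\<bar>sum t' X - Y\<bar> \<le> K" "sum z X \<noteq> 0" "\<forall>i<r. sum t' (W i) = sum t (W i)"
    by blast
  \<comment> \<open>The walk kept the earlier sums, as \<open>z\<close> is orthogonal to them; the
    constraint that stopped it is not orthogonal to \<open>z\<close>, hence independent of the
    earlier ones.\<close>
  have "independent_sets k (Suc r) (W(r := X))"
  proof (rule independent_sets_Suc[where z = z])
    show "independent_sets k r (W(r := X))"
      using t(2) by (simp add: independent_sets_def)
    show "(W(r := X)) i \<subseteq> {..<k}" if "i < Suc r" for i
      using that Wsub sub[OF t'(2)] by (auto simp: less_Suc_eq)
  qed (use z(3) t'(4) in auto)
  moreover have "\<forall>i<Suc r. ((W(r := X)) i, (R(r := Y)) i) \<in> L \<union> H \<and>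
      \<bar>sum t' ((W(r := X)) i) - (R(r := Y)) i\<bar> \<le> K"
    using t(3) t' by (auto simp: less_Suc_eq)
  ultimately show ?case using t'(1) by blast
qed

text \<open>Siegel's lemma is applied to the \<open>k\<close> incidence vectors together with the
  \<open>v\<close>-th unit vector: \<open>k + 1\<close> columns in dimension \<open>k\<close>.
  Independence forces a nonzero coefficient on the unit vector, which becomes the denominator
  \<open>d\<close>. This takes the place of Cramer's rule.\<close>

lemma bounded_inverse_row:
  assumes ind: "independent_sets k k W" and v: "v < k"
  defines "D \<equiv> int ((k + 1) ^ k)"
  obtains q :: "nat \<Rightarrow> int" and d :: int where "0 < d" "d \<le> D" "\<And>i. i < k \<Longrightarrow> \<bar>q i\<bar> \<le> D"
    "\<And>u. u < k \<Longrightarrow> (\<Sum>i<k. q i * of_bool (u \<in> W i)) = d * of_bool (u = v)"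
proof -
  have D: "D = int (Suc k ^ k)" by (simp add: D_def)
  obtain z :: "nat \<Rightarrow> int" where z: "\<exists>u<Suc k. z u \<noteq> 0" "\<And>u. u < Suc k \<Longrightarrow> \<bar>z u\<bar> \<le> int (Suc k ^ k)"
    "\<And>e. e < k \<Longrightarrow> (\<Sum>i | i < Suc k \<and> (if i < k then e \<in> W i else e = v). z i) = 0"
    by (rule small_kernel_vector[of k "Suc k" "\<lambda>e i. if i < k then e \<in> W i else e = v"])
      (simp, rule that)
  note zD = z(2)[folded D]
  have rel: "(\<Sum>i<k. z i * of_bool (u \<in> W i)) = - z k * of_bool (u = v)" if "u < k" for u
  proof -
    have "(\<Sum>i<Suc k. z i * of_bool (if i < k then u \<in> W i else u = v)) = 0"
      using z(3)[OF that]
      by (rule trans[OF sum.mono_neutral_cong_right, rotated -1]) auto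
    then show ?thesis by simp
  qed
  have zk: "z k \<noteq> 0"
  proof
    assume "z k = 0"
    then have "\<forall>i<k. z i = 0"
      using ind rel unfolding independent_sets_def by simp
    then show False using z(1) \<open>z k = 0\<close> by (auto simp: less_Suc_eq)
  qed
  show thesis
  proof (cases "z k < 0")
    case True
    show ?thesis
      by (rule that[of "- z k" z]) (use True rel zD in \<open>auto simp: abs_le_iff\<close>)
  next
    case False
    show ?thesis
      by (rule that[of "z k" "\<lambda>i. - z i"])
        (use False zk rel zD in \<open>auto simp: sum_negf abs_le_iff\<close>)
  qed
qed

text \<open>Pairing the relation for \<open>q\<close> with \<open>t\<close> isolates
  \<open>d * t v\<close>; replacing each of the \<open>k\<close> sums by its right-hand side costs
  at most \<open>D * K\<close>.\<close>

lemma approximation_by_inverse_row: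
  fixes t R :: "nat \<Rightarrow> int"
  assumes "v < k" and sub: "\<And>i. i < k \<Longrightarrow> W i \<subseteq> {..<k}"
    and tight: "\<And>i. i < k \<Longrightarrow> \<bar>sum t (W i) - R i\<bar> \<le> K"
    and q: "\<And>i. i < k \<Longrightarrow> \<bar>q i\<bar> \<le> D"
      "\<And>u. u < k \<Longrightarrow> (\<Sum>i<k. q i * of_bool (u \<in> W i)) = d * of_bool (u = v)"
  shows "\<bar>d * t v - (\<Sum>i<k. q i * R i)\<bar> \<le> int k * (D * K)"
proof -
  have "(\<Sum>i<k. q i * sum t (W i)) = (\<Sum>u<k. d * of_bool (u = v) * t u)"
    using sum_over_combination[of k W k q t] sub q(2) by simp
  also have "\<dots> = d * t v"
    using \<open>v < k\<close> by (subst sum.remove[of _ v]) (auto intro: sum.neutral)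
  finally have "\<bar>d * t v - (\<Sum>i<k. q i * R i)\<bar> = \<bar>\<Sum>i<k. q i * (sum t (W i) - R i)\<bar>"
    by (simp add: right_diff_distrib sum_subtractf)
  also have "\<dots> \<le> (\<Sum>i<k. \<bar>q i * (sum t (W i) - R i)\<bar>)" by (rule sum_abs)
  also have "\<dots> \<le> (\<Sum>i<k. D * K)"
    using q(1) tight
    by (intro sum_mono) (auto simp: abs_mult intro!: mult_mono order.trans[OF abs_ge_zero])
  finally show ?thesis by simp
qed

section \<open>Hall's theorem with lower and upper bounds\<close>

definition fibre :: "'a set \<Rightarrow> ('a \<Rightarrow> 'b) \<Rightarrow> 'b \<Rightarrow> nat" where
  "fibre A f v = card {i \<in> A. f i = v}"

text \<open>The additive form avoids truncated subtraction and covers \<open>b = f i\<close> as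
  well.\<close>

lemma fibre_update:
  assumes "finite A" "i \<in> A"
  shows "fibre A (f(i := b)) x + of_bool (x = f i) = fibre A f x + of_bool (x = b)"
proof -
  have eq: "fibre A g x = fibre (A - {i}) g x + of_bool (x = g i)" for g :: "'a \<Rightarrow> 'b" and x
  proof -
    have "{j \<in> A. g j = x} = {j \<in> A - {i}. g j = x} \<union> (if x = g i then {i} else {})"
      using assms(2) by auto
    moreover have "card ({j \<in> A - {i}. g j = x} \<union> (if x = g i then {i} else {}))
        = card {j \<in> A - {i}. g j = x} + of_bool (x = g i)"
      using assms(1) by (auto simp: card_insert_if)
    ultimately show ?thesis unfolding fibre_def by simp
  qed
  have "{j \<in> A - {i}. (f(i := b)) j = x} = {j \<in> A - {i}. f j = x}" by auto
  then have "fibre (A - {i}) (f(i := b)) x = fibre (A - {i}) f x" by (simp only: fibre_def)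
  then show ?thesis using eq[of f x] eq[of "f(i := b)" x] by simp
qed

lemma fibre_sum:
  assumes "finite A" "finite W"
  shows "sum (fibre A f) W = card {i \<in> A. f i \<in> W}"
proof -
  have "{i \<in> A. f i \<in> W} = (\<Union>v\<in>W. {i \<in> A. f i = v})" by auto
  then show ?thesis
    using assms by (simp add: fibre_def, subst card_UN_disjoint) auto
qed

text \<open>The residual graph of the assignment \<open>f\<close>. The set \<open>S\<close> limits
  which vertices may be left, so that an induction on \<open>S\<close> can consume a path vertex by
  vertex.\<close>

definition exchange :: "'a set \<Rightarrow> ('a \<Rightarrow> 'b set) \<Rightarrow> 'b set \<Rightarrow> ('a \<Rightarrow> 'b) \<Rightarrow> ('b \<times> 'b) set" where
  "exchange A N S f = {(x, y). x \<in> S \<and> (\<exists>i\<in>A. f i = x \<and> y \<in> N i)}"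

text \<open>Cut the path at its last visit to \<open>v\<close>; the remainder never leaves
  \<open>v\<close> again.\<close>

lemma exchange_last_visit:
  assumes "(v, w) \<in> (exchange A N S f)\<^sup>*" "v \<noteq> w"
  obtains b where "(v, b) \<in> exchange A N S f" "(b, w) \<in> (exchange A N (S - {v}) f)\<^sup>*"
proof -
  have "v = w \<or> (\<exists>b. (v, b) \<in> exchange A N S f \<and> (b, w) \<in> (exchange A N (S - {v}) f)\<^sup>*)"
    using assms(1)
  proof (induction rule: rtrancl_induct)
    case (step y w)
    show ?case
    proof (cases "y = v")
      case False
      then have "(y, w) \<in> exchange A N (S - {v}) f" using step(2) by (auto simp: exchange_def)
      with step False show ?thesis by (blast intro: rtrancl_into_rtrancl)
    qed (use step in blast)
  qed simp
  then show thesis using that assms(2) by blast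
qed

text \<open>Moving one element along each edge of a simple exchange path shifts one unit from \<open>v\<close> to \<open>w\<close>.\<close>
lemma exchange_shift:
  assumes "finite A" "finite S" "\<forall>i\<in>A. f i \<in> N i" "(v, w) \<in> (exchange A N S f)\<^sup>*"
  shows "\<exists>f'. (\<forall>i\<in>A. f' i \<in> N i) \<and>
    (\<forall>x. fibre A f' x + of_bool (x = v) = fibre A f x + of_bool (x = w))"
  using assms(2-)
proof (induction "card S" arbitrary: S f v rule: less_induct)
  case less
  show ?case
  proof (cases "v = w")
    case False
    obtain b where b: "(v, b) \<in> exchange A N S f" "(b, w) \<in> (exchange A N (S - {v}) f)\<^sup>*"
      using exchange_last_visit[OF less.prems(3) False] .
    obtain i where i: "i \<in> A" "f i = v" "b \<in> N i" "v \<in> S"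
      using b(1) by (auto simp: exchange_def)
    let ?f = "f(i := b)"
    \<comment> \<open>Moving \<open>i\<close> can only destroy edges that leave \<open>v\<close>,
      and the rest of the path uses none of these.\<close>
    have "exchange A N (S - {v}) f \<subseteq> exchange A N (S - {v}) ?f"
      using i(2) by (auto simp: exchange_def)
    then have "(b, w) \<in> (exchange A N (S - {v}) ?f)\<^sup>*" using b(2) rtrancl_mono by blast
    moreover have "card (S - {v}) < card S" using less.prems(1) i(4) by (rule card_Diff1_less)
    moreover have "\<forall>i\<in>A. ?f i \<in> N i" using less.prems(2) i(3) by simp
    ultimately obtain f' where f': "\<forall>i\<in>A. f' i \<in> N i"
      "\<forall>x. fibre A f' x + of_bool (x = b) = fibre A ?f x + of_bool (x = w)"
      using less.hyps[of "S - {v}" ?f b] less.prems(1) by blast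
    have "fibre A f' x + of_bool (x = v) = fibre A f x + of_bool (x = w)" for x
      using fibre_update[OF assms(1) i(1), of f b x] f'(2)[rule_format, of x]
      unfolding i(2) by linarith
    then show ?thesis using f'(1) by blast
  qed (use less.prems in blast)
qed

text \<open>
  A map \<open>f\<close> of least total violation of the bounds satisfies them: an offending vertex together
  with everything it can exchange with would otherwise violate one of the two Hall conditions.
\<close>
lemma Hall_with_bounds:
  fixes N :: "'a \<Rightarrow> 'b set" and lo up :: "'b \<Rightarrow> nat"
  assumes A: "finite A" and V: "finite V" and N: "\<And>i. i \<in> A \<Longrightarrow> N i \<subseteq> V"
    and lo_up: "\<And>v. v \<in> V \<Longrightarrow> lo v \<le> up v"
    and upper: "\<And>W. W \<subseteq> V \<Longrightarrow> card {i \<in> A. N i \<subseteq> W} \<le> sum up W"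
    and lower: "\<And>W. W \<subseteq> V \<Longrightarrow> sum lo W \<le> card {i \<in> A. N i \<inter> W \<noteq> {}}"
  obtains f where "\<And>i. i \<in> A \<Longrightarrow> f i \<in> N i" "\<And>v. v \<in> V \<Longrightarrow> lo v \<le> fibre A f v \<and> fibre A f v \<le> up v"
proof -
  define valid where "valid = (\<lambda>f. \<forall>i\<in>A. f i \<in> N i)"
  define viol where "viol = (\<lambda>f v. (fibre A f v - up v) + (lo v - fibre A f v))"
  have "card {i \<in> A. N i \<subseteq> {}} \<le> 0" using upper[of "{}"] by simp
  then have "\<forall>i\<in>A. N i \<noteq> {}" using A by auto
  then have "valid (\<lambda>i. SOME x. x \<in> N i)" by (simp add: valid_def some_in_eq)
  then obtain f where f: "valid f" "\<And>g. valid g \<Longrightarrow> sum (viol f) V \<le> sum (viol g) V"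
    using ex_has_least_nat[of valid _ "\<lambda>f. sum (viol f) V"] by blast
  define E where "E = exchange A N V f"
  have fN: "i \<in> A \<Longrightarrow> f i \<in> N i" for i using f(1) by (simp add: valid_def)
  have fV: "i \<in> A \<Longrightarrow> f i \<in> V" for i using fN N by blast
  \<comment> \<open>A shift out of an overfull \<open>v\<close> or into a deficient \<open>w\<close>
    repairs one violation; \<open>bad\<close> together with \<open>lo v \<le> up v\<close> ensures
    that the other end is not harmed.\<close>
  have no_shift: False
    if vw: "(v, w) \<in> E\<^sup>*" "v \<in> V" "w \<in> V" "v \<noteq> w"
      and bad: "fibre A f v > up v \<and> fibre A f w < up w \<or> fibre A f w < lo w \<and> fibre A f v > lo v" for v w
  proof -
    have "\<forall>i\<in>A. f i \<in> N i" using fN by blast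
    from exchange_shift[OF A V this vw(1)[unfolded E_def]] obtain f' where f': "valid f'"
      "\<And>x. fibre A f' x + of_bool (x = v) = fibre A f x + of_bool (x = w)"
      unfolding valid_def by blast
    have "viol f' x \<le> viol f x" if "x \<in> V" for x
      using f'(2)[of x] bad lo_up[OF that] vw(4)
      by (cases "x = v"; cases "x = w") (auto simp: viol_def)
    moreover have "viol f' v < viol f v \<or> viol f' w < viol f w"
      using f'(2)[of v] f'(2)[of w] bad lo_up[OF vw(2)] lo_up[OF vw(3)] vw(4)
      by (auto simp: viol_def)
    ultimately have "sum (viol f') V < sum (viol f) V"
      using vw(2,3) V by (intro sum_strict_mono_ex1) auto
    then show False using f(2)[OF f'(1)] by simp
  qed
  have "fibre A f v \<le> up v" if v: "v \<in> V" for v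
  proof (rule ccontr)
    assume over: "\<not> fibre A f v \<le> up v"
    \<comment> \<open>All elements placed in \<open>R\<close> have their neighborhoods inside
      \<open>R\<close>, which is full at every vertex and overfull at \<open>v\<close>; this
      contradicts \<open>upper\<close>.\<close>
    define R where "R = {w. (v, w) \<in> E\<^sup>*}"
    have closed: "N i \<subseteq> R" if "i \<in> A" "f i \<in> R" for i
      using that fV unfolding R_def E_def exchange_def by (auto intro: rtrancl_into_rtrancl)
    have "R \<subseteq> V"
    proof
      fix w assume "w \<in> R"
      then have "(v, w) \<in> E\<^sup>*" by (simp add: R_def)
      then show "w \<in> V" using v N by (cases rule: rtranclE) (auto simp: E_def exchange_def)
    qed
    have "up w \<le> fibre A f w" if "w \<in> R" for w
    proof (rule ccontr)
      assume "\<not> ?thesis"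
      then show False
        using no_shift[of v w] over v that subsetD[OF \<open>R \<subseteq> V\<close> that]
        by (cases "w = v") (auto simp: R_def)
    qed
    moreover have "v \<in> R" by (simp add: R_def)
    moreover have "finite R" using \<open>R \<subseteq> V\<close> V finite_subset by blast
    ultimately have "sum up R < sum (fibre A f) R"
      using over by (intro sum_strict_mono_ex1 bexI[of _ v]) auto
    also have "\<dots> = card {i \<in> A. f i \<in> R}"
      by (rule fibre_sum[OF A \<open>finite R\<close>])
    also have "\<dots> \<le> card {i \<in> A. N i \<subseteq> R}"
      using A closed by (intro card_mono) auto
    also have "\<dots> \<le> sum up R" by (rule upper[OF \<open>R \<subseteq> V\<close>])
    finally show False by simp
  qed
  moreover have "lo v \<le> fibre A f v" if v: "v \<in> V" for v
  proof (rule ccontr)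
    assume under: "\<not> lo v \<le> fibre A f v"
    \<comment> \<open>Dually, every element that could be placed in \<open>R\<close> already is, yet
      \<open>R\<close> falls short of its total lower bound; this contradicts
      \<open>lower\<close>.\<close>
    define R where "R = {w. (w, v) \<in> E\<^sup>*}"
    have closed: "f i \<in> R" if "i \<in> A" "N i \<inter> R \<noteq> {}" for i
      using that fV
      unfolding R_def E_def exchange_def by (auto intro: converse_rtrancl_into_rtrancl)
    have "R \<subseteq> V"
    proof
      fix w assume "w \<in> R"
      then have "(w, v) \<in> E\<^sup>*" by (simp add: R_def)
      then show "w \<in> V"
        using v by (cases rule: converse_rtranclE) (auto simp: E_def exchange_def)
    qed
    have "fibre A f w \<le> lo w" if "w \<in> R" for w
    proof (rule ccontr)
      assume "\<not> ?thesis"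
      then show False
        using no_shift[of w v] under v that subsetD[OF \<open>R \<subseteq> V\<close> that]
        by (cases "w = v") (auto simp: R_def)
    qed
    moreover have "v \<in> R" by (simp add: R_def)
    moreover have "finite R" using \<open>R \<subseteq> V\<close> V finite_subset by blast
    ultimately have "sum (fibre A f) R < sum lo R"
      using under by (intro sum_strict_mono_ex1 bexI[of _ v]) auto
    moreover have "sum lo R \<le> card {i \<in> A. N i \<inter> R \<noteq> {}}"
      by (rule lower[OF \<open>R \<subseteq> V\<close>])
    moreover have "\<dots> \<le> card {i \<in> A. f i \<in> R}"
      using A closed by (intro card_mono) auto
    moreover have "\<dots> = sum (fibre A f) R"
      by (rule fibre_sum[OF A \<open>finite R\<close>, symmetric])
    ultimately show False by simp
  qed
  ultimately show thesis using that[of f] fN by blast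
qed

section \<open>Certificates\<close>

lemma card_less_pigeon:
  assumes "finite B" "card B < card A"
  shows "\<exists>a\<in>A. a \<notin> B"
  using assms by (meson card_mono not_less subsetI)

lemma sum_add_indicator:
  fixes a :: "'a \<Rightarrow> nat"
  assumes "finite W"
  shows "(\<Sum>v\<in>W. a v + l * of_bool (P v)) = sum a W + l * card {v \<in> W. P v}"
proof -
  have "(\<Sum>v\<in>W. l * of_bool (P v)) = l * card (W \<inter> {v. P v})"
    using assms by (simp add: sum_distrib_left[symmetric])
  then show ?thesis by (simp add: sum.distrib Collect_conj_eq)
qed

text \<open>\<open>\<gamma>\<close> is the number of colors; \<open>\<delta>\<close> is 1 with the
  non-emptiness constraint and 0 without it, so that both versions are treated at once.\<close>

locale fair_assignment =
  fixes n k \<gamma> l \<delta> :: nat and cl :: "nat \<Rightarrow> nat" and N :: "nat \<Rightarrow> nat set"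
  assumes N: "i < n \<Longrightarrow> N i \<subseteq> {..<k}"
    and \<delta>: "\<delta> \<le> 1"
begin

definition "cls" :: "nat \<Rightarrow> nat set" where "cls c = {i. i < n \<and> cl i = c}"

definition trapped :: "nat \<Rightarrow> nat set \<Rightarrow> nat" where
  "trapped c W = card {i \<in> cls c. N i \<subseteq> W}"

definition meet :: "nat \<Rightarrow> nat set \<Rightarrow> nat" where
  "meet c W = card {i \<in> cls c. N i \<inter> W \<noteq> {}}"

text \<open>Instead of sorting the counts, it asks for a most frequent color and any other color
  within \<open>l\<close> of it; the runner-up is the best choice for the latter.\<close>

definition solves :: "(nat \<Rightarrow> nat) \<Rightarrow> bool" where
  "solves f \<longleftrightarrow> (\<forall>i<n. f i \<in> N i) \<and> (\<forall>v<k. \<delta> \<le> fibre {..<n} f v \<and>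
     (\<exists>c1<\<gamma>. \<exists>c2<\<gamma>. c1 \<noteq> c2 \<and> (\<forall>c<\<gamma>. fibre (cls c) f v \<le> fibre (cls c1) f v) \<and>
        fibre (cls c1) f v \<le> fibre (cls c2) f v + l))"

text \<open>\<open>\<rho> v\<close> is the most frequent color at \<open>v < k\<close>, and \<open>\<rho> (k + v)\<close> is the runner-up.\<close>
definition slots :: "(nat \<Rightarrow> nat) \<Rightarrow> nat \<Rightarrow> nat set" where
  "slots \<rho> c = {v. v < k \<and> (\<rho> v = c \<or> \<rho> (k + v) = c)}"

text \<open>A vertex whose runner-up is \<open>c\<close> may hold up to \<open>l\<close> fewer
  elements of color \<open>c\<close> than \<open>t v\<close>; each such vertex adds \<open>l\<close>
  to what \<open>t\<close> may claim.\<close>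

definition cap :: "(nat \<Rightarrow> nat) \<Rightarrow> nat \<Rightarrow> nat set \<Rightarrow> nat" where
  "cap \<rho> c W = meet c W + l * card {v \<in> W. \<rho> (k + v) = c}"

text \<open>Hall's conditions for all colors. Color \<open>c\<close> has upper quota
  \<open>t v\<close> everywhere and lower quota \<open>t v\<close> or \<open>t v - l\<close> at its
  slots; the terms \<open>l\<close> are moved into \<open>cap\<close>. Bounding the leading count by
  \<open>\<delta>\<close> expresses non-emptiness, since a nonempty set has a nonempty largest color
  class.\<close>

definition certificate :: "(nat \<Rightarrow> nat) \<Rightarrow> (nat \<Rightarrow> nat) \<Rightarrow> bool" where
  "certificate \<rho> t \<longleftrightarrow>
     (\<forall>v<k. \<rho> v < \<gamma> \<and> \<rho> (k + v) < \<gamma> \<and> \<rho> v \<noteq> \<rho> (k + v) \<and> \<delta> \<le> t v) \<and>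
     (\<forall>c<\<gamma>. \<forall>W. W \<subseteq> {..<k} \<longrightarrow> trapped c W \<le> sum t W) \<and>
     (\<forall>c<\<gamma>. \<forall>W. W \<subseteq> slots \<rho> c \<longrightarrow> sum t W \<le> cap \<rho> c W)"

section \<open>Certificates versus fair assignments\<close>

lemma finite_cls [simp]: "finite (cls c)"
  by (simp add: cls_def)

lemma certificate_trapped:
  "certificate \<rho> t \<Longrightarrow> c < \<gamma> \<Longrightarrow> W \<subseteq> {..<k} \<Longrightarrow> trapped c W \<le> sum t W"
  unfolding certificate_def by blast

lemma certificate_cap:
  "certificate \<rho> t \<Longrightarrow> c < \<gamma> \<Longrightarrow> W \<subseteq> slots \<rho> c \<Longrightarrow> sum t W \<le> cap \<rho> c W"
  unfolding certificate_def by blast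

lemma slots_subset: "slots \<rho> c \<subseteq> {..<k}"
  by (auto simp: slots_def)

lemma meet_le: "meet c W \<le> n"
proof -
  have "meet c W \<le> card {..<n}"
    unfolding meet_def by (rule card_mono) (auto simp: cls_def)
  then show ?thesis by simp
qed

lemma certificate_cong:
  assumes cert: "certificate \<rho> t" and \<rho>: "\<And>j. j < 2 * k \<Longrightarrow> \<rho> j = \<rho>' j"
    and t: "\<And>v. v < k \<Longrightarrow> t v = t' v"
  shows "certificate \<rho>' t'"
proof -
  have slots: "slots \<rho>' c = slots \<rho> c" for c
    unfolding slots_def using \<rho> by (intro Collect_cong) auto
  have sum: "sum t' W = sum t W" if "W \<subseteq> {..<k}" for W
    using that t by (intro sum.cong) auto
  have cap: "cap \<rho>' c W = cap \<rho> c W" if "W \<subseteq> {..<k}" for c W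
  proof -
    have "{v \<in> W. \<rho>' (k + v) = c} = {v \<in> W. \<rho> (k + v) = c}"
      using that \<rho> by auto
    then show ?thesis by (simp add: cap_def)
  qed
  have "\<forall>v<k. \<rho>' v < \<gamma> \<and> \<rho>' (k + v) < \<gamma> \<and> \<rho>' v \<noteq> \<rho>' (k + v) \<and> \<delta> \<le> t' v"
    using cert \<rho> t unfolding certificate_def by simp
  moreover have "\<forall>c<\<gamma>. \<forall>W. W \<subseteq> {..<k} \<longrightarrow> trapped c W \<le> sum t' W"
    using certificate_trapped[OF cert] sum by simp
  moreover have "sum t' W \<le> cap \<rho>' c W"
    if "c < \<gamma>" "W \<subseteq> slots \<rho>' c" for c W
  proof -
    have "W \<subseteq> {..<k}" using that(2) slots_subset by (rule order.trans)
    then show ?thesis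
      using certificate_cap[OF cert that(1), of W] that(2) by (simp add: slots sum cap)
  qed
  ultimately show ?thesis unfolding certificate_def by blast
qed

lemma trapped_le: "trapped c W \<le> n"
proof -
  have "trapped c W \<le> card {..<n}"
    unfolding trapped_def by (rule card_mono) (auto simp: cls_def)
  then show ?thesis by simp
qed

lemma fibre_cls_le: "fibre (cls c) f v \<le> fibre {..<n} f v"
  unfolding fibre_def by (rule card_mono) (auto simp: cls_def)

lemma fibre_cls_pos:
  assumes "0 < fibre {..<n} f v"
  shows "\<exists>c. c \<in> cl ` {..<n} \<and> 0 < fibre (cls c) f v"
proof -
  obtain i where "i < n" "f i = v"
    using assms by (force simp: fibre_def card_gt_0_iff)
  then have "0 < fibre (cls (cl i)) f v"
    unfolding fibre_def by (subst card_gt_0_iff) (auto simp: cls_def)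
  then show ?thesis using \<open>i < n\<close> by auto
qed

lemma certificate_if_solves:
  assumes cl: "\<And>i. i < n \<Longrightarrow> cl i < \<gamma>" and f: "solves f"
  obtains \<rho> t where "certificate \<rho> t"
proof -
  define best where "best = (\<lambda>v c1 c2. c1 < \<gamma> \<and> c2 < \<gamma> \<and> c1 \<noteq> c2 \<and>
      (\<forall>c<\<gamma>. fibre (cls c) f v \<le> fibre (cls c1) f v) \<and> fibre (cls c1) f v \<le> fibre (cls c2) f v + l)"
  define c1 where "c1 = (\<lambda>v. SOME c1. \<exists>c2. best v c1 c2)"
  define c2 where "c2 = (\<lambda>v. SOME c2. best v (c1 v) c2)"
  have "best v (c1 v) (c2 v)" if "v < k" for v
  proof -
    have "\<exists>c1 c2. best v c1 c2"
      using f that unfolding solves_def best_def by blast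
    then have "\<exists>c2. best v (c1 v) c2" unfolding c1_def by (rule someI_ex)
    then show ?thesis unfolding c2_def by (rule someI_ex)
  qed
  then have c: "c1 v < \<gamma> \<and> c2 v < \<gamma> \<and> c1 v \<noteq> c2 v \<and>
      (\<forall>c<\<gamma>. fibre (cls c) f v \<le> fibre (cls (c1 v)) f v) \<and>
      fibre (cls (c1 v)) f v \<le> fibre (cls (c2 v)) f v + l" if "v < k" for v
    using that unfolding best_def by blast
  define \<rho> where "\<rho> = (\<lambda>j. if j < k then c1 j else c2 (j - k))"
  define t where "t = (\<lambda>v. fibre (cls (c1 v)) f v)"
  have fN: "i \<in> cls c \<Longrightarrow> f i \<in> N i" for i c
    using f by (simp add: solves_def cls_def)
  show thesis
  proof (rule that[of \<rho> t])
    have "\<delta> \<le> t v" if "v < k" for v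
    proof (cases "fibre {..<n} f v = 0")
      case True
      have "\<delta> \<le> fibre {..<n} f v" using f that unfolding solves_def by blast
      then show ?thesis using True by simp
    next
      case False
      then obtain i where "i < n" "0 < fibre (cls (cl i)) f v"
        using fibre_cls_pos[of f v] by auto
      moreover have "fibre (cls (cl i)) f v \<le> t v"
        using c[OF that] cl[OF \<open>i < n\<close>] by (simp add: t_def)
      ultimately have "1 \<le> t v" by linarith
      then show ?thesis using \<delta> by simp
    qed
    moreover have "trapped c' W \<le> sum t W" if "c' < \<gamma>" "W \<subseteq> {..<k}" for c' W
    proof -
      have "trapped c' W \<le> card {i \<in> cls c'. f i \<in> W}"
        unfolding trapped_def using fN by (intro card_mono) auto
      also have "\<dots> = sum (fibre (cls c') f) W"
        using that(2) by (intro fibre_sum[symmetric]) (auto intro: finite_subset)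
      also have "\<dots> \<le> sum t W" using that c unfolding t_def by (intro sum_mono) auto
      finally show ?thesis .
    qed
    moreover have "sum t W \<le> cap \<rho> c' W" if W: "W \<subseteq> slots \<rho> c'" for c' W
    proof -
      have fin: "finite W"
        by (rule finite_subset[OF order.trans[OF W slots_subset] finite_lessThan])
      have "t v \<le> fibre (cls c') f v + l * of_bool (\<rho> (k + v) = c')" if "v \<in> W" for v
        using c[of v] W that by (auto simp: slots_def \<rho>_def t_def)
      then have "sum t W \<le> (\<Sum>v\<in>W. fibre (cls c') f v + l * of_bool (\<rho> (k + v) = c'))"
        by (rule sum_mono)
      also have "\<dots> = card {i \<in> cls c'. f i \<in> W} + l * card {v \<in> W. \<rho> (k + v) = c'}"
        using fibre_sum[OF finite_cls fin, of c' f] sum_add_indicator[OF fin, of "fibre (cls c') f"]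
        by simp
      also have "\<dots> \<le> cap \<rho> c' W"
        unfolding cap_def meet_def using fN by (intro add_right_mono card_mono) auto
      finally show ?thesis .
    qed
    ultimately show "certificate \<rho> t"
      unfolding certificate_def using c by (simp add: \<rho>_def)
  qed
qed

text \<open>Once \<open>t\<close> is fixed, the quotas of different colors do not interact: each
  color class is assigned by Hall's theorem on its own, and the assignments are glued along
  \<open>cl\<close>.\<close>

lemma solves_if_certificate:
  assumes cl: "\<And>i. i < n \<Longrightarrow> cl i < \<gamma>" and cert: "certificate \<rho> t"
  obtains f where "solves f"
proof -
  define lo where "lo = (\<lambda>c v. if \<rho> v = c then t v else if \<rho> (k + v) = c then t v - l else 0)"
  have ex: "\<exists>f. (\<forall>i\<in>cls c. f i \<in> N i) \<and> (\<forall>v<k. lo c v \<le> fibre (cls c) f v \<and> fibre (cls c) f v \<le> t v)"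
    if c: "c < \<gamma>" for c
  proof -
    have low: "sum (lo c) W \<le> card {i \<in> cls c. N i \<inter> W \<noteq> {}}"
      if W: "W \<subseteq> {..<k}" for W
    proof -
      \<comment> \<open>Vertices with positive lower quota are slots of \<open>c\<close>, and there
        the subtraction of \<open>l\<close> is not truncated; the others contribute nothing to the
        sum.\<close>
      define W' where "W' = {v \<in> W. 0 < lo c v}"
      have fin: "finite W" "finite W'"
        using finite_subset[OF W] by (auto simp: W'_def)
      have W': "W' \<subseteq> slots \<rho> c"
        using W by (auto simp: W'_def lo_def slots_def split: if_splits)
      have "t v = lo c v + l * of_bool (\<rho> (k + v) = c)" if "v \<in> W'" for v
        using that cert W by (auto simp: W'_def lo_def certificate_def split: if_splits)
      then have "sum t W' = (\<Sum>v\<in>W'. lo c v + l * of_bool (\<rho> (k + v) = c))"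
        by (rule sum.cong[OF refl])
      also have "\<dots> = sum (lo c) W' + l * card {v \<in> W'. \<rho> (k + v) = c}"
        by (rule sum_add_indicator[OF fin(2)])
      finally have "sum (lo c) W' \<le> meet c W'"
        using certificate_cap[OF cert c W'] unfolding cap_def by linarith
      moreover have "sum (lo c) W = sum (lo c) W'"
        using fin(1) by (intro sum.mono_neutral_right) (auto simp: W'_def)
      moreover have "meet c W' \<le> meet c W"
        unfolding meet_def by (rule card_mono) (auto simp: W'_def)
      ultimately show ?thesis by (simp add: meet_def)
    qed
    have up: "card {i \<in> cls c. N i \<subseteq> W} \<le> sum t W" if "W \<subseteq> {..<k}" for W
      using cert c that by (auto simp: certificate_def trapped_def)
    have NV: "N i \<subseteq> {..<k}" if "i \<in> cls c" for i using that N by (auto simp: cls_def)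
    show ?thesis
      by (rule Hall_with_bounds[OF finite_cls finite_lessThan NV _ up low])
        (assumption, simp add: lo_def, assumption, assumption, metis lessThan_iff)
  qed
  then obtain F where F: "\<And>c. c < \<gamma> \<Longrightarrow> \<forall>i\<in>cls c. F c i \<in> N i"
    "\<And>c v. c < \<gamma> \<Longrightarrow> v < k \<Longrightarrow> lo c v \<le> fibre (cls c) (F c) v \<and> fibre (cls c) (F c) v \<le> t v"
    by metis
  define f where "f = (\<lambda>i. F (cl i) i)"
  have fib: "fibre (cls c) f v = fibre (cls c) (F c) v" for c v
    unfolding fibre_def f_def cls_def by (rule arg_cong[of _ _ card]) auto
  show thesis
  proof (rule that[of f])
    show "solves f"
      unfolding solves_def
    proof (intro conjI allI impI)
      fix i assume "i < n"
      then show "f i \<in> N i" using F(1)[OF cl] by (simp add: f_def cls_def)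
    next
      fix v assume v: "v < k"
      have r: "\<rho> v < \<gamma>" "\<rho> (k + v) < \<gamma>" "\<rho> v \<noteq> \<rho> (k + v)" "\<delta> \<le> t v"
        using cert v by (auto simp: certificate_def)
      \<comment> \<open>For the leading color the lower and the upper quota coincide.\<close>
      have 1: "fibre (cls (\<rho> v)) f v = t v"
        using F(2)[OF r(1) v] by (simp add: fib lo_def)
      show "\<delta> \<le> fibre {..<n} f v" using fibre_cls_le[of "\<rho> v" f v] 1 r(4) by simp
      have 2: "t v \<le> fibre (cls (\<rho> (k + v))) f v + l"
        using F(2)[OF r(2) v] r(3) by (simp add: fib lo_def le_diff_conv)
      show "\<exists>c1<\<gamma>. \<exists>c2<\<gamma>. c1 \<noteq> c2 \<and> (\<forall>c<\<gamma>. fibre (cls c) f v \<le> fibre (cls c1) f v) \<and>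
          fibre (cls c1) f v \<le> fibre (cls c2) f v + l"
        using r F(2)[OF _ v] 1 2
        by (intro exI[of _ "\<rho> v"] exI[of _ "\<rho> (k + v)"] conjI) (auto simp: fib)
    qed
  qed
qed

text \<open>Orders the colors by how many of their elements are adjacent to \<open>v\<close>, and
  ties by position. The factor exceeds every tie-breaking term, so distinct colors get distinct keys
  and a rank determines its color.\<close>

definition key :: "nat \<Rightarrow> nat \<Rightarrow> nat" where
  "key v c = meet c {v} * (\<gamma> + 1) + (\<gamma> - c)"

definition color_rank :: "nat \<Rightarrow> nat \<Rightarrow> nat" where
  "color_rank v c = card {c'. c' < \<gamma> \<and> key v c < key v c'}"

definition vert :: "nat \<Rightarrow> nat" where
  "vert j = (if j < k then j else j - k)"

lemma key_less: "meet c {v} < meet c' {v} \<Longrightarrow> key v c < key v c'"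
proof -
  assume "meet c {v} < meet c' {v}"
  then have "(meet c {v} + 1) * (\<gamma> + 1) \<le> meet c' {v} * (\<gamma> + 1)"
    by (intro mult_le_mono1) simp
  then show ?thesis by (simp add: key_def)
qed

lemma key_inj: "c < \<gamma> \<Longrightarrow> c' < \<gamma> \<Longrightarrow> key v c = key v c' \<Longrightarrow> c = c'"
proof -
  assume c: "c < \<gamma>" "c' < \<gamma>" and eq: "key v c = key v c'"
  then have "meet c {v} = meet c' {v}"
    using key_less[of c v c'] key_less[of c' v c] by (metis less_irrefl linorder_neqE_nat)
  then show "c = c'" using c eq by (simp add: key_def)
qed

lemma color_rank_less: "c' < \<gamma> \<Longrightarrow> key v c < key v c' \<Longrightarrow> color_rank v c' < color_rank v c"
  unfolding color_rank_def by (intro psubset_card_mono) auto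

lemma color_rank_inj: "c < \<gamma> \<Longrightarrow> c' < \<gamma> \<Longrightarrow> color_rank v c = color_rank v c' \<Longrightarrow> c = c'"
  using color_rank_less[of c' v c] color_rank_less[of c v c'] key_inj[of c c' v]
  by (metis less_irrefl linorder_neqE_nat)

text \<open>
  A color outside the \<open>2 k\<close> best ones for \<open>v\<close> can be replaced
    by an unused better one, which then
  serves \<open>v\<close> alone.
\<close>
lemma certificate_exchange:
  assumes cert: "certificate \<rho> t" and j: "j < 2 * k" and bad: "2 * k \<le> color_rank (vert j) (\<rho> j)"
  obtains c' where "color_rank (vert j) c' < 2 * k" "certificate (\<rho>(j := c')) t"
proof -
  define v where "v = vert j"
  define c where "c = \<rho> j"
  define used where "used = \<rho> ` ({..<2 * k} - {j})"
  have v: "v < k" "j = v \<or> j = k + v" using j by (auto simp: v_def vert_def)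
  have fin: "finite used" by (simp add: used_def)
  have "card used \<le> card ({..<2 * k} - {j})" unfolding used_def by (rule card_image_le) simp
  then have used: "card used < 2 * k" using j by simp
  then have "card used < color_rank v c" using bad by (simp add: v_def c_def)
  then obtain b where b: "b < \<gamma>" "key v c < key v b" "b \<notin> used"
    using card_less_pigeon[OF fin, of "{c'. c' < \<gamma> \<and> key v c < key v c'}"]
    by (auto simp: color_rank_def)
  obtain c' where c': "c' < \<gamma>" "c' \<notin> used" "\<And>x. x < \<gamma> \<Longrightarrow> x \<notin> used \<Longrightarrow> color_rank v c' \<le> color_rank v x"
    using ex_has_least_nat[of "\<lambda>x. x < \<gamma> \<and> x \<notin> used" b "color_rank v"] b
    by blast
  have "color_rank v c' \<le> card used"
    unfolding color_rank_def
    using c'(3) color_rank_less by (intro card_mono[OF fin]) (force simp: not_le[symmetric])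
  then have "color_rank v c' < 2 * k" using used by simp
  moreover have meet_c: "meet c {v} \<le> meet c' {v}"
  proof -
    have "\<not> key v c' < key v b" using c'(3)[OF b(1,3)] color_rank_less[OF b(1)] by (metis leD)
    then have "key v c < key v c'" using b(2) by simp
    then show ?thesis using key_less[of c' v c] by (metis less_asym not_le)
  qed
  moreover have "certificate (\<rho>(j := c')) t"
  proof -
    let ?\<rho> = "\<rho>(j := c')"
    have not_used: "\<rho> i \<noteq> c'" if "i < 2 * k" "i \<noteq> j" for i
      using c'(2) that by (auto simp: used_def)
    have ok: "\<rho> u < \<gamma>" "\<rho> (k + u) < \<gamma>" "\<rho> u \<noteq> \<rho> (k + u)" "\<delta> \<le> t u" if "u < k" for u
      using cert that by (auto simp: certificate_def)
    have 1: "?\<rho> u < \<gamma> \<and> ?\<rho> (k + u) < \<gamma> \<and> ?\<rho> u \<noteq> ?\<rho> (k + u) \<and> \<delta> \<le> t u" if "u < k" for u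
      using ok[OF that] c'(1) not_used[of u] not_used[of "k + u"] that by auto
    have 2: "sum t W \<le> cap ?\<rho> d W"
      if d: "d < \<gamma>" and W: "W \<subseteq> slots ?\<rho> d" for d W
    proof (cases "d = c'")
      case True
      \<comment> \<open>With a single slot only the condition for \<open>{v}\<close> matters, and
        there the new color allows at least as much as the old one.\<close>
      have "slots ?\<rho> d \<subseteq> {v}"
      proof
        fix u assume "u \<in> slots ?\<rho> d"
        then have "u < k" "?\<rho> u = c' \<or> ?\<rho> (k + u) = c'"
          using True by (auto simp: slots_def)
        then have "u = j \<or> k + u = j"
          using not_used[of u] not_used[of "k + u"] by (auto split: if_splits)
        then show "u \<in> {v}" using v \<open>u < k\<close> by auto
      qed
      then have "W = {} \<or> W = {v}" using W by blast
      moreover have "t v \<le> cap ?\<rho> c' {v}"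
      proof -
        have "{v} \<subseteq> slots \<rho> c" using v by (auto simp: slots_def c_def)
        moreover have "c < \<gamma>" using ok[OF v(1)] v(2) by (auto simp: c_def)
        ultimately have "t v \<le> cap \<rho> c {v}"
          using certificate_cap[OF cert, of c "{v}"] by simp
        also have "\<dots> \<le> cap ?\<rho> c' {v}"
        proof -
          have "{u \<in> {v}. \<rho> (k + u) = c} = {u \<in> {v}. ?\<rho> (k + u) = c'}"
            using v ok(3)[OF v(1)] not_used[of "k + v"] by (auto simp: c_def)
          then show ?thesis unfolding cap_def using meet_c by simp
        qed
        finally show ?thesis .
      qed
      ultimately show ?thesis using True by auto
    next
      case False
      \<comment> \<open>Any other color keeps or loses slots, so it faces no new condition.\<close>
      have "W \<subseteq> slots \<rho> d" using W False by (auto simp: slots_def split: if_splits)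
      then have "sum t W \<le> cap \<rho> d W" using cert d by (simp add: certificate_def)
      also have "{u \<in> W. \<rho> (k + u) = d} = {u \<in> W. ?\<rho> (k + u) = d}"
      proof -
        have "u \<noteq> v \<or> j \<noteq> k + v \<or> \<rho> (k + v) \<noteq> d"
          if "u \<in> W" for u
          using W that ok(3)[OF v(1)] False v by (auto simp: slots_def split: if_splits)
        then show ?thesis using False v by (auto split: if_splits)
      qed
      then have "cap \<rho> d W = cap ?\<rho> d W" by (simp add: cap_def)
      finally show ?thesis .
    qed
    have 3: "\<forall>u<k. ?\<rho> u < \<gamma> \<and> ?\<rho> (k + u) < \<gamma> \<and> ?\<rho> u \<noteq> ?\<rho> (k + u) \<and> \<delta> \<le> t u"
      using 1 by blast
    have 4: "\<forall>c<\<gamma>. \<forall>W. W \<subseteq> {..<k} \<longrightarrow> trapped c W \<le> sum t W"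
      using certificate_trapped[OF cert] by blast
    have 5: "\<forall>c<\<gamma>. \<forall>W. W \<subseteq> slots ?\<rho> c \<longrightarrow> sum t W \<le> cap ?\<rho> c W"
      using 2 by blast
    show ?thesis unfolding certificate_def by (intro conjI 3 4 5)
  qed
  ultimately show thesis using that by (simp add: v_def)
qed

lemma certificate_small_rank:
  assumes "certificate \<rho> t"
  obtains \<rho>' where "certificate \<rho>' t" "\<And>j. j < 2 * k \<Longrightarrow> color_rank (vert j) (\<rho>' j) < 2 * k"
proof -
  have "m \<le> 2 * k \<Longrightarrow> \<exists>\<rho>'. certificate \<rho>' t \<and> (\<forall>j<m. color_rank (vert j) (\<rho>' j) < 2 * k)" for m
  proof (induction m)
    case (Suc m)
    then obtain \<rho>' where \<rho>': "certificate \<rho>' t" "\<forall>j<m. color_rank (vert j) (\<rho>' j) < 2 * k" by auto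
    show ?case
    proof (cases "color_rank (vert m) (\<rho>' m) < 2 * k")
      case True
      then show ?thesis using \<rho>' by (auto simp: less_Suc_eq)
    next
      case False
      then obtain c' where "color_rank (vert m) c' < 2 * k" "certificate (\<rho>'(m := c')) t"
        using certificate_exchange[OF \<rho>'(1), of m] Suc.prems by auto
      then show ?thesis
        using \<rho>'(2)
        by (intro exI[of _ "\<rho>'(m := c')"]) (auto simp: less_Suc_eq fun_upd_def)
    qed
  qed (use assms in auto)
  from this[of "2 * k"] show thesis using that by auto
qed

text \<open>Merges the lower constraints of all colors, so that a tight one can be guessed without
  guessing its color. Inserting \<open>\<delta>\<close> covers \<open>\<delta> \<le> t v\<close> and
  keeps the maximum defined.\<close>

definition lower :: "nat set \<Rightarrow> nat" where
  "lower W = Max (insert \<delta> ((\<lambda>c. trapped c W) ` {..<\<gamma>}))"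

lemma lower_le_iff: "lower W \<le> y \<longleftrightarrow> \<delta> \<le> y \<and> (\<forall>c<\<gamma>. trapped c W \<le> y)"
  unfolding lower_def by (subst Max_le_iff) auto

text \<open>A tight upper constraint names its color through a slot \<open>s < 2 * k\<close>;
  together with the lower constraints there are \<open>2 k + 1\<close> kinds, however many colors
  exist.\<close>

definition row :: "(nat \<Rightarrow> nat) \<Rightarrow> nat \<Rightarrow> nat set \<Rightarrow> nat" where
  "row \<rho> s W = (if s < 2 * k then cap \<rho> (\<rho> s) W else lower W)"

lemma certificate_nearly_tight:
  assumes cert: "certificate \<rho> t0"
  obtains t W s where "certificate \<rho> t" "independent_sets k k W"
    "\<And>i. i < k \<Longrightarrow> W i \<subseteq> {..<k}" "\<And>i. i < k \<Longrightarrow> s i \<le> 2 * k"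
    "\<And>i. i < k \<Longrightarrow> \<bar>int (sum t (W i)) - int (row \<rho> (s i) (W i))\<bar> \<le> int (k * (k + 1) ^ k)"
proof -
  \<comment> \<open>The empty set is left out: its sum is 0, while \<open>lower {}\<close> is at
    least \<open>\<delta>\<close>.\<close>
  define L where "L = {(W, int (lower W)) | W. W \<subseteq> {..<k} \<and> W \<noteq> {}}"
  define H where "H = {(W, int (cap \<rho> (\<rho> s) W)) | W s. s < 2 * k \<and> W \<subseteq> slots \<rho> (\<rho> s)}"
  have role: "\<rho> s < \<gamma>" if "s < 2 * k" for s
  proof (cases "s < k")
    case False
    then have "s = k + (s - k)" "s - k < k" using that by auto
    then show ?thesis using cert unfolding certificate_def by metis
  qed (use cert in \<open>auto simp: certificate_def\<close>)
  have sub: "W \<subseteq> {..<k}" if "(W, R) \<in> L \<union> H" for W R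
    using that slots_subset by (auto simp: L_def H_def)
  have "feasible L H (\<lambda>v. int (t0 v))"
    unfolding feasible_def
  proof (intro conjI ballI; clarify)
    fix W R assume "(W, R) \<in> L"
    then have W: "W \<subseteq> {..<k}" "W \<noteq> {}" "R = int (lower W)" by (auto simp: L_def)
    then obtain v where v: "v \<in> W" by blast
    then have "\<delta> \<le> t0 v" using cert W by (auto simp: certificate_def)
    also have "t0 v \<le> sum t0 W"
      using v W(1) by (intro member_le_sum) (auto intro: finite_subset)
    finally have "lower W \<le> sum t0 W"
      using cert W(1) by (auto simp: lower_le_iff certificate_def)
    then show "R \<le> (\<Sum>v\<in>W. int (t0 v))" using W(3) by (simp flip: of_nat_sum)
  next
    fix W R assume "(W, R) \<in> H"
    then obtain s where "s < 2 * k" "W \<subseteq> slots \<rho> (\<rho> s)" "R = int (cap \<rho> (\<rho> s) W)" by (auto simp: H_def)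
    then show "(\<Sum>v\<in>W. int (t0 v)) \<le> R"
      using cert role by (simp add: certificate_def flip: of_nat_sum)
  qed
  moreover have "\<exists>R\<ge>0. ({v}, R) \<in> L" if "v < k" for v
    using that by (auto simp: L_def)
  ultimately obtain T W R where T: "feasible L H T" "independent_sets k k W"
    "\<And>i. i < k \<Longrightarrow> (W i, R i) \<in> L \<union> H \<and> \<bar>sum T (W i) - R i\<bar> \<le> int (k * (k + 1) ^ k)"
    using nearly_tight_solution[of L H k "\<lambda>v. int (t0 v)" k] sub by blast
  define t where "t = (\<lambda>v. nat (T v))"
  have T0: "0 \<le> T v" if "v < k" for v
    using feasible_lower[OF T(1), of "{v}" "int (lower {v})"] that by (simp add: L_def)
  have sumT: "int (sum t X) = sum T X" if "X \<subseteq> {..<k}" for X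
    unfolding t_def of_nat_sum using T0 that by (intro sum.cong) auto
  have "certificate \<rho> t"
    unfolding certificate_def
  proof (intro conjI allI impI)
    fix v assume v: "v < k"
    show "\<rho> v < \<gamma>" "\<rho> (k + v) < \<gamma>" "\<rho> v \<noteq> \<rho> (k + v)"
      using cert v by (auto simp: certificate_def)
    have "({v}, int (lower {v})) \<in> L" using v by (auto simp: L_def)
    then have "int (lower {v}) \<le> sum T {v}" by (rule feasible_lower[OF T(1)])
    then have "lower {v} \<le> t v" by (simp add: t_def)
    then show "\<delta> \<le> t v" by (simp add: lower_le_iff)
  next
    fix c X assume c: "c < \<gamma>" and X: "X \<subseteq> {..<k}"
    show "trapped c X \<le> sum t X"
    proof (cases "X = {}")
      case True
      then show ?thesis using certificate_trapped[OF cert c, of "{}"] by simp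
    next
      case False
      then have "(X, int (lower X)) \<in> L" using X by (auto simp: L_def)
      then have "int (lower X) \<le> int (sum t X)"
        using feasible_lower[OF T(1)] sumT[OF X] by force
      then have "lower X \<le> sum t X" by (simp only: of_nat_le_iff)
      then show ?thesis using c by (simp add: lower_le_iff)
    qed
  next
    fix c X assume c: "c < \<gamma>" and X: "X \<subseteq> slots \<rho> c"
    have Xk: "X \<subseteq> {..<k}" using X slots_subset by blast
    show "sum t X \<le> cap \<rho> c X"
    proof (cases "X = {}")
      case False
      then obtain v where "v \<in> X" by blast
      then have "v < k" "\<rho> v = c \<or> \<rho> (k + v) = c" using X by (auto simp: slots_def)
      then have "\<exists>s<2 * k. \<rho> s = c"
        by (elim disjE) (rule exI[of _ v], simp, rule exI[of _ "k + v"], simp)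
      then obtain s where "s < 2 * k" "\<rho> s = c" by blast
      then have "(X, int (cap \<rho> c X)) \<in> H" using X by (auto simp: H_def)
      then have "int (sum t X) \<le> int (cap \<rho> c X)"
        using feasible_upper[OF T(1)] sumT[OF Xk] by force
      then show ?thesis by (simp only: of_nat_le_iff)
    qed simp
  qed
  moreover have "\<exists>s\<le>2 * k. R i = int (row \<rho> s (W i))" if "i < k" for i
  proof -
    from T(3)[OF that] consider (L) "(W i, R i) \<in> L" | (H) "(W i, R i) \<in> H" by blast
    then show ?thesis
    proof cases
      case L
      then show ?thesis by (intro exI[of _ "2 * k"]) (auto simp: L_def row_def)
    next
      case H
      then show ?thesis by (auto simp: H_def row_def intro: less_imp_le)
    qed
  qed
  then obtain s where "\<And>i. i < k \<Longrightarrow> s i \<le> 2 * k \<and> R i = int (row \<rho> (s i) (W i))" by metis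
  moreover have "W i \<subseteq> {..<k}" if "i < k" for i using T(3)[OF that] sub by blast
  ultimately show thesis using that[of t W s] T(2,3) sumT by force
qed

text \<open>At \<open>{v}\<close> the leading color gets no allowance \<open>l\<close>, so
  \<open>t v\<close> is at most its number of elements adjacent to \<open>v\<close>. This limits the
  search for \<open>t v\<close>.\<close>

lemma certificate_le:
  assumes "certificate \<rho> t" "v < k"
  shows "t v \<le> n"
proof -
  have "\<rho> v < \<gamma>" "{v} \<subseteq> slots \<rho> (\<rho> v)" "\<rho> (k + v) \<noteq> \<rho> v"
    using assms by (auto simp: certificate_def slots_def)
  then have "t v \<le> cap \<rho> (\<rho> v) {v}"
    using certificate_cap[OF assms(1), of "\<rho> v" "{v}"] by simp
  also have "\<dots> = meet (\<rho> v) {v}"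
    using \<open>\<rho> (k + v) \<noteq> \<rho> v\<close> by (auto simp: cap_def)
  finally show ?thesis using meet_le le_trans by blast
qed

end

section \<open>The decision procedure\<close>

text \<open>The offsets follow the encoding: five header entries, left vertices, their colors, right
  vertices, edge endpoints, colors.\<close>

definition colored :: "nat list \<Rightarrow> nat \<Rightarrow> nat \<Rightarrow> bool" where
  "colored x i c \<longleftrightarrow>
     c < x ! 3 \<and> entry x (5 + x ! 0 + i) = entry x (5 + 2 * x ! 0 + x ! 1 + 2 * x ! 2 + c)"

definition adjacent :: "nat list \<Rightarrow> nat \<Rightarrow> nat \<Rightarrow> bool" where
  "adjacent x i j \<longleftrightarrow>
     (\<exists>e<x ! 2. entry x (5 + 2 * x ! 0 + x ! 1 + 2 * e) = entry x (5 + i) \<and>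
        entry x (5 + 2 * x ! 0 + x ! 1 + 2 * e + 1) = entry x (5 + 2 * x ! 0 + j))"

text \<open>
  Vertices and colors are represented by their positions in the input lists. Subsets of the right
  side are bit masks, and tuples are numbers in base \<open>radix\<close>. Two unused colors with
  the positions \<open>x ! 3\<close> and \<open>x ! 3 + 1\<close> make up for entries that are missing in the list of counts.
\<close>
definition elem :: "nat list \<Rightarrow> nat \<Rightarrow> nat \<Rightarrow> bool" where
  "elem x j W \<longleftrightarrow> W div capped_power x 2 j mod 2 = 1"

definition radix :: "nat list \<Rightarrow> nat" where
  "radix x = capped_power x (x ! 1 + 2) (2 * x ! 1 + 3)"

definition digit :: "nat list \<Rightarrow> nat \<Rightarrow> nat \<Rightarrow> nat" where
  "digit x z i = z div capped_power x (radix x) i mod radix x"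

definition trapped_num :: "nat list \<Rightarrow> nat \<Rightarrow> nat \<Rightarrow> nat" where
  "trapped_num x c W =
     (\<Sum>i<x ! 0. of_bool (colored x i c \<and> (\<forall>j<x ! 1. adjacent x i j \<longrightarrow> elem x j W)))"

definition meet_num :: "nat list \<Rightarrow> nat \<Rightarrow> nat \<Rightarrow> nat" where
  "meet_num x c W =
     (\<Sum>i<x ! 0. of_bool (colored x i c \<and> (\<exists>j<x ! 1. adjacent x i j \<and> elem x j W)))"

definition key_num :: "nat list \<Rightarrow> nat \<Rightarrow> nat \<Rightarrow> nat" where
  "key_num x v c = meet_num x c (capped_power x 2 v) * (x ! 3 + 2 + 1) + (x ! 3 + 2 - c)"

definition rank_num :: "nat list \<Rightarrow> nat \<Rightarrow> nat \<Rightarrow> nat" where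
  "rank_num x v c = (\<Sum>c'<x ! 3 + 2. of_bool (key_num x v c < key_num x v c'))"

text \<open>A digit stores a rank, since a color position cannot be bounded in terms of
  \<open>k\<close>. A rank held by no color decodes to \<open>x ! 3 + 2\<close>, which
  \<open>verifies\<close> rejects.\<close>

definition role :: "nat list \<Rightarrow> nat \<Rightarrow> nat \<Rightarrow> nat" where
  "role x z j = first (x ! 3 + 2)
     (\<lambda>c. rank_num x (if j < x ! 1 then j else j - x ! 1) c = digit x z j)"

definition cap_num :: "nat list \<Rightarrow> nat \<Rightarrow> nat \<Rightarrow> nat \<Rightarrow> nat" where
  "cap_num x z c W = meet_num x c W + min (x ! 4) (x ! 0) *
     (\<Sum>v<x ! 1. of_bool (elem x v W \<and> role x z (x ! 1 + v) = c))"

text \<open>A maximum obtained as the least upper bound. The range reaches \<open>x ! 0 + 1\<close>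
  because \<open>\<delta>\<close> may exceed \<open>x ! 0\<close>.\<close>

definition lower_num :: "nat \<Rightarrow> nat list \<Rightarrow> nat \<Rightarrow> nat" where
  "lower_num \<delta> x W = first (x ! 0 + 2) (\<lambda>y. \<delta> \<le> y \<and> (\<forall>c<x ! 3 + 2. trapped_num x c W \<le> y))"

definition row_num :: "nat \<Rightarrow> nat list \<Rightarrow> nat \<Rightarrow> nat \<Rightarrow> nat \<Rightarrow> nat \<Rightarrow> nat" where
  "row_num \<delta> x z w s i =
     (if digit x s i < 2 * x ! 1 then cap_num x z (role x z (digit x s i)) (digit x w i)
      else lower_num \<delta> x (digit x w i))"

definition coeff_bound :: "nat list \<Rightarrow> nat" where
  "coeff_bound x = capped_power x (x ! 1 + 1) (x ! 1)"

text \<open>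
  The digits of \<open>q\<close> are the coefficients of a row of the inverse, shifted
    by \<open>coeff_bound\<close> to make
  them nonnegative, and then the denominator \<open>d\<close>.
\<close>
definition inverse_row :: "nat list \<Rightarrow> nat \<Rightarrow> nat \<Rightarrow> nat \<Rightarrow> bool" where
  "inverse_row x w v q \<longleftrightarrow> 0 < digit x q (x ! 1) \<and>
     (\<forall>i<x ! 1. digit x q i \<le> 2 * coeff_bound x) \<and>
     (\<forall>u<x ! 1. (\<Sum>i<x ! 1. digit x q i * of_bool (elem x u (digit x w i))) =
        digit x q (x ! 1) * of_bool (u = v) +
        coeff_bound x * (\<Sum>i<x ! 1. of_bool (elem x u (digit x w i))))"

text \<open>
  The values \<open>y\<close> within \<open>(k D)\<^sup>2 / d\<close> of the \<open>v\<close>-th coordinate of the solution of the system of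
  tight constraints, where \<open>D\<close> is \<open>coeff_bound\<close>.
\<close>
definition candidate :: "nat \<Rightarrow> nat list \<Rightarrow> nat \<Rightarrow> nat \<Rightarrow> nat \<Rightarrow> nat \<Rightarrow> nat \<Rightarrow> bool" where
  "candidate \<delta> x z w s v y \<longleftrightarrow>
     (\<exists>q<capped_power x (radix x) (x ! 1 + 1). inverse_row x w v q \<and>
        digit x q (x ! 1) * y + coeff_bound x * (\<Sum>i<x ! 1. row_num \<delta> x z w s i)
          \<le> (\<Sum>i<x ! 1. digit x q i * row_num \<delta> x z w s i)
            + x ! 1 * coeff_bound x * (x ! 1 * coeff_bound x) \<and>
        (\<Sum>i<x ! 1. digit x q i * row_num \<delta> x z w s i)
          \<le> digit x q (x ! 1) * y + coeff_bound x * (\<Sum>i<x ! 1. row_num \<delta> x z w s i)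
            + x ! 1 * coeff_bound x * (x ! 1 * coeff_bound x))"

text \<open>The intended quota and the least candidate both pass the approximation test, so their
  difference is small enough to be guessed as a digit of \<open>p\<close>.\<close>

definition quota :: "nat \<Rightarrow> nat list \<Rightarrow> nat \<Rightarrow> nat \<Rightarrow> nat \<Rightarrow> nat \<Rightarrow> nat \<Rightarrow> nat" where
  "quota \<delta> x z w s p v = first (x ! 0 + 1) (candidate \<delta> x z w s v) + digit x p v"

definition quota_sum :: "nat \<Rightarrow> nat list \<Rightarrow> nat \<Rightarrow> nat \<Rightarrow> nat \<Rightarrow> nat \<Rightarrow> nat \<Rightarrow> nat" where
  "quota_sum \<delta> x z w s p W = (\<Sum>v<x ! 1. of_bool (elem x v W) * quota \<delta> x z w s p v)"

text \<open>Every Hall condition is tested for the decoded quotas, so acceptance is sound whatever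
  \<open>z\<close>, \<open>w\<close>, \<open>s\<close> and \<open>p\<close> decode to. The
  approximation serves completeness.\<close>

definition verifies :: "nat \<Rightarrow> nat list \<Rightarrow> nat \<Rightarrow> nat \<Rightarrow> nat \<Rightarrow> nat \<Rightarrow> bool" where
  "verifies \<delta> x z w s p \<longleftrightarrow>
     (\<forall>v<x ! 1. role x z v < x ! 3 + 2 \<and> role x z (x ! 1 + v) < x ! 3 + 2 \<and>
        \<not> role x z v = role x z (x ! 1 + v) \<and> \<delta> \<le> quota \<delta> x z w s p v) \<and>
     (\<forall>c<x ! 3 + 2. \<forall>W<capped_power x 2 (x ! 1). trapped_num x c W \<le> quota_sum \<delta> x z w s p W) \<and>
     (\<forall>c<x ! 3 + 2. \<forall>W<capped_power x 2 (x ! 1).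
        (\<forall>v<x ! 1. elem x v W \<longrightarrow> role x z v = c \<or> role x z (x ! 1 + v) = c) \<longrightarrow>
        quota_sum \<delta> x z w s p W \<le> cap_num x z c W)"

definition accepts :: "nat \<Rightarrow> nat list \<Rightarrow> bool" where
  "accepts \<delta> x \<longleftrightarrow>
     (\<exists>z<capped_power x (radix x) (2 * x ! 1). \<exists>w<capped_power x (radix x) (x ! 1).
      \<exists>s<capped_power x (radix x) (x ! 1). \<exists>p<capped_power x (radix x) (x ! 1). verifies \<delta> x z w s p)"

section \<open>Computability of the decision procedure\<close>

lemma computable_mod:
  assumes "computable d F" "computable d G"
  shows "computable d (\<lambda>x rs. F x rs mod G x rs)"
  unfolding minus_mult_div_eq_mod[symmetric]
  by (intro computable_minus computable_times computable_div assms)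

lemmas computable_intros =
  decidable_entry_eq decidable_not decidable_conj decidable_disj decidable_imp decidable_le
  decidable_less decidable_eq decidable_bex decidable_ball
  computable_min_fairness computable_plus computable_minus computable_times computable_div
  computable_mod computable_sum computable_capped_power computable_of_bool computable_if computable_first
  computable_last computable_const

lemmas computable_weaken = computable_butlast decidable_butlast

text \<open>Arguments are arbitrary computable functions here and below, so that substitution is
  built into each lemma.\<close>

lemma decidable_colored:
  assumes "computable d a" "computable d b"
  shows "decidable d (\<lambda>x rs. colored x (a x rs) (b x rs))"
  unfolding colored_def
  by (intro computable_intros assms computable_header) simp_all

lemma decidable_adjacent:
  assumes "computable d a" "computable d b"
  shows "decidable d (\<lambda>x rs. adjacent x (a x rs) (b x rs))"
  unfolding adjacent_def
  by (intro computable_intros assms computable_weaken computable_header) simp_all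

lemma decidable_elem:
  assumes "computable d a" "computable d b"
  shows "decidable d (\<lambda>x rs. elem x (a x rs) (b x rs))"
  unfolding elem_def
  by (intro computable_intros assms)

lemma computable_radix: "computable d (\<lambda>x rs. radix x)"
  unfolding radix_def
  by (intro computable_intros computable_header) simp_all

lemma computable_digit:
  assumes "computable d a" "computable d b"
  shows "computable d (\<lambda>x rs. digit x (a x rs) (b x rs))"
  unfolding digit_def
  by (intro computable_intros computable_radix assms)

lemma computable_trapped_num:
  assumes "computable d a" "computable d b"
  shows "computable d (\<lambda>x rs. trapped_num x (a x rs) (b x rs))"
  unfolding trapped_num_def
  by (intro computable_intros decidable_colored decidable_adjacent decidable_elem assms
      computable_weaken computable_header) simp_all


lemma computable_meet_num:
  assumes "computable d a" "computable d b"
  shows "computable d (\<lambda>x rs. meet_num x (a x rs) (b x rs))"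
  unfolding meet_num_def
  by (intro computable_intros decidable_colored decidable_adjacent decidable_elem assms
      computable_weaken computable_header) simp_all

lemma computable_key_num:
  assumes "computable d a" "computable d b"
  shows "computable d (\<lambda>x rs. key_num x (a x rs) (b x rs))"
  unfolding key_num_def
  by (intro computable_intros computable_meet_num assms
      computable_weaken computable_header) simp_all

lemma computable_rank_num:
  assumes "computable d a" "computable d b"
  shows "computable d (\<lambda>x rs. rank_num x (a x rs) (b x rs))"
  unfolding rank_num_def
  by (intro computable_intros computable_key_num assms
      computable_weaken computable_header) simp_all

lemma computable_role:
  assumes "computable d a" "computable d b"
  shows "computable d (\<lambda>x rs. role x (a x rs) (b x rs))"
  unfolding role_def
  by (intro computable_intros computable_rank_num computable_digit assms
      computable_weaken computable_header) simp_all

lemma computable_cap_num: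
  assumes "computable d a" "computable d b" "computable d c"
  shows "computable d (\<lambda>x rs. cap_num x (a x rs) (b x rs) (c x rs))"
  unfolding cap_num_def
  by (intro computable_intros computable_meet_num decidable_elem computable_role assms
      computable_weaken computable_header) simp_all

lemma computable_lower_num:
  assumes "computable d a"
  shows "computable d (\<lambda>x rs. lower_num \<delta> x (a x rs))"
  unfolding lower_num_def
  by (intro computable_intros computable_trapped_num assms
      computable_weaken computable_header) simp_all

lemma computable_row_num:
  assumes "computable d a" "computable d b" "computable d c" "computable d e"
  shows "computable d (\<lambda>x rs. row_num \<delta> x (a x rs) (b x rs) (c x rs) (e x rs))"
  unfolding row_num_def
  by (intro computable_intros computable_digit computable_cap_num computable_role computable_lower_num assms
      computable_weaken computable_header) simp_all

lemma computable_coeff_bound: "computable d (\<lambda>x rs. coeff_bound x)"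
  unfolding coeff_bound_def
  by (intro computable_intros computable_header) simp_all

lemma decidable_inverse_row:
  assumes "computable d a" "computable d b" "computable d c"
  shows "decidable d (\<lambda>x rs. inverse_row x (a x rs) (b x rs) (c x rs))"
  unfolding inverse_row_def
  by (intro computable_intros computable_digit computable_coeff_bound decidable_elem assms
      computable_weaken computable_header) simp_all

lemma decidable_candidate:
  assumes "computable d a" "computable d b" "computable d c" "computable d e" "computable d f"
  shows "decidable d (\<lambda>x rs. candidate \<delta> x (a x rs) (b x rs) (c x rs) (e x rs) (f x rs))"
  unfolding candidate_def
  by (intro computable_intros computable_digit computable_coeff_bound computable_radix computable_row_num decidable_inverse_row assms
      computable_weaken computable_header) simp_all

lemma computable_quota:
  assumes "computable d a" "computable d b" "computable d c" "computable d e" "computable d f"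
  shows "computable d (\<lambda>x rs. quota \<delta> x (a x rs) (b x rs) (c x rs) (e x rs) (f x rs))"
  unfolding quota_def
  by (intro computable_intros computable_digit decidable_candidate assms
      computable_weaken computable_header) simp_all

lemma computable_quota_sum:
  assumes "computable d a" "computable d b" "computable d c" "computable d e" "computable d f"
  shows "computable d (\<lambda>x rs. quota_sum \<delta> x (a x rs) (b x rs) (c x rs) (e x rs) (f x rs))"
  unfolding quota_sum_def
  by (intro computable_intros computable_quota decidable_elem assms
      computable_weaken computable_header) simp_all

lemma decidable_verifies:
  assumes "computable d a" "computable d b" "computable d c" "computable d e"
  shows "decidable d (\<lambda>x rs. verifies \<delta> x (a x rs) (b x rs) (c x rs) (e x rs))"
  unfolding verifies_def
  by (intro computable_intros computable_quota computable_quota_sum computable_role computable_trapped_num computable_cap_num decidable_elem assms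
      computable_weaken computable_header) simp_all

lemma computable_accepts: "computable d (\<lambda>x rs. of_bool (accepts \<delta> x))"
  unfolding accepts_def
  by (intro computable_intros computable_radix decidable_verifies computable_weaken computable_header)
    simp_all

lemma digits_exist:
  fixes f :: "nat \<Rightarrow> nat"
  assumes "\<And>i. i < m \<Longrightarrow> f i < b"
  shows "\<exists>z<b ^ m. \<forall>i<m. z div b ^ i mod b = f i"
  using assms
proof (induction m)
  case (Suc m)
  then obtain z where z: "z < b ^ m" "\<forall>i<m. z div b ^ i mod b = f i" by auto
  have b: "0 < b" using Suc.prems[of m] by simp
  let ?z = "f m * b ^ m + z"
  have "f m * b ^ m + z < f m * b ^ m + b ^ m" using z(1) by simp
  also have "\<dots> = (f m + 1) * b ^ m" by simp
  also have "\<dots> \<le> b * b ^ m" using Suc.prems[of m] by (intro mult_le_mono1) simp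
  finally have "?z < b ^ Suc m" by simp
  moreover have "?z div b ^ i mod b = f i" if "i < Suc m" for i
  proof (cases "i = m")
    case True
    then show ?thesis using z(1) b Suc.prems[of m] by simp
  next
    case False
    then have i: "i < m" using that by simp
    then have "b ^ m = b ^ ((m - i - 1) + 1 + i)" by simp
    also have "\<dots> = b ^ (m - i - 1) * b * b ^ i" by (simp only: power_add power_one_right)
    finally have "b ^ m = b ^ (m - i - 1) * b * b ^ i" .
    then have "?z = z + (f m * b ^ (m - i - 1) * b) * b ^ i" by (simp only: mult.assoc add.commute)
    moreover have "b ^ i \<noteq> 0" using b by simp
    then have "(z + f m * b ^ (m - i - 1) * b * b ^ i) div b ^ i
        = f m * b ^ (m - i - 1) * b + z div b ^ i"
      by (rule div_mult_self1)
    ultimately have "?z div b ^ i = f m * b ^ (m - i - 1) * b + z div b ^ i"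
      by (simp only:)
    then show ?thesis using z(2) i by (simp only: mod_mult_self3)
  qed
  ultimately show ?case by blast
qed simp

text \<open>Each inequality makes one kind of guess fit into a digit: offsets of quotas, shifted
  coefficients of an inverse row, ranks and kinds of constraints, and bit masks. The factor
  \<open>(k + 2) ^ (2 * k)\<close> dominates the squared coefficient bound, and the remaining cube
  absorbs \<open>2 * k ^ 2\<close>.\<close>

lemma radix_large:
  fixes k :: nat
  defines "b \<equiv> (k + 2) ^ (2 * k + 3)"
  shows "2 * (k * (k + 1) ^ k * (k * (k + 1) ^ k)) < b" "2 * (k + 1) ^ k < b" "2 * k < b" "2 ^ k \<le> b"
proof -
  let ?y = "(k + 2) ^ (2 * k)"
  have b: "b = (k + 2) ^ 3 * ?y" by (simp add: b_def power_add mult.commute)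
  have y: "1 \<le> ?y" by simp
  have cube: "(k + 2) ^ 3 = k ^ 3 + 6 * k ^ 2 + 12 * k + 8"
    by (simp add: power3_eq_cube power2_eq_square algebra_simps)
  have large: "2 * k ^ 2 < (k + 2) ^ 3" "2 < (k + 2) ^ 3" "2 * k < (k + 2) ^ 3"
    unfolding cube by linarith+
  have "(k + 1) ^ k * (k + 1) ^ k = (k + 1) ^ (2 * k)" by (simp add: mult_2 power_add)
  also have "\<dots> \<le> ?y" by (rule power_mono) auto
  finally have "2 * k ^ 2 * ((k + 1) ^ k * (k + 1) ^ k) \<le> 2 * k ^ 2 * ?y"
    by (rule mult_le_mono2)
  also have "\<dots> < (k + 2) ^ 3 * ?y" using y by (intro mult_strict_right_mono large) simp
  finally show "2 * (k * (k + 1) ^ k * (k * (k + 1) ^ k)) < b"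
    unfolding b by (simp only: power2_eq_square ac_simps)
  have "(k + 1) ^ k \<le> (k + 2) ^ k" by (rule power_mono) auto
  also have "\<dots> \<le> ?y" by (rule power_increasing) auto
  finally have "2 * (k + 1) ^ k \<le> 2 * ?y" by simp
  also have "\<dots> < (k + 2) ^ 3 * ?y" using y by (intro mult_strict_right_mono large) simp
  finally show "2 * (k + 1) ^ k < b" unfolding b .
  have "2 * k * 1 \<le> 2 * k * ?y" using y by (rule mult_le_mono2)
  also have "\<dots> < (k + 2) ^ 3 * ?y" using y by (intro mult_strict_right_mono large) simp
  finally show "2 * k < b" unfolding b by simp
  have "2 ^ k \<le> (k + 2) ^ k" by (rule power_mono) auto
  also have "\<dots> \<le> b" unfolding b_def by (rule power_increasing) auto
  finally show "2 ^ k \<le> b" .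
qed

section \<open>Correctness on decoded inputs\<close>

lemma sum_of_bool_card: "(\<Sum>i<m. of_bool (P i) :: nat) = card {i. i < m \<and> P i}" for m :: nat
proof -
  have "{..<m} \<inter> {i. P i} = {i. i < m \<and> P i}" by auto
  moreover have "(\<Sum>i<m. of_bool (P i) :: nat) = card ({..<m} \<inter> {i. P i})" by simp
  ultimately show ?thesis by (simp only:)
qed

locale input_instance =
  fixes x :: "nat list" and n k \<gamma> l \<delta> :: nat and cl :: "nat \<Rightarrow> nat"
  assumes header: "x ! 0 = n" "x ! 1 = k" "x ! 3 + 2 = \<gamma>" "min (x ! 4) n = l"
    and \<delta>: "\<delta> \<le> 1"
    and colored: "i < n \<Longrightarrow> colored x i c \<longleftrightarrow> cl i = c"
    and cl: "i < n \<Longrightarrow> cl i < \<gamma>"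
begin

abbreviation "nbhd i \<equiv> {j. j < k \<and> adjacent x i j}"

sublocale fair_assignment n k \<gamma> l \<delta> cl nbhd
  by unfold_locales (use \<delta> in auto)

lemmas threshold_unfold = threshold_def[of x, unfolded header]
lemmas radix_unfold = radix_def[of x, unfolded header]
lemmas trapped_num_unfold = trapped_num_def[of x, unfolded header]
lemmas meet_num_unfold = meet_num_def[of x, unfolded header]
lemmas key_num_unfold = key_num_def[of x, unfolded header]
lemmas rank_num_unfold = rank_num_def[of x, unfolded header]
lemmas role_unfold = role_def[of x, unfolded header]
lemmas cap_num_unfold = cap_num_def[of x, unfolded header]
lemmas lower_num_unfold = lower_num_def[of \<delta> x, unfolded header]
lemmas row_num_unfold = row_num_def[of \<delta> x, unfolded header]
lemmas coeff_bound_unfold = coeff_bound_def[of x, unfolded header]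
lemmas inverse_row_unfold = inverse_row_def[of x, unfolded header]
lemmas candidate_unfold = candidate_def[of \<delta> x, unfolded header]
lemmas quota_unfold = quota_def[of \<delta> x, unfolded header]
lemmas quota_sum_unfold = quota_sum_def[of \<delta> x, unfolded header]
lemmas verifies_unfold = verifies_def[of \<delta> x, unfolded header]
lemmas accepts_unfold = accepts_def[of \<delta> x, unfolded header]

definition B :: nat where "B = (k + 2) ^ (2 * k + 3)"

definition unmask :: "nat \<Rightarrow> nat set" where "unmask w = {v. v < k \<and> elem x v w}"

text \<open>Powers of the radix therefore survive the cut up to exponent \<open>2 k + 1\<close>,
  which covers the \<open>2 k\<close> digits of \<open>z\<close> and the \<open>k + 1\<close> digits
  of an inverse row.\<close>

lemma threshold_eq: "threshold x = B ^ (2 * k + 1)"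
  by (simp only: threshold_unfold B_def power_mult)

lemma capped_power_exact: "a ^ b \<le> B \<Longrightarrow> capped_power x a b = a ^ b"
proof -
  assume "a ^ b \<le> B"
  also have "B \<le> B ^ (2 * k + 1)" by (rule self_le_power) (auto simp: B_def)
  finally show ?thesis by (simp add: capped_power_def threshold_eq)
qed

lemma radix_eq: "radix x = B"
  unfolding radix_unfold by (subst capped_power_exact) (auto simp: B_def)

lemma capped_power_radix: "i \<le> 2 * k + 1 \<Longrightarrow> capped_power x (radix x) i = B ^ i"
  unfolding radix_eq capped_power_def threshold_eq
  by (rule min_absorb2, rule power_increasing) (auto simp: B_def)

lemma digit_eq: "i \<le> 2 * k + 1 \<Longrightarrow> digit x z i = z div B ^ i mod B"
  by (simp only: digit_def capped_power_radix) (simp only: radix_eq)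

lemma capped_power_2: "j \<le> k \<Longrightarrow> capped_power x 2 j = 2 ^ j"
proof (rule capped_power_exact)
  assume "j \<le> k"
  then have "(2::nat) ^ j \<le> 2 ^ k" by (intro power_increasing) auto
  from this radix_large(4)[of k] show "2 ^ j \<le> B" unfolding B_def by (rule order.trans)
qed

lemma coeff_bound_eq: "coeff_bound x = (k + 1) ^ k"
  unfolding coeff_bound_unfold
  by (rule capped_power_exact) (use radix_large(2)[of k] in \<open>simp add: B_def\<close>)

lemma elem_eq: "j < k \<Longrightarrow> elem x j w \<longleftrightarrow> w div 2 ^ j mod 2 = 1"
  by (simp add: elem_def capped_power_2)

lemma unmask_subset: "unmask w \<subseteq> {..<k}"
  by (auto simp: unmask_def)

lemma mask_exists:
  assumes "W \<subseteq> {..<k}"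
  obtains w where "w < 2 ^ k" "unmask w = W"
proof -
  have "\<exists>w<2 ^ k. \<forall>v<k. w div 2 ^ v mod 2 = (of_bool (v \<in> W) :: nat)"
    by (rule digits_exist) simp
  then obtain w :: nat where w: "w < 2 ^ k" "\<forall>v<k. w div 2 ^ v mod 2 = of_bool (v \<in> W)"
    by blast
  have "elem x v w \<longleftrightarrow> v \<in> W" if "v < k" for v
    unfolding elem_eq[OF that] w(2)[rule_format, OF that] by simp
  then have "unmask w = W" using assms by (auto simp: unmask_def)
  then show thesis using that w(1) by blast
qed

lemma unmask_singleton: "v < k \<Longrightarrow> unmask (2 ^ v) = {v}"
proof -
  have "(2::nat) ^ v div 2 ^ u mod 2 = 1 \<longleftrightarrow> u = v" for u
  proof (cases "u \<le> v")
    case True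
    then have "(2::nat) ^ v div 2 ^ u = 2 ^ (v - u)" by (simp add: power_diff)
    then show ?thesis using True by (cases "v - u") auto
  next
    case False
    then have "(2::nat) ^ v div 2 ^ u = 0" by (intro div_less power_strict_increasing) auto
    then show ?thesis using False by simp
  qed
  then have "elem x u (2 ^ v) \<longleftrightarrow> u = v" if "u < k" for u
    unfolding elem_eq[OF that] by blast
  then show "v < k \<Longrightarrow> unmask (2 ^ v) = {v}" by (auto simp: unmask_def)
qed

lemma trapped_num_eq: "trapped_num x c w = trapped c (unmask w)"
  unfolding trapped_num_unfold trapped_def sum_of_bool_card cls_def unmask_def
  by (rule arg_cong[of _ _ card]) (auto simp: colored)

lemma meet_num_eq: "meet_num x c w = meet c (unmask w)"
  unfolding meet_num_unfold meet_def sum_of_bool_card cls_def unmask_def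
  by (rule arg_cong[of _ _ card]) (auto simp: colored)

lemma key_num_eq: "v < k \<Longrightarrow> key_num x v c = key v c"
  by (simp add: key_num_unfold key_def meet_num_eq capped_power_2 unmask_singleton)

lemma rank_num_eq: "v < k \<Longrightarrow> rank_num x v c = color_rank v c"
  by (simp add: rank_num_unfold color_rank_def sum_of_bool_card key_num_eq del: sum_of_bool_eq)

lemma role_eq:
  assumes "j < 2 * k" "c < \<gamma>" "digit x z j = color_rank (vert j) c"
  shows "role x z j = c"
proof -
  let ?P = "\<lambda>c'. rank_num x (if j < k then j else j - k) c' = digit x z j"
  have P: "?P c' \<longleftrightarrow> color_rank (vert j) c' = color_rank (vert j) c" for c'
    using assms(1,3) by (auto simp: vert_def rank_num_eq)
  have "?P (role x z j)" "role x z j \<le> c"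
    using first_works[of ?P c "\<gamma>"] assms(2) P unfolding role_unfold by auto
  then show ?thesis using color_rank_inj[of "role x z j" c "vert j"] P assms(2) by auto
qed

lemma cap_num_eq: "cap_num x z c w = cap (role x z) c (unmask w)"
proof -
  have "(\<Sum>v<k. of_bool (elem x v w \<and> role x z (k + v) = c)) = card {v \<in> unmask w. role x z (k + v) = c}"
    unfolding sum_of_bool_card unmask_def by (rule arg_cong[of _ _ card]) auto
  then show ?thesis by (simp only: cap_num_unfold cap_def meet_num_eq)
qed

lemma lower_num_eq: "lower_num \<delta> x w = lower (unmask w)"
proof -
  let ?P = "\<lambda>y. \<delta> \<le> y \<and> (\<forall>c<\<gamma>. trapped_num x c w \<le> y)"
  have P: "?P y \<longleftrightarrow> lower (unmask w) \<le> y" for y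
    by (simp add: lower_le_iff trapped_num_eq)
  have "lower (unmask w) \<le> n + 1"
    using \<delta> trapped_le by (simp add: lower_le_iff le_SucI)
  then have "?P (lower_num \<delta> x w)" "lower_num \<delta> x w \<le> lower (unmask w)"
    using first_works[of ?P "lower (unmask w)" "n + 2"] P unfolding lower_num_unfold by auto
  then show ?thesis using P by (meson order_antisym)
qed

lemma row_num_eq:
  "i < k \<Longrightarrow> row_num \<delta> x z w s i = row (role x z) (digit x s i) (unmask (digit x w i))"
  by (simp add: row_num_unfold row_def cap_num_eq lower_num_eq)

lemma quota_sum_eq: "quota_sum \<delta> x z w s p W = sum (quota \<delta> x z w s p) (unmask W)"
proof -
  have "quota_sum \<delta> x z w s p W = (\<Sum>v | v < k \<and> elem x v W. quota \<delta> x z w s p v)"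
    unfolding quota_sum_unfold by (rule sum.mono_neutral_cong_right) auto
  then show ?thesis by (simp add: unmask_def)
qed

lemma verifies_iff: "verifies \<delta> x z w s p \<longleftrightarrow> certificate (role x z) (quota \<delta> x z w s p)"
proof -
  have all: "(\<forall>W<capped_power x 2 k. P (unmask W)) \<longleftrightarrow> (\<forall>W. W \<subseteq> {..<k} \<longrightarrow> P W)" for P
    unfolding capped_power_2[OF order.refl] by (metis mask_exists unmask_subset)
  have sl: "(\<forall>v<k. elem x v W \<longrightarrow> role x z v = c \<or> role x z (k + v) = c) \<longleftrightarrow>
      unmask W \<subseteq> slots (role x z) c" for W c
    by (auto simp: unmask_def slots_def)
  have sub: "(\<forall>W. W \<subseteq> {..<k} \<longrightarrow> W \<subseteq> slots (role x z) c \<longrightarrow> P W) \<longleftrightarrow>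
      (\<forall>W. W \<subseteq> slots (role x z) c \<longrightarrow> P W)" for c P
    using slots_subset by blast
  show ?thesis
    unfolding verifies_unfold certificate_def trapped_num_eq quota_sum_eq cap_num_eq sl
      all[of "\<lambda>W. trapped _ W \<le> sum _ W"] all[of "\<lambda>W. W \<subseteq> _ \<longrightarrow> sum _ W \<le> cap _ _ W"] sub
    by simp
qed

text \<open>Completeness: the ranks of the roles go into \<open>z\<close>, the nearly tight sets
  into \<open>w\<close>, their kinds into \<open>s\<close>, and the offsets from the least
  candidates into \<open>p\<close>.\<close>

lemma verifies_exists:
  assumes "solves f"
  obtains z w s p where "z < B ^ (2 * k)" "w < B ^ k" "s < B ^ k" "p < B ^ k" "verifies \<delta> x z w s p"
proof -
  note large = radix_large[of k, folded B_def]
  let ?D = "(k + 1) ^ k"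
  let ?K = "k * ?D"
  obtain \<rho>0 t0 where c0: "certificate \<rho>0 t0"
    using certificate_if_solves[OF cl assms] by blast
  obtain \<rho>1 where c1: "certificate \<rho>1 t0" "\<And>j. j < 2 * k \<Longrightarrow> color_rank (vert j) (\<rho>1 j) < 2 * k"
    using certificate_small_rank[OF c0] by blast
  obtain z where z: "z < B ^ (2 * k)" "\<forall>j<2 * k. z div B ^ j mod B = color_rank (vert j) (\<rho>1 j)"
    using digits_exist[of "2 * k" "\<lambda>j. color_rank (vert j) (\<rho>1 j)" B] c1(2) large(3)
    by (meson less_trans)
  define \<rho> where "\<rho> = role x z"
  have \<rho>: "\<rho> j = \<rho>1 j" if "j < 2 * k" for j
    unfolding \<rho>_def
  proof (rule role_eq[OF that])
    show "\<rho>1 j < \<gamma>"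
    proof (cases "j < k")
      case False
      then have "j = k + (j - k)" "j - k < k" using that by auto
      then show ?thesis using c1(1) unfolding certificate_def by metis
    qed (use c1(1) in \<open>auto simp: certificate_def\<close>)
    show "digit x z j = color_rank (vert j) (\<rho>1 j)" using z(2) that by (simp add: digit_eq)
  qed
  have cert0: "certificate \<rho> t0"
    by (rule certificate_cong[OF c1(1)]) (use \<rho> in auto)
  obtain t W \<sigma> where t: "certificate \<rho> t" "independent_sets k k W"
    "\<And>i. i < k \<Longrightarrow> W i \<subseteq> {..<k}" "\<And>i. i < k \<Longrightarrow> \<sigma> i \<le> 2 * k"
    "\<And>i. i < k \<Longrightarrow> \<bar>int (sum t (W i)) - int (row \<rho> (\<sigma> i) (W i))\<bar> \<le> int ?K"
    using certificate_nearly_tight[OF cert0] by blast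
  have "\<exists>m. m < 2 ^ k \<and> unmask m = W i" if "i < k" for i
    using mask_exists[OF t(3)[OF that]] by blast
  then obtain m where m: "\<And>i. i < k \<Longrightarrow> m i < 2 ^ k \<and> unmask (m i) = W i"
    by metis
  have "m i < B" if "i < k" for i using m[OF that] large(4) by simp
  then obtain w where w: "w < B ^ k" "\<forall>i<k. w div B ^ i mod B = m i"
    using digits_exist[of k m B] by blast
  have "\<sigma> i < B" if "i < k" for i using t(4)[OF that] large(3) by simp
  then obtain s where s: "s < B ^ k" "\<forall>i<k. s div B ^ i mod B = \<sigma> i"
    using digits_exist[of k \<sigma> B] by blast
  have dw: "digit x w i = m i" "digit x s i = \<sigma> i" if "i < k" for i
    using w(2) s(2) that by (simp_all add: digit_eq)
  define R where "R = (\<lambda>i. row_num \<delta> x z w s i)"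
  have tight: "\<bar>(\<Sum>v\<in>W i. int (t v)) - int (R i)\<bar> \<le> int ?K" if "i < k" for i
    using t(5)[OF that] m[OF that] that by (simp add: R_def row_num_eq dw \<rho>_def)
  have el: "elem x u (digit x w i) \<longleftrightarrow> u \<in> W i" if "i < k" "u < k" for i u
    using m[OF that(1)] that by (auto simp: dw unmask_def)
  define S where "S = (\<Sum>i<k. R i)"
  have cand_iff: "candidate \<delta> x z w s v y \<longleftrightarrow> (\<exists>q<B ^ (k + 1). inverse_row x w v q \<and>
      digit x q k * y + ?D * S \<le> (\<Sum>i<k. digit x q i * R i) + ?K * ?K \<and>
      (\<Sum>i<k. digit x q i * R i) \<le> digit x q k * y + ?D * S + ?K * ?K)" for v y
    unfolding candidate_unfold coeff_bound_eq R_def S_def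
    using capped_power_radix[of "k + 1"] by (simp add: mult.assoc)
  \<comment> \<open>Stored coefficients exceed the true ones by \<open>?D\<close>, which adds
    \<open>?D * S\<close> to the weighted sum of right-hand sides.\<close>
  have shift: "int (\<Sum>i<k. digit x q i * R i) = (\<Sum>i<k. (int (digit x q i) - int ?D) * int (R i)) + int ?D * int S"
    for q
    by (simp add: S_def left_diff_distrib sum_subtractf sum_distrib_left)
  \<comment> \<open>Holds for every \<open>q\<close> that passes \<open>inverse_row\<close>, not
    just for the row constructed in \<open>cand\<close>.\<close>
  have approx: "\<bar>int (digit x q k) * int (t v) - (\<Sum>i<k. (int (digit x q i) - int ?D) * int (R i))\<bar> \<le> int (?K * ?K)"
    if v: "v < k" and q: "inverse_row x w v q" for v q
  proof -
    have "\<bar>int (digit x q k) * int (t v) - (\<Sum>i<k. (int (digit x q i) - int ?D) * int (R i))\<bar>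
        \<le> int k * (int ?D * int ?K)"
    proof (rule approximation_by_inverse_row[OF v t(3) tight])
      fix i assume i: "i < k"
      have "digit x q i \<le> 2 * ?D" using q i unfolding inverse_row_unfold coeff_bound_eq by blast
      then show "\<bar>int (digit x q i) - int ?D\<bar> \<le> int ?D" by linarith
    next
      fix u assume u: "u < k"
      have "(\<Sum>i<k. digit x q i * of_bool (elem x u (digit x w i))) =
          digit x q k * of_bool (u = v) + ?D * (\<Sum>i<k. of_bool (elem x u (digit x w i)))"
        using q u unfolding inverse_row_unfold coeff_bound_eq by blast
      then have "(\<Sum>i<k. digit x q i * of_bool (u \<in> W i)) =
          digit x q k * of_bool (u = v) + ?D * (\<Sum>i<k. of_bool (u \<in> W i))"
        using el u by (simp del: sum_of_bool_eq sum_mult_of_bool_eq sum_of_bool_mult_eq cong: sum.cong_simp)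
      from arg_cong[OF this, of int]
      show "(\<Sum>i<k. (int (digit x q i) - int ?D) * of_bool (u \<in> W i)) = int (digit x q k) * of_bool (u = v)"
        by (simp add: left_diff_distrib sum_subtractf sum_distrib_left
            del: sum_of_bool_eq sum_mult_of_bool_eq sum_of_bool_mult_eq)
    qed
    then show ?thesis by (simp add: mult.assoc mult.left_commute)
  qed
  have cand: "candidate \<delta> x z w s v (t v)" if v: "v < k" for v
  proof -
    obtain q d where q: "0 < d" "d \<le> int ?D" "\<And>i. i < k \<Longrightarrow> \<bar>q i\<bar> \<le> int ?D"
      "\<And>u. u < k \<Longrightarrow> (\<Sum>i<k. q i * of_bool (u \<in> W i)) = d * of_bool (u = v)"
      by (rule bounded_inverse_row[OF t(2) v]) (rule that)
    define g where "g = (\<lambda>i. if i < k then nat (q i + int ?D) else nat d)"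
    have g: "int (g i) = q i + int ?D" "g i \<le> 2 * ?D" if "i < k" for i
    proof -
      have "0 \<le> q i + int ?D" using q(3)[OF that] by linarith
      then show 1: "int (g i) = q i + int ?D"
        unfolding g_def if_P[OF that] by (rule int_nat_eq[THEN trans, OF if_P])
      show "g i \<le> 2 * ?D" using q(3)[OF that] 1 by linarith
    qed
    have gk1: "int (g k) = d" using q(1) by (simp add: g_def)
    then have "int (g k) \<le> int ?D" using q(2) by simp
    then have "g k \<le> ?D" by (simp only: of_nat_le_iff)
    note gk = gk1 this
    have "g i < B" if "i < k + 1" for i
      using g(2)[of i] gk(2) large(2) that by (cases "i = k") auto
    then obtain c where c: "c < B ^ (k + 1)" "\<forall>i<k + 1. c div B ^ i mod B = g i"
      using digits_exist[of "k + 1" g B] by blast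
    have dc: "digit x c i = g i" if "i \<le> k" for i using c(2) that by (simp add: digit_eq)
    have inv: "inverse_row x w v c"
      unfolding inverse_row_unfold coeff_bound_eq
    proof (intro conjI allI impI)
      show "0 < digit x c k" using gk q(1) dc[of k] by linarith
      show "digit x c i \<le> 2 * ?D" if "i < k" for i using g(2)[OF that] dc[of i] that by simp
      fix u assume u: "u < k"
      have "int (\<Sum>i<k. g i * of_bool (u \<in> W i)) = (\<Sum>i<k. (q i + int ?D) * of_bool (u \<in> W i))"
        unfolding of_nat_sum
        by (rule sum.cong[OF refl]) (simp only: of_nat_mult g(1) lessThan_iff of_nat_of_bool)
      also have "\<dots> = (\<Sum>i<k. q i * of_bool (u \<in> W i)) + int ?D * (\<Sum>i<k. of_bool (u \<in> W i))"
        by (simp only: distrib_right sum.distrib sum_distrib_left)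
      also have "\<dots> = int (g k * of_bool (u = v) + ?D * (\<Sum>i<k. of_bool (u \<in> W i)))"
        by (simp only: q(4)[OF u] gk(1) of_nat_add of_nat_mult of_nat_of_bool of_nat_sum)
      finally have "(\<Sum>i<k. g i * of_bool (u \<in> W i)) = g k * of_bool (u = v) + ?D * (\<Sum>i<k. of_bool (u \<in> W i))"
        by (simp only: of_nat_eq_iff)
      then show "(\<Sum>i<k. digit x c i * of_bool (elem x u (digit x w i))) =
          digit x c k * of_bool (u = v) + ?D * (\<Sum>i<k. of_bool (elem x u (digit x w i)))"
        using el u dc
        by (simp del: sum_of_bool_eq sum_mult_of_bool_eq sum_of_bool_mult_eq cong: sum.cong_simp)
    qed
    have "int (digit x c k * t v + ?D * S) \<le> int ((\<Sum>i<k. digit x c i * R i) + ?K * ?K)"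
      "int (\<Sum>i<k. digit x c i * R i) \<le> int (digit x c k * t v + ?D * S + ?K * ?K)"
      unfolding of_nat_add shift of_nat_mult[of _ "t v"] of_nat_mult[of _ S]
      using approx[OF v inv] unfolding abs_le_iff by linarith+
    then show ?thesis
      unfolding cand_iff using c(1) inv by (intro exI[of _ c]) (simp only: of_nat_le_iff simp_thms)
  qed
  define y where "y = (\<lambda>v. first (n + 1) (candidate \<delta> x z w s v))"
  have y: "candidate \<delta> x z w s v (y v)" "y v \<le> t v" if "v < k" for v
    using first_works[of "candidate \<delta> x z w s v" "t v" "n + 1"] cand[OF that]
      certificate_le[OF t(1) that] by (auto simp: y_def)
  have off: "t v - y v < B" if v: "v < k" for v
  proof -
    \<comment> \<open>The row that admits \<open>y v\<close> may differ from the one for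
      \<open>t v\<close>, but \<open>approx\<close> applies to it as well. The two errors add up,
      and the denominator is at least 1.\<close>
    obtain q where q: "inverse_row x w v q"
      "(\<Sum>i<k. digit x q i * R i) \<le> digit x q k * y v + ?D * S + ?K * ?K"
      using y(1)[OF v] unfolding cand_iff by blast
    have d: "0 < digit x q k" using q(1) by (simp add: inverse_row_unfold)
    have "int (\<Sum>i<k. digit x q i * R i) \<le> int (digit x q k * y v + ?D * S + ?K * ?K)"
      using q(2) by (simp only: of_nat_le_iff)
    then have "int (digit x q k * t v) \<le> int (digit x q k * y v + 2 * (?K * ?K))"
      using approx[OF v q(1)]
      unfolding of_nat_add shift of_nat_mult[of _ "t v"] of_nat_mult[of _ S] of_nat_mult[of 2] abs_le_iff
      by simp
    then have "digit x q k * (t v - y v) \<le> 2 * (?K * ?K)"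
      using y(2)[OF v] by (simp only: of_nat_le_iff diff_mult_distrib2)
    moreover have "1 * (t v - y v) \<le> digit x q k * (t v - y v)"
      using d by (intro mult_le_mono1) simp
    ultimately show ?thesis using large(1) by linarith
  qed
  then obtain p where p: "p < B ^ k" "\<forall>v<k. p div B ^ v mod B = t v - y v"
    using digits_exist[of k "\<lambda>v. t v - y v" B] by blast
  have quota: "quota \<delta> x z w s p v = t v" if "v < k" for v
  proof -
    have "quota \<delta> x z w s p v = y v + digit x p v" by (simp only: quota_unfold y_def)
    then show ?thesis using p(2) that y(2)[OF that] by (simp add: digit_eq)
  qed
  have "certificate \<rho> (quota \<delta> x z w s p)"
    by (rule certificate_cong[OF t(1)]) (use quota in auto)
  then have "verifies \<delta> x z w s p" unfolding verifies_iff \<rho>_def .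
  then show thesis using that z(1) w(1) s(1) p(1) by blast
qed

theorem accepts_iff: "accepts \<delta> x \<longleftrightarrow> (\<exists>f. solves f)"
proof
  assume "accepts \<delta> x"
  then obtain z w s p where "certificate (role x z) (quota \<delta> x z w s p)"
    unfolding accepts_unfold verifies_iff by blast
  then show "\<exists>f. solves f" using solves_if_certificate[OF cl] by blast
next
  assume "\<exists>f. solves f"
  then obtain z w s p where "z < B ^ (2 * k)" "w < B ^ k" "s < B ^ k" "p < B ^ k"
    "verifies \<delta> x z w s p"
    using verifies_exists by blast
  then show "accepts \<delta> x"
    unfolding accepts_unfold using capped_power_radix[of "2 * k"] capped_power_radix[of k] by auto
qed

end

section \<open>Encoded instances\<close>

text \<open>Two zeros appended to the sorted list merge the three cases into one difference and keep
  the order, as counts are nonnegative. A permutation then carries the first two positions over to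
  positions in the unsorted list.\<close>

lemma gap_of_two_largest:
  fixes L :: "nat list"
  defines "L' \<equiv> L @ [0, 0]"
  shows "(case rev (sort L) of [] \<Rightarrow> 0 | [a] \<Rightarrow> a | a # b # _ \<Rightarrow> a - b) \<le> l \<longleftrightarrow>
    (\<exists>c1<length L + 2. \<exists>c2<length L + 2. c1 \<noteq> c2 \<and> (\<forall>c<length L + 2. L' ! c \<le> L' ! c1) \<and>
       L' ! c1 \<le> L' ! c2 + l)"
proof -
  define T where "T = rev (sort L) @ [0, 0]"
  have gap: "(case rev (sort L) of [] \<Rightarrow> 0 | [a] \<Rightarrow> a | a # b # _ \<Rightarrow> a - b) = T ! 0 - T ! 1"
    by (auto simp: T_def split: list.split)
  have len: "length T = length L + 2" "length L' = length L + 2" by (simp_all add: T_def L'_def)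
  have dec: "T ! j \<le> T ! i" if "i \<le> j" "j < length T" for i j
  proof -
    have "sorted (rev T)" by (simp add: T_def)
    then have "sorted_wrt (\<ge>) T" by (simp add: sorted_wrt_rev)
    then show ?thesis using that by (cases "i = j") (auto simp: sorted_wrt_iff_nth_less)
  qed
  have "mset T = mset L'" by (simp add: T_def L'_def)
  then obtain \<pi> where \<pi>: "\<pi> permutes {..<length L'}" "permute_list \<pi> L' = T"
    by (rule mset_eq_permutation)
  have T: "T ! i = L' ! \<pi> i" if "i < length T" for i
    using permute_list_nth[OF \<pi>(1), of i] that \<pi>(2) len by simp
  have \<pi>_less: "\<pi> i < length L + 2" if "i < length L + 2" for i
    using permutes_in_image[OF \<pi>(1), of i] that len by simp
  have onto: "\<exists>i<length L + 2. \<pi> i = c" if "c < length L + 2" for c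
    using permutes_surj[OF \<pi>(1)] permutes_in_image[OF \<pi>(1)] that len
    by (metis lessThan_iff surjD)
  show ?thesis
    unfolding gap
  proof
    assume le: "T ! 0 - T ! 1 \<le> l"
    have "\<pi> 0 \<noteq> \<pi> 1" using permutes_inj[OF \<pi>(1)] by (metis injD zero_neq_one)
    moreover have "L' ! c \<le> L' ! \<pi> 0" if c: "c < length L + 2" for c
    proof -
      obtain i where i: "i < length L + 2" "\<pi> i = c" using onto[OF c] by blast
      then show ?thesis using dec[of 0 i] T[of i] T[of 0] len by simp
    qed
    moreover have "L' ! \<pi> 0 \<le> L' ! \<pi> 1 + l" using le T[of 0] T[of 1] len by simp
    ultimately show "\<exists>c1<length L + 2. \<exists>c2<length L + 2. c1 \<noteq> c2 \<and>
        (\<forall>c<length L + 2. L' ! c \<le> L' ! c1) \<and> L' ! c1 \<le> L' ! c2 + l"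
      using \<pi>_less[of 0] \<pi>_less[of 1] by auto
  next
    assume "\<exists>c1<length L + 2. \<exists>c2<length L + 2. c1 \<noteq> c2 \<and>
        (\<forall>c<length L + 2. L' ! c \<le> L' ! c1) \<and> L' ! c1 \<le> L' ! c2 + l"
    then obtain c1 c2 where c: "c1 < length L + 2" "c2 < length L + 2" "c1 \<noteq> c2"
      "\<forall>c<length L + 2. L' ! c \<le> L' ! c1" "L' ! c1 \<le> L' ! c2 + l" by blast
    obtain i1 where i1: "i1 < length L + 2" "\<pi> i1 = c1" using onto[OF c(1)] by blast
    obtain i2 where i2: "i2 < length L + 2" "\<pi> i2 = c2" using onto[OF c(2)] by blast
    have 0: "T ! 0 \<le> T ! i1" using c(4) \<pi>_less[of 0] T[of 0] T[of i1] i1 len by simp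
    have 1: "T ! 0 \<le> T ! i2 + l" using 0 c(5) T[of i1] T[of i2] i1 i2 len by simp
    show "T ! 0 - T ! 1 \<le> l"
    \<comment> \<open>If \<open>c2\<close> itself comes first in the order, then \<open>c1\<close>
      is another maximum further down, so the gap is 0.\<close>
    proof (cases "i2 = 0")
      case True
      then have "i1 \<noteq> 0" using c(3) i1 i2 by (cases "i1 = 0") auto
      then show ?thesis using 0 dec[of 1 i1] i1 len by simp
    next
      case False
      then show ?thesis using 1 dec[of 1 i2] i2 len by simp
    qed
  qed
qed

lemma MoV_le_iff:
  fixes col :: "'v \<Rightarrow> 'c" and W :: "'v set"
  assumes "distinct cs"
  defines "a \<equiv> \<lambda>c. if c < length cs then card (color_class col W (cs ! c)) else 0"
  shows "MoV (set cs) col W \<le> l \<longleftrightarrow>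
    (\<exists>c1<length cs + 2. \<exists>c2<length cs + 2. c1 \<noteq> c2 \<and> (\<forall>c<length cs + 2. a c \<le> a c1) \<and>
       a c1 \<le> a c2 + l)"
proof -
  let ?L = "map (\<lambda>c. card (color_class col W c)) cs"
  have "sorted_list_of_multiset (image_mset (\<lambda>c. card (color_class col W c)) (mset_set (set cs))) = sort ?L"
    using assms(1) by (metis mset_map mset_set_set sorted_list_of_multiset_mset)
  moreover have "(?L @ [0, 0]) ! c = a c" if "c < length cs + 2" for c
  proof -
    have "c < length cs \<or> c = length cs \<or> c = length cs + 1" using that by auto
    then show ?thesis by (auto simp: a_def nth_append)
  qed
  ultimately show ?thesis
    unfolding MoV_def using gap_of_two_largest[of ?L l] by (simp cong: conj_cong)
qed

section \<open>Reading instances off their encodings\<close>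

lemma concat_pairs_nth:
  assumes "e < length es"
  shows "concat (map (\<lambda>(u, v). [u, v]) es) ! (2 * e) = fst (es ! e)"
    "concat (map (\<lambda>(u, v). [u, v]) es) ! (2 * e + 1) = snd (es ! e)"
  using assms
proof (induction es arbitrary: e)
  case (Cons p es)
  { case 1 then show ?case using Cons.IH(1)[of "e - 1"] by (cases e; cases p) auto }
  { case 2 then show ?case using Cons.IH(2)[of "e - 1"] by (cases e; cases p) auto }
qed auto

lemma length_concat_pairs: "length (concat (map (\<lambda>(u, v). [u, v]) es)) = 2 * length es"
  by (induction es) auto

locale encoded_instance =
  fixes I :: "(nat, nat) mov_instance" and x us vs :: "nat list" and es :: "(nat \<times> nat) list"
    and cs :: "nat list" and \<delta> :: nat
  assumes valid: "valid_instance I"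
    and us: "distinct us" "set us = left_side I"
    and vs: "distinct vs" "set vs = right_side I"
    and es: "set es \<subseteq> left_side I \<times> right_side I" "(\<lambda>(u, v). {u, v}) ` set es = edges I"
    and cs: "distinct cs" "set cs = colors I"
    and x: "x = [length us, length vs, length es, length cs, fairness I]
      @ us @ map (coloring I) us @ vs @ concat (map (\<lambda>(u, v). [u, v]) es) @ cs"
    and \<delta>: "\<delta> \<le> 1"
begin

abbreviation "n \<equiv> length us"
abbreviation "k \<equiv> length vs"

definition cl :: "nat \<Rightarrow> nat" where
  "cl i = (THE c. c < length cs \<and> cs ! c = coloring I (us ! i))"

lemma length_x: "length x = 5 + 2 * n + k + 2 * length es + length cs"
  by (simp add: x length_concat_pairs)

lemma header: "x ! 0 = n" "x ! 1 = k" "x ! 2 = length es" "x ! 3 = length cs" "x ! 4 = fairness I"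
  by (simp_all add: x)

lemma well_formed_x: "well_formed x"
  by (simp add: well_formed_def length_x header del: One_nat_def)

lemma entries:
  "i < n \<Longrightarrow> entry x (5 + i) = us ! i"
  "i < n \<Longrightarrow> entry x (5 + n + i) = coloring I (us ! i)"
  "j < k \<Longrightarrow> entry x (5 + 2 * n + j) = vs ! j"
  "e < length es \<Longrightarrow> entry x (5 + 2 * n + k + 2 * e) = fst (es ! e)"
  "e < length es \<Longrightarrow> entry x (5 + 2 * n + k + 2 * e + 1) = snd (es ! e)"
  "c < length cs \<Longrightarrow> entry x (5 + 2 * n + k + 2 * length es + c) = cs ! c"
proof -
  define ps where "ps = concat (map (\<lambda>(u, v). [u, v]) es)"
  have ps: "length ps = 2 * length es" by (simp add: ps_def length_concat_pairs)
  have x': "x = [length us, length vs, length es, length cs, fairness I] @ us @ map (coloring I) us @ vs @ ps @ cs"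
    by (simp add: x ps_def)
  have nth: "entry x i = x ! i" if "i < length x" for i using that by (simp add: entry_def)
  show "i < n \<Longrightarrow> entry x (5 + i) = us ! i"
    by (subst nth) (auto simp: length_x x' nth_append)
  show "i < n \<Longrightarrow> entry x (5 + n + i) = coloring I (us ! i)"
    by (subst nth) (auto simp: length_x x' nth_append)
  show "j < k \<Longrightarrow> entry x (5 + 2 * n + j) = vs ! j"
    by (subst nth) (auto simp: length_x x' nth_append)
  show "e < length es \<Longrightarrow> entry x (5 + 2 * n + k + 2 * e) = fst (es ! e)"
    using concat_pairs_nth(1)[of e es, folded ps_def]
    by (subst nth) (auto simp: length_x x' nth_append ps)
  show "e < length es \<Longrightarrow> entry x (5 + 2 * n + k + 2 * e + 1) = snd (es ! e)"
    using concat_pairs_nth(2)[of e es, folded ps_def]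
    by (subst nth) (auto simp: length_x x' nth_append ps)
  show "c < length cs \<Longrightarrow> entry x (5 + 2 * n + k + 2 * length es + c) = cs ! c"
    by (subst nth) (auto simp: length_x x' nth_append ps)
qed

lemma disjoint: "left_side I \<inter> right_side I = {}"
  using valid by (simp add: valid_instance_def bipartite_graph_def)

lemma us_in: "i < n \<Longrightarrow> us ! i \<in> left_side I"
  using us(2) nth_mem by blast

lemma vs_in: "j < k \<Longrightarrow> vs ! j \<in> right_side I"
  using vs(2) nth_mem by blast

lemma cl_index: "i < n \<Longrightarrow> cl i < length cs" "i < n \<Longrightarrow> cs ! cl i = coloring I (us ! i)"
proof -
  have "cl i < length cs \<and> cs ! cl i = coloring I (us ! i)" if i: "i < n"
  proof -
    have "coloring I (us ! i) \<in> set cs"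
      using valid us_in[OF i] cs(2) by (auto simp: valid_instance_def)
    then obtain c where c: "c < length cs" "cs ! c = coloring I (us ! i)"
      by (auto simp: in_set_conv_nth)
    have "\<exists>!c. c < length cs \<and> cs ! c = coloring I (us ! i)"
    proof (rule ex1I[of _ c])
      fix c' assume "c' < length cs \<and> cs ! c' = coloring I (us ! i)"
      then show "c' = c" using c nth_eq_iff_index_eq[OF cs(1), of c' c] by simp
    qed (use c in simp)
    then show ?thesis unfolding cl_def by (rule theI')
  qed
  then show "i < n \<Longrightarrow> cl i < length cs" "i < n \<Longrightarrow> cs ! cl i = coloring I (us ! i)" by auto
qed

lemma colored_iff: "i < n \<Longrightarrow> colored x i c \<longleftrightarrow> cl i = c"
  using cl_index[of i] cs(1)
  by (auto simp: colored_def header entries nth_eq_iff_index_eq simp del: One_nat_def)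

lemma adjacent_iff:
  assumes "i < n" "j < k"
  shows "adjacent x i j \<longleftrightarrow> {us ! i, vs ! j} \<in> edges I"
proof -
  have "adjacent x i j \<longleftrightarrow> (\<exists>e<length es. fst (es ! e) = us ! i \<and> snd (es ! e) = vs ! j)"
    unfolding adjacent_def header using assms by (simp only: entries cong: conj_cong)
  also have "\<dots> \<longleftrightarrow> (us ! i, vs ! j) \<in> set es"
    by (auto simp: in_set_conv_nth prod_eq_iff)
  also have "\<dots> \<longleftrightarrow> {us ! i, vs ! j} \<in> (\<lambda>(u, v). {u, v}) ` set es"
  proof
    assume "{us ! i, vs ! j} \<in> (\<lambda>(u, v). {u, v}) ` set es"
    then obtain u v where "(u, v) \<in> set es" "{us ! i, vs ! j} = {u, v}" by auto
    moreover have "u \<in> left_side I" "v \<in> right_side I" using calculation(1) es(1) by auto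
    \<comment> \<open>The two sides are disjoint, so the unordered edge has only one
      orientation.\<close>
    ultimately show "(us ! i, vs ! j) \<in> set es"
      using us_in[OF assms(1)] vs_in[OF assms(2)] disjoint by (auto simp: doubleton_eq_iff)
  qed force
  finally show ?thesis using es(2) by simp
qed

sublocale input_instance x n k "length cs + 2" "min (fairness I) n" \<delta> cl
proof
  show "cl i < length cs + 2" if "i < n" for i using cl_index(1)[OF that] by simp
qed (use \<delta> colored_iff in \<open>simp_all add: header del: One_nat_def\<close>)

definition represents :: "nat set set \<Rightarrow> (nat \<Rightarrow> nat) \<Rightarrow> bool" where
  "represents M f \<longleftrightarrow> (\<forall>j<k. partners M (vs ! j) = (!) us ` {i. i < n \<and> f i = j})"

lemma inj_us: "inj_on ((!) us) {i. i < n \<and> P i}"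
  using us(1) by (auto simp: inj_on_def nth_eq_iff_index_eq)

lemma represents_iff:
  assumes r: "represents M f" and j: "j < k"
  shows "fair_set (colors I) (coloring I) (fairness I) (partners M (vs ! j)) \<longleftrightarrow>
      (\<exists>c1<length cs + 2. \<exists>c2<length cs + 2. c1 \<noteq> c2 \<and>
        (\<forall>c<length cs + 2. fibre (cls c) f j \<le> fibre (cls c1) f j) \<and>
        fibre (cls c1) f j \<le> fibre (cls c2) f j + min (fairness I) n)"
    "partners M (vs ! j) \<noteq> {} \<longleftrightarrow> 1 \<le> fibre {..<n} f j"
proof -
  have P: "partners M (vs ! j) = (!) us ` {i. i < n \<and> f i = j}"
    using r j by (simp add: represents_def)
  have count: "(if c < length cs then card (color_class (coloring I) (partners M (vs ! j)) (cs ! c)) else 0)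
      = fibre (cls c) f j" for c
  proof (cases "c < length cs")
    case True
    have "color_class (coloring I) (partners M (vs ! j)) (cs ! c) = (!) us ` {i. i < n \<and> cl i = c \<and> f i = j}"
    proof -
      have "coloring I (us ! i) = cs ! c \<longleftrightarrow> cl i = c" if "i < n" for i
        using cl_index[OF that] True cs(1) nth_eq_iff_index_eq[of cs "cl i" c] by metis
      then show ?thesis unfolding color_class_def P by auto
    qed
    then show ?thesis
      using True card_image[OF inj_us] by (simp add: fibre_def cls_def conj_assoc)
  next
    case False
    then have "cls c = {}" using cl_index(1) by (auto simp: cls_def)
    then show ?thesis using False by (simp add: fibre_def)
  qed
  have le: "fibre (cls c) f j \<le> n" for c
  proof -
    have "fibre (cls c) f j \<le> fibre {..<n} f j" by (rule fibre_cls_le)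
    also have "\<dots> \<le> card {..<n}" unfolding fibre_def by (rule card_mono) auto
    finally show ?thesis by simp
  qed
  \<comment> \<open>No count exceeds \<open>n\<close>, so capping the fairness at \<open>n\<close>
    changes nothing.\<close>
  have min: "fibre (cls c1) f j \<le> fibre (cls c2) f j + min (fairness I) n \<longleftrightarrow>
      fibre (cls c1) f j \<le> fibre (cls c2) f j + fairness I" for c1 c2
    using le[of c1] by (auto simp: min_def)
  show "fair_set (colors I) (coloring I) (fairness I) (partners M (vs ! j)) \<longleftrightarrow>
      (\<exists>c1<length cs + 2. \<exists>c2<length cs + 2. c1 \<noteq> c2 \<and>
        (\<forall>c<length cs + 2. fibre (cls c) f j \<le> fibre (cls c1) f j) \<and>
        fibre (cls c1) f j \<le> fibre (cls c2) f j + min (fairness I) n)"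
    unfolding fair_set_def cs(2)[symmetric] MoV_le_iff[OF cs(1)] count min ..
  show "partners M (vs ! j) \<noteq> {} \<longleftrightarrow> 1 \<le> fibre {..<n} f j"
    unfolding P by (auto simp: fibre_def Suc_le_eq card_gt_0_iff)
qed

lemma solves_iff_matching:
  "(\<exists>f. solves f) \<longleftrightarrow>
     (\<exists>M. MoV_solution I M \<and> (\<delta> = 1 \<longrightarrow> (\<forall>v\<in>right_side I. partners M v \<noteq> {})))"
proof -
  \<comment> \<open>Serves both directions: fairness and non-emptiness depend only on the sets of
    partners, which \<open>f\<close> represents.\<close>
  have rep: "(\<forall>v<k. \<delta> \<le> fibre {..<n} f v \<and>
      (\<exists>c1<length cs + 2. \<exists>c2<length cs + 2. c1 \<noteq> c2 \<and>
        (\<forall>c<length cs + 2. fibre (cls c) f v \<le> fibre (cls c1) f v) \<and>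
        fibre (cls c1) f v \<le> fibre (cls c2) f v + min (fairness I) n)) \<longleftrightarrow>
    fair_matching (right_side I) (colors I) (coloring I) (fairness I) M \<and>
      (\<delta> = 1 \<longrightarrow> (\<forall>v\<in>right_side I. partners M v \<noteq> {}))" if "represents M f" for M f
  proof -
    have all: "(\<forall>v\<in>right_side I. P v) \<longleftrightarrow> (\<forall>j<k. P (vs ! j))" for P
      unfolding vs(2)[symmetric] by (rule all_set_conv_all_nth)
    have "\<delta> = 0 \<or> \<delta> = 1" using \<delta> by auto
    then show ?thesis
      unfolding fair_matching_def all using represents_iff[OF that] by auto
  qed
  show ?thesis
  proof
    assume "\<exists>f. solves f"
    then obtain f where f: "solves f" by blast
    have fk: "f i < k" "{us ! i, vs ! f i} \<in> edges I" if "i < n" for i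
    proof -
      have "f i \<in> nbhd i" using f that unfolding solves_def by blast
      then show "f i < k" "{us ! i, vs ! f i} \<in> edges I" using adjacent_iff[OF that] by auto
    qed
    define M where "M = (\<lambda>i. {us ! i, vs ! f i}) ` {..<n}"
    have ne: "us ! i \<noteq> vs ! j" if "i < n" "j < k" for i j
      using us_in[OF that(1)] vs_in[OF that(2)] disjoint by auto
    have left: "partners M (us ! i) = {vs ! f i}" if "i < n" for i
      using that us(1) ne fk(1) unfolding partners_def M_def
      by (auto simp: doubleton_eq_iff nth_eq_iff_index_eq)
    have r: "represents M f"
      unfolding represents_def partners_def M_def
      using ne fk(1) vs(1) by (auto simp: doubleton_eq_iff nth_eq_iff_index_eq) metis+
    have "\<forall>v<k. \<delta> \<le> fibre {..<n} f v \<and>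
      (\<exists>c1<length cs + 2. \<exists>c2<length cs + 2. c1 \<noteq> c2 \<and>
        (\<forall>c<length cs + 2. fibre (cls c) f v \<le> fibre (cls c1) f v) \<and>
        fibre (cls c1) f v \<le> fibre (cls c2) f v + min (fairness I) n)"
      using f unfolding solves_def by (rule conjunct2)
    then have "fair_matching (right_side I) (colors I) (coloring I) (fairness I) M"
      "\<delta> = 1 \<longrightarrow> (\<forall>v\<in>right_side I. partners M v \<noteq> {})"
      unfolding rep[OF r] by blast+
    moreover have "M \<subseteq> edges I" using fk(2) by (auto simp: M_def)
    moreover have "card (partners M u) = 1" if "u \<in> left_side I" for u
      using that left unfolding us(2)[symmetric] by (auto simp: in_set_conv_nth)
    ultimately show "\<exists>M. MoV_solution I M \<and> (\<delta> = 1 \<longrightarrow> (\<forall>v\<in>right_side I. partners M v \<noteq> {}))"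
      unfolding MoV_solution_def many_to_one_matching_def left_perfect_def
      by (intro exI[of _ M] conjI ballI) (simp_all del: One_nat_def)
  next
    assume "\<exists>M. MoV_solution I M \<and> (\<delta> = 1 \<longrightarrow> (\<forall>v\<in>right_side I. partners M v \<noteq> {}))"
    then obtain M where M: "MoV_solution I M" "\<delta> = 1 \<longrightarrow> (\<forall>v\<in>right_side I. partners M v \<noteq> {})" by blast
    have sub: "M \<subseteq> edges I" and perfect: "\<And>u. u \<in> left_side I \<Longrightarrow> card (partners M u) = 1"
      and fair: "fair_matching (right_side I) (colors I) (coloring I) (fairness I) M"
      using M(1) by (auto simp: MoV_solution_def many_to_one_matching_def left_perfect_def)
    have ends: "u \<in> left_side I \<and> w \<in> right_side I \<or> u \<in> right_side I \<and> w \<in> left_side I"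
      if "{u, w} \<in> M" for u w
    proof -
      have "{u, w} \<in> (\<lambda>(u, v). {u, v}) ` set es" using that sub es(2) by blast
      then obtain a b where "(a, b) \<in> set es" "{u, w} = {a, b}" by auto
      then show ?thesis using es(1) by (auto simp: doubleton_eq_iff)
    qed
    have "\<exists>j<k. partners M (us ! i) = {vs ! j}" if i: "i < n" for i
    proof -
      obtain w where w: "partners M (us ! i) = {w}"
        using perfect[OF us_in[OF i]] by (auto simp: card_1_singleton_iff)
      then have "{us ! i, w} \<in> M" by (auto simp: partners_def)
      then have "w \<in> right_side I" using ends us_in[OF i] disjoint by blast
      then show ?thesis using w unfolding vs(2)[symmetric] by (auto simp: in_set_conv_nth)
    qed
    then obtain f where f: "\<And>i. i < n \<Longrightarrow> f i < k \<and> partners M (us ! i) = {vs ! f i}" by metis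
    have fM: "{us ! i, vs ! f i} \<in> M" if "i < n" for i
      using f[OF that] by (auto simp: partners_def)
    have "represents M f"
      unfolding represents_def
    proof (intro allI impI equalityI subsetI)
      fix j w assume j: "j < k" and "w \<in> partners M (vs ! j)"
      then have e: "{vs ! j, w} \<in> M" by (simp add: partners_def)
      then have "w \<in> left_side I" using ends vs_in[OF j] disjoint by blast
      then obtain i where i: "i < n" "w = us ! i"
        unfolding us(2)[symmetric] by (auto simp: in_set_conv_nth)
      then have "vs ! j \<in> partners M (us ! i)"
        using e by (simp add: partners_def insert_commute)
      then have "f i = j" using f[OF i(1)] j vs(1) by (auto simp: nth_eq_iff_index_eq)
      then show "w \<in> (!) us ` {i. i < n \<and> f i = j}" using i by auto
    next
      fix j w assume "w \<in> (!) us ` {i. i < n \<and> f i = j}"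
      then show "w \<in> partners M (vs ! j)" using fM by (auto simp: partners_def insert_commute)
    qed
    from rep[OF this] have fair_counts: "\<forall>v<k. \<delta> \<le> fibre {..<n} f v \<and>
      (\<exists>c1<length cs + 2. \<exists>c2<length cs + 2. c1 \<noteq> c2 \<and>
        (\<forall>c<length cs + 2. fibre (cls c) f v \<le> fibre (cls c1) f v) \<and>
        fibre (cls c1) f v \<le> fibre (cls c2) f v + min (fairness I) n)"
      using fair M(2) by blast
    have "f i \<in> nbhd i" if "i < n" for i
      using f[OF that] fM[OF that] sub adjacent_iff[OF that] by auto
    then have "solves f"
      unfolding solves_def using fair_counts by blast
    then show "\<exists>f. solves f" by blast
  qed
qed

end

lemma accepts_correct:
  assumes "valid_instance I" "encodes x I" "\<delta> \<le> 1"
  shows "accepts \<delta> x \<longleftrightarrow>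
      (\<exists>M. MoV_solution I M \<and> (\<delta> = 1 \<longrightarrow> (\<forall>v\<in>right_side I. partners M v \<noteq> {})))"
    and "well_formed x" and "x ! 1 = card (right_side I)"
proof -
  obtain us vs es cs where e: "distinct us" "set us = left_side I" "distinct vs" "set vs = right_side I"
    "set es \<subseteq> left_side I \<times> right_side I" "(\<lambda>(u, v). {u, v}) ` set es = edges I"
    "distinct cs" "set cs = colors I"
    "x = [length us, length vs, length es, length cs, fairness I]
      @ us @ map (coloring I) us @ vs @ concat (map (\<lambda>(u, v). [u, v]) es) @ cs"
    using assms(2) unfolding encodes_def by blast
  interpret encoded_instance I x us vs es cs \<delta>
    by unfold_locales (use assms e in auto)
  show "accepts \<delta> x \<longleftrightarrow>
      (\<exists>M. MoV_solution I M \<and> (\<delta> = 1 \<longrightarrow> (\<forall>v\<in>right_side I. partners M v \<noteq> {})))"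
    using accepts_iff solves_iff_matching by simp
  show "well_formed x" by (rule well_formed_x)
  show "x ! 1 = card (right_side I)"
    unfolding e(4)[symmetric] distinct_card[OF e(3)] by (rule header(2))
qed

section \<open>Running time and the final program\<close>

lemma load_input_at: "input_at x (load_input x)"
  by (simp add: input_at_def load_input_def)

text \<open>For \<open>k\<close> at least 2, the exponent is at most \<open>9 * k ^ 2\<close> and
  the base at most \<open>k ^ 2\<close>, whence \<open>18 * k ^ 2\<close>. The constant
  \<open>3 ^ 15\<close> is the value at \<open>k = 1\<close>; it also covers \<open>k = 0\<close>,
  where the power is \<open>0 ^ 0 = 1\<close>.\<close>

lemma threshold_le: "threshold x \<le> 3 ^ 15 * (x ! 1) ^ (18 * (x ! 1) ^ 2)"
proof -
  define k where "k = x ! 1"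
  have "(k + 2) ^ ((2 * k + 3) * (2 * k + 1)) \<le> 3 ^ 15 * k ^ (18 * k ^ 2)"
  proof (cases "k = 0 \<or> k = 1")
    case True
    then show ?thesis by (auto simp flip: numeral_2_eq_2 numeral_3_eq_3)
  next
    case False
    then have k: "2 \<le> k" by auto
    have k2: "2 * k \<le> k ^ 2" using k by (simp add: power2_eq_square)
    then have "4 \<le> k ^ 2" using k by linarith
    moreover have "(2 * k + 3) * (2 * k + 1) = 4 * k ^ 2 + 8 * k + 3"
      by (simp add: algebra_simps power2_eq_square)
    ultimately have "(2 * k + 3) * (2 * k + 1) \<le> 9 * k ^ 2"
      using k2 by linarith
    moreover have "k + 2 \<le> k ^ 2" using k k2 by linarith
    ultimately have "(k + 2) ^ ((2 * k + 3) * (2 * k + 1)) \<le> (k ^ 2) ^ (9 * k ^ 2)"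
      by (meson le_trans power_increasing power_mono zero_le k one_le_power one_le_numeral order.trans)
    also have "\<dots> = k ^ (18 * k ^ 2)" by (simp add: power_mult[symmetric])
    finally show ?thesis by simp
  qed
  then show ?thesis by (simp add: threshold_def k_def)
qed

text \<open>The run is a point distribution, so the answer is right with probability 1.\<close>

lemma randomized_decides_computable:
  assumes "computable 0 (\<lambda>x rs. of_bool (P x))"
  obtains c e where "\<And>x M. well_formed x \<Longrightarrow> bounds x [] M \<Longrightarrow> randomized_decides c x (P x) (M ^ e)"
proof -
  obtain p where p: "\<And>as \<tau>. length as = 0 \<Longrightarrow> (\<forall>a\<in>set as. a < \<tau>) \<Longrightarrow>
      \<exists>e. computes (p as \<tau>) as \<tau> e (\<lambda>x rs. of_bool (P x))"
    using assms unfolding computable_def by blast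
  from p[of "[]" 0] obtain e where e: "computes (p [] 0) [] 0 e (\<lambda>x rs. of_bool (P x))"
    by auto
  \<comment> \<open>Cell 0 holds a header entry, so the answer is computed in a register and moved
    there last.\<close>
  let ?out = "Assign (Num 0) (Mem (reg 0))"
  have run: "randomized_decides (Seq (p [] 0) ?out) x (P x) (M ^ (e + 255))"
    if a: "well_formed x" "bounds x [] M" for x M
  proof -
    have M: "2 \<le> M" using a(2) by (rule bounds_2)
    obtain s t where s: "exec (p [] 0) (load_input x) = return_spmf (s, t)" "t \<le> M ^ e" "input_at x s"
      "regs x s 0 = of_bool (P x)"
    proof -
      have "bounds x (map (regs x (load_input x)) []) M" using a(2) by simp
      from computesD[OF e a(1) load_input_at this] show thesis using that by blast
    qed
    let ?s = "s(0 := of_bool (P x))"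
    have out: "exec ?out s = return_spmf (?s, cost_expr (Num 0) s + cost_expr (Mem (reg 0)) s)"
      using eval_Mem_reg[OF a(1) s(3), of 0] s(4)
      unfolding exec_Assign by (simp del: eval_expr.simps(2) cost_expr.simps)
    have "regs x s 0 \<le> M" using s(4) M by (simp add: of_bool_def)
    then have "cost_expr (Num 0) s + cost_expr (Mem (reg 0)) s \<le> 253 * M"
      using cost_Mem_reg[OF a(1) s(3) a(2), of 0] cost_Num[of 0 s] M by simp
    also have "\<dots> \<le> M ^ (253 + 1)" by (rule mult_le_pow[OF le_pow[OF M]]) simp
    finally have "cost_expr (Num 0) s + cost_expr (Mem (reg 0)) s \<le> M ^ (253 + 1)" .
    from add_le_pow[OF M s(2) this]
    have "t + (cost_expr (Num 0) s + cost_expr (Mem (reg 0)) s) \<le> M ^ (e + 255)"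
      by (simp only: add.assoc) (simp only: numeral_plus_one numeral_plus_numeral one_plus_numeral semiring_norm)
    then show ?thesis
      unfolding randomized_decides_def exec_Seq[OF s(1) out]
      by (simp add: measure_spmf_return_spmf measure_return)
  qed
  show thesis by (rule that[of "Seq (p [] 0) ?out"]) (rule run)
qed

lemma randomized_Ostar_solves_accepts:
  assumes Q: "\<And>I x. valid_instance I \<Longrightarrow> encodes x I \<Longrightarrow> accepts \<delta> x = Q I" and \<delta>: "\<delta> \<le> 1"
  shows "\<exists>c f. (\<lambda>k. real (f k)) \<in> O(\<lambda>k. real k ^ 2) \<and> randomized_Ostar_solves c Q f"
proof -
  obtain c e where ce: "\<And>x M. well_formed x \<Longrightarrow> bounds x [] M \<Longrightarrow>
      randomized_decides c x (accepts \<delta> x) (M ^ e)"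
    using randomized_decides_computable[OF computable_accepts] by blast
  define f where "f = (\<lambda>k::nat. 18 * e * k ^ 2)"
  define p where "p = smult ((3 ^ 15) ^ e) ([:3, 1:] ^ e :: nat poly)"
  have "randomized_decides c x (Q I) (card (right_side I) ^ f (card (right_side I)) * poly p (input_size x))"
    if a: "valid_instance I" "encodes x I" for I x
  proof -
    note x = accepts_correct(2,3)[OF a \<delta>]
    let ?k = "card (right_side I)"
    define T where "T = 3 ^ 15 * ?k ^ (18 * ?k ^ 2)"
    have T: "threshold x \<le> T" using threshold_le[of x] unfolding x(2) T_def .
    moreover have "1 \<le> threshold x" by (simp add: threshold_def)
    ultimately have "1 \<le> T" by linarith
    \<comment> \<open>A product rather than a sum: \<open>M ^ e\<close> then splits into a power of
      \<open>T\<close>, giving the factor in \<open>k\<close>, and a polynomial in the input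
      size.\<close>
    define M where "M = (input_size x + 3) * T"
    have M: "input_size x + 2 + T \<le> M"
    proof -
      have "input_size x * 1 \<le> input_size x * T"
        using \<open>1 \<le> T\<close> by (rule mult_le_mono2)
      moreover have "M = input_size x * T + 3 * T" by (simp add: M_def algebra_simps)
      ultimately show ?thesis using \<open>1 \<le> T\<close> by linarith
    qed
    then have "bounds x [] M" using T by (simp add: bounds_def)
    then have "randomized_decides c x (Q I) (M ^ e)"
      using ce[OF x(1)] Q[OF a] by simp
    also have "M ^ e = ?k ^ f ?k * poly p (input_size x)"
      by (simp add: M_def T_def f_def p_def power_mult_distrib poly_power power_mult[symmetric] ac_simps)
    finally show ?thesis .
  qed
  then have "randomized_Ostar_solves c Q f"
    unfolding randomized_Ostar_solves_def by blast
  moreover have "(\<lambda>k. real (f k)) \<in> O(\<lambda>k. real k ^ 2)"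
    unfolding f_def by simp
  ultimately show ?thesis by blast
qed

theorem theorem15:
  shows "(\<exists>c f. (\<lambda>k. real (f k)) \<in> O(\<lambda>k. real k ^ 2) \<and>
            randomized_Ostar_solves c MoV_Fair_Matching f) \<and>
         (\<exists>c f. (\<lambda>k. real (f k)) \<in> O(\<lambda>k. real k ^ 2) \<and>
            randomized_Ostar_solves c MoV_Fair_Matching_nonempty f)"
proof
  show "\<exists>c f. (\<lambda>k. real (f k)) \<in> O(\<lambda>k. real k ^ 2) \<and> randomized_Ostar_solves c MoV_Fair_Matching f"
    by (rule randomized_Ostar_solves_accepts[of 0])
      (simp_all add: accepts_correct(1) MoV_Fair_Matching_def)
  show "\<exists>c f. (\<lambda>k. real (f k)) \<in> O(\<lambda>k. real k ^ 2) \<and>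
      randomized_Ostar_solves c MoV_Fair_Matching_nonempty f"
    by (rule randomized_Ostar_solves_accepts[of 1])
      (simp_all add: accepts_correct(1) MoV_Fair_Matching_nonempty_def)
qed

end
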